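(* Let $p\ge3$, fix $a\in\mathbb S^{p-1}$, and let $\psi:(-1,0)\cup(0,1)\to\mathbb R$ be Borel and finite almost everywhere. Define the measurable tangent field $$T_\psi(u):=\psi(a^\top u)\{a-(a^\top u)u\}$$ on $\mathbb S^{p-1}$ away from $a^\perp$, with an arbitrary definition on that null set. The following are equivalent. (i) For Haar-almost every oriented two-plane $P$, $\mathcal L\{T_\psi(U)^\top V\mid P\}=\mathrm{Cauchy}(0,1)$. (ii) $|\psi(t)|=1/|t|$ for Lebesgue-almost every $t\in(-1,1)$. Suppose moreover that these equivalent conditions hold and that $T_\psi$ is antipodally odd, i.e. $T_\psi(-u)=-T_\psi(u)$. Then necessarily, for Haar-almost every $u$, $$T_\psi(u)=\varepsilon(|a^\top u|)\Bigl\{\frac{a}{a^\top u}-u\Bigr\}$$ for some measurable $\varepsilon:(0,1)\to\{-1,1\}$; and conversely, for an arbitrary measurable sign function $\varepsilon:(0,1)\to\{-1,1\}$ the field given by this formula satisfies (i). If, in addition, $\psi$ is continuous on each of $(-1,0)$ and $(0,1)$, then $\varepsilon$ is constant, so only the reciprocal field $T_\psi(u)=\frac{a}{a^\top u}-u$ and its radial dual $T_\psi(u)=-\bigl(\frac{a}{a^\top u}-u\bigr)$ remain.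
   Context: $(U,V)$ is a Haar-distributed orthonormal two-frame in $\mathbb R^p$ (the first two columns of a Haar matrix in $O(p)$), and $P=\operatorname{span}\{U,V\}$ with the orientation induced by the ordered frame. $\mathcal L\{\cdot\mid P\}$ denotes the conditional law given $P$. Conditional on $P$ with positive orthonormal basis $(e_1,e_2)$, one has $U=e_1\cos\phi+e_2\sin\phi$, $V=-e_1\sin\phi+e_2\cos\phi$ with $\phi$ uniform modulo $2\pi$. (The radial dual of a tangent field $T$ here is $-T$.) *)

theory Defs
  imports "HOL-Probability.Probability"
begin

text \<open>Normalised Haar measure on the compact group \<open>O(p)\<close>, \<open>p = CARD('n)\<close>, characterised as the
  (unique) left-invariant Borel probability measure.\<close>

definition haar_orthogonal :: "(real ^ 'n ^ 'n) measure \<Rightarrow> bool" where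
  "haar_orthogonal H \<longleftrightarrow>
     prob_space H \<and>
     space H = {Q. orthogonal_matrix Q} \<and>
     sets H = sets (restrict_space borel {Q. orthogonal_matrix Q}) \<and>
     (\<forall>R. orthogonal_matrix R \<longrightarrow> distr H H (\<lambda>Q. R ** Q) = H)"

definition unit_sphere :: "(real ^ 'n) measure" where
  "unit_sphere = restrict_space borel (sphere 0 1)"

definition two_frames :: "((real ^ 'n) \<times> (real ^ 'n)) set" where
  "two_frames = {(u, v). norm u = 1 \<and> norm v = 1 \<and> u \<bullet> v = 0}"

text \<open>An oriented two-plane is encoded as the plane together with the set of its positively
  oriented orthonormal bases; the displayed expression in \<open>x, y\<close> is the determinant of \<open>(x, y)\<close>
  relative to the orthonormal basis \<open>(u, v)\<close> of the plane.\<close>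

type_synonym 'n oriented_plane = "(real ^ 'n) set \<times> ((real ^ 'n) \<times> (real ^ 'n)) set"

definition oriented_span :: "(real ^ 'n) \<times> (real ^ 'n) \<Rightarrow> 'n oriented_plane" where
  "oriented_span = (\<lambda>(u, v).
     (span {u, v},
      {(x, y) \<in> two_frames. x \<in> span {u, v} \<and> y \<in> span {u, v} \<and>
         (x \<bullet> u) * (y \<bullet> v) - (x \<bullet> v) * (y \<bullet> u) > 0}))"

text \<open>The set of all oriented two-planes with the quotient sigma-algebra of the map
  \<open>oriented_span\<close> on orthonormal two-frames (that is, the Borel sigma-algebra of the oriented
  Grassmannian).\<close>

definition oriented_planes :: "('n::finite) oriented_plane measure" where
  "oriented_planes = sigma (oriented_span ` two_frames)
     {A. A \<subseteq> oriented_span ` two_frames \<and> two_frames \<inter> oriented_span -` A \<in> sets borel}"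

text \<open>\<open>K\<close> is a (regular) conditional law of \<open>X\<close> given \<open>Y\<close>; on the Borel space \<open>\<real>\<close> it is unique up to
  null sets of the law of \<open>Y\<close>.\<close>

definition conditional_law ::
    "'w measure \<Rightarrow> 'y measure \<Rightarrow> ('w \<Rightarrow> 'y) \<Rightarrow> ('w \<Rightarrow> real) \<Rightarrow> ('y \<Rightarrow> real measure) \<Rightarrow> bool" where
  "conditional_law M N Y X K \<longleftrightarrow>
     Y \<in> measurable M N \<and> X \<in> borel_measurable M \<and>
     K \<in> measurable N (prob_algebra borel) \<and>
     (\<forall>A \<in> sets N. \<forall>B \<in> sets borel.
        emeasure M {\<omega> \<in> space M. Y \<omega> \<in> A \<and> X \<omega> \<in> B} =
        (\<integral>\<^sup>+ y \<in> A. emeasure (K y) B \<partial>distr M N Y))"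

definition standard_cauchy :: "real measure" where
  "standard_cauchy = density lborel (\<lambda>x. ennreal (1 / (pi * (1 + x\<^sup>2))))"

text \<open>With \<open>Q\<close> Haar distributed, \<open>U = column i Q\<close>, \<open>V = column j Q\<close> and \<open>P\<close> the oriented span of
  \<open>(U, V)\<close>: the conditional law of \<open>T(U)\<^sup>T V\<close> given \<open>P\<close> is \<open>Cauchy(0, 1)\<close> for almost every \<open>P\<close>.\<close>

definition cauchy_on_planes ::
    "(real ^ 'n ^ 'n) measure \<Rightarrow> 'n \<Rightarrow> 'n \<Rightarrow> (real ^ 'n \<Rightarrow> real ^ 'n) \<Rightarrow> bool" where
  "cauchy_on_planes H i j T \<longleftrightarrow>
     (let plane = (\<lambda>Q. oriented_span (column i Q, column j Q)) in
      \<exists>K. conditional_law H oriented_planes plane (\<lambda>Q. T (column i Q) \<bullet> column j Q) K \<and>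
          (AE P in distr H oriented_planes plane. K P = standard_cauchy))"

definition tangent_field :: "(real ^ 'n \<Rightarrow> real ^ 'n) \<Rightarrow> bool" where
  "tangent_field T \<longleftrightarrow> T \<in> borel_measurable unit_sphere \<and> (\<forall>u \<in> sphere 0 1. u \<bullet> T u = 0)"

text \<open>Equality of fields on the sphere away from \<open>a\<^sup>\<bottom>\<close>; the values on that null set are left free.\<close>

definition agree_off_equator ::
    "real ^ 'n \<Rightarrow> (real ^ 'n \<Rightarrow> real ^ 'n) \<Rightarrow> (real ^ 'n \<Rightarrow> real ^ 'n) \<Rightarrow> bool" where
  "agree_off_equator a S T \<longleftrightarrow> (\<forall>u \<in> sphere 0 1. a \<bullet> u \<noteq> 0 \<longrightarrow> S u = T u)"

definition reciprocal_field :: "real ^ 'n \<Rightarrow> real ^ 'n \<Rightarrow> real ^ 'n" where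
  "reciprocal_field a u = (1 / (a \<bullet> u)) *\<^sub>R a - u"

definition sign_function :: "(real \<Rightarrow> real) \<Rightarrow> bool" where
  "sign_function \<epsilon> \<longleftrightarrow>
     \<epsilon> \<in> borel_measurable (restrict_space borel {0<..<1}) \<and> (\<forall>t \<in> {0<..<1}. \<epsilon> t \<in> {-1, 1})"

end

theory Submission
  imports Defs "HOL-Library.Periodic_Fun"
begin

text \<open>Write \<open>x = a \<bullet> U\<close> and \<open>y = a \<bullet> V\<close>. Since \<open>U \<bullet> V = 0\<close>, the observed product is
\<open>T U \<bullet> V = \<psi> x * y\<close>, and given the oriented plane only \<open>r\<^sup>2 = x\<^sup>2 + y\<^sup>2\<close> matters for its law, with the
direction of \<open>(x, y)\<close> uniform on the circle of radius \<open>r\<close>.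

Sufficiency. If \<open>\<bar>\<psi> t\<bar> = 1 / \<bar>t\<bar>\<close>, the product is \<open>\<plusminus> y / x\<close>, that is \<open>\<plusminus> tan \<alpha>\<close> with a uniform angle
\<open>\<alpha>\<close> and a sign that depends on \<open>r * cos \<alpha>\<close> only. Reflecting \<open>\<alpha>\<close> keeps the sign and negates the
tangent, so the sign cannot be seen in the law, which is that of \<open>tan \<alpha>\<close>: the Cauchy law
(\<open>nn_integral_circle_tan\<close>, \<open>nn_integral_quotient_on_planes\<close>). Uniformity of the angle given the plane is
used in the form of invariance of the frame under rotations in its plane, which is right invariance of
Haar measure and follows from left invariance by a Fubini argument.

Necessity. The Cauchy property fixes the joint law of \<open>(r\<^sup>2, \<psi> x * y)\<close>, so that a weight \<open>w(r\<^sup>2)\<close> times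
\<open>\<bar>\<psi> x * y\<bar> powr s\<close> has the same integral for \<open>\<psi>\<close> as for the reciprocal profile. The pair \<open>(x, y)\<close> has a
positive rotationally symmetric density on the unit disc (\<open>planar_projection_density\<close>; this is where
\<open>p \<ge> 3\<close> enters), so the integral may be taken against planar Lebesgue measure. With the weight
\<open>(R\<^sup>2 - r\<^sup>2) powr (- (s + 1) / 2)\<close> for \<open>r < R\<close> the integral over \<open>y\<close> at fixed \<open>x\<close> no longer depends on
\<open>x\<close>, by scaling; this does the work of inverting Abel's integral equation and leaves
\<open>\<integral>\<^bsub>-R\<^esub>\<^bsup>R\<^esup> \<bar>\<psi> x\<bar> powr s = \<integral>\<^bsub>-R\<^esub>\<^bsup>R\<^esup> \<bar>x\<bar> powr - s\<close> for all \<open>R \<le> 1\<close> and \<open>0 < s < 1\<close>, and hence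
\<open>\<bar>x * \<psi> x\<bar> powr s + \<bar>x * \<psi> (- x)\<bar> powr s = 2\<close> almost everywhere. Taking \<open>s\<close> and \<open>2 * s\<close>, two
numbers with sum \<open>2\<close> and sum of squares \<open>2\<close> are both \<open>1\<close>; so the contributions of \<open>x\<close> and \<open>- x\<close>, of
which a single moment sees only the sum, separate (\<open>reciprocal_if_cauchy_on_planes\<close>).

The remaining claims are elementary: oddness of \<open>T\<close> is oddness of \<open>\<psi>\<close>, which leaves one sign for each
value of \<open>\<bar>a \<bullet> u\<bar>\<close>, and a continuous sign on an interval is constant.\<close>

section \<open>Substitutions on the line and the Cauchy law\<close>

text \<open>The substitution rule in this form, for an increasing bijection of an open interval onto the whole
line and an arbitrary nonnegative Borel integrand, amounts to saying that \<open>g\<close> pushes the measure with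
density \<open>g'\<close> forward to Lebesgue measure. It suffices to compare the two on bounded intervals,
where the claim is the fundamental theorem of calculus.\<close>

lemma nn_integral_increasing_substitution:
  fixes g g' :: "real \<Rightarrow> real" and f :: "real \<Rightarrow> ennreal"
  assumes deriv: "\<And>t. t \<in> {p<..<q} \<Longrightarrow> (g has_real_derivative g' t) (at t)"
    and cont: "continuous_on {p<..<q} g'"
    and pos: "\<And>t. t \<in> {p<..<q} \<Longrightarrow> g' t > 0"
    and surj: "\<And>x. \<exists>t\<in>{p<..<q}. g t = x"
    and f[measurable]: "f \<in> borel_measurable borel"
  shows "(\<integral>\<^sup>+x. f x \<partial>lborel) = (\<integral>\<^sup>+t. f (g t) * ennreal (g' t) * indicator {p<..<q} t \<partial>lborel)"
proof -
  \<comment> \<open>The density \<open>D\<close> gives no mass to the points where \<open>G\<close> takes its default value.\<close>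
  define G where "G = (\<lambda>t. if t \<in> {p<..<q} then g t else 0)"
  define D where "D = (\<lambda>t. if t \<in> {p<..<q} then g' t else 0)"
  have contg: "continuous_on {p<..<q} g"
    using deriv by (meson DERIV_isCont continuous_at_imp_continuous_on)
  have [measurable]: "G \<in> borel_measurable borel" "D \<in> borel_measurable borel"
    unfolding G_def D_def
    using contg cont by (intro borel_measurable_continuous_on_if; simp)+
  have mono: "g s < g t" if "s < t" "s \<in> {p<..<q}" "t \<in> {p<..<q}" for s t
    using that by (intro DERIV_pos_imp_increasing[of s t g]) (auto intro!: deriv pos exI)
  have "lborel = distr (density lborel (\<lambda>t. ennreal (D t))) borel G"
  proof (rule lborel_eqI)
    fix l u :: real
    assume "\<And>b. b \<in> Basis \<Longrightarrow> l \<bullet> b \<le> u \<bullet> b"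
    then have lu: "l \<le> u" by simp
    obtain s where s: "s \<in> {p<..<q}" "g s = l" using surj by blast
    obtain t where t: "t \<in> {p<..<q}" "g t = u" using surj by blast
    have st: "s \<le> t"
    proof (rule ccontr)
      assume "\<not> s \<le> t" then show False using mono[of t s] s t lu by auto
    qed
    have in_box: "G x \<in> box l u \<and> x \<in> {p<..<q} \<longleftrightarrow> x \<in> {s<..<t}" for x
    proof (cases "x \<in> {p<..<q}")
      case True
      have "l < g x \<longleftrightarrow> s < x"
        using mono[of s x] mono[of x s] s True by (metis linorder_neqE_linordered_idom order_less_asym)
      moreover have "g x < u \<longleftrightarrow> x < t"
        using mono[of t x] mono[of x t] t True by (metis linorder_neqE_linordered_idom order_less_asym)
      ultimately show ?thesis using True by (auto simp: G_def box_real)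
    qed (use s t in auto)
    have "emeasure (distr (density lborel (\<lambda>t. ennreal (D t))) borel G) (box l u) =
        (\<integral>\<^sup>+x. ennreal (D x) * indicator (G -` box l u) x \<partial>lborel)"
      by (subst emeasure_distr, simp, simp, subst emeasure_density)
        (auto intro!: measurable_sets_borel[of G borel])
    also have "\<dots> = (\<integral>\<^sup>+x. ennreal (D x) * indicator {s..t} x \<partial>lborel)"
    proof (rule nn_integral_cong_AE)
      have "AE x in lborel. x \<noteq> s \<and> x \<noteq> t"
        by (simp add: AE_lborel_singleton)
      then show "AE x in lborel. ennreal (D x) * indicator (G -` box l u) x =
          ennreal (D x) * indicator {s..t} x"
      proof eventually_elim
        case (elim x)
        show ?case
        proof (cases "x \<in> {p<..<q}")
          case True
          then show ?thesis using in_box[of x] elim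
            by (auto simp: indicator_def)
        qed (auto simp: D_def)
      qed
    qed
    also have "\<dots> = ennreal (g t - g s)"
    proof (rule nn_integral_FTC_Icc)
      show "D x \<ge> 0" for x using pos by (auto simp: D_def less_imp_le)
      show "(g has_real_derivative D x) (at x)" if "x \<in> {s..t}" for x
        using that s t deriv[of x] by (auto simp: D_def)
      show "D \<in> borel_measurable borel" by simp
    qed (use st in auto)
    finally show "emeasure (distr (density lborel (\<lambda>t. ennreal (D t))) borel G) (box l u) =
        ennreal (\<Prod>b\<in>Basis. (u - l) \<bullet> b)"
      using s t by simp
  qed simp
  then have "(\<integral>\<^sup>+x. f x \<partial>lborel) =
      (\<integral>\<^sup>+x. f x \<partial>distr (density lborel (\<lambda>t. ennreal (D t))) borel G)"
    by (rule arg_cong)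
  also have "\<dots> = (\<integral>\<^sup>+t. ennreal (D t) * f (G t) \<partial>lborel)"
    by (simp add: nn_integral_distr nn_integral_density)
  also have "\<dots> = (\<integral>\<^sup>+t. f (g t) * ennreal (g' t) * indicator {p<..<q} t \<partial>lborel)"
    by (intro nn_integral_cong) (auto simp: D_def G_def indicator_def mult.commute)
  finally show ?thesis .
qed

text \<open>The central projection of an open half circle of radius \<open>c\<close> onto a line at distance \<open>\<sigma>\<close> from the
centre, in the coordinate \<open>t\<close> parallel to the line. It undoes the normalisation of a vector one coordinate at a time: it is used once
with the first and once with the second coordinate free.\<close>

lemma nn_integral_gnomonic_substitution:
  fixes f :: "real \<Rightarrow> ennreal"
  assumes \<sigma>: "\<sigma> > 0" and c: "c > 0" and f: "f \<in> borel_measurable borel"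
  shows "(\<integral>\<^sup>+x. f x \<partial>lborel) =
    (\<integral>\<^sup>+t. f (\<sigma> * t / sqrt (c\<^sup>2 - t\<^sup>2)) * ennreal (\<sigma> * c\<^sup>2 / (c\<^sup>2 - t\<^sup>2) / sqrt (c\<^sup>2 - t\<^sup>2)) *
      indicator {-c<..<c} t \<partial>lborel)"
proof (rule nn_integral_increasing_substitution[OF _ _ _ _ f])
  have pos: "c\<^sup>2 - t\<^sup>2 > 0" if "t \<in> {-c<..<c}" for t
    using that c abs_le_square_iff[of c t] by auto
  show "((\<lambda>t. \<sigma> * t / sqrt (c\<^sup>2 - t\<^sup>2)) has_real_derivative \<sigma> * c\<^sup>2 / (c\<^sup>2 - t\<^sup>2) / sqrt (c\<^sup>2 - t\<^sup>2)) (at t)"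
    if "t \<in> {-c<..<c}" for t
  proof -
    note p = pos[OF that]
    define w where "w = sqrt (c\<^sup>2 - t\<^sup>2)"
    have w: "w > 0" "w\<^sup>2 = c\<^sup>2 - t\<^sup>2" using p by (auto simp: w_def)
    have e: "(\<sigma> * w - \<sigma> * t * (- (2 * t) * (inverse w / 2))) / (w * w) = \<sigma> * c\<^sup>2 / w\<^sup>2 / w"
    proof -
      have c2: "c\<^sup>2 = w\<^sup>2 + t\<^sup>2" using w by simp
      show ?thesis unfolding c2 using w(1) by (simp add: field_simps power2_eq_square)
    qed
    have "((\<lambda>t. \<sigma> * t / sqrt (c\<^sup>2 - t\<^sup>2)) has_real_derivative
       (\<sigma> * w - \<sigma> * t * (- (2 * t) * (inverse w / 2))) / (w * w)) (at t)"
      unfolding w_def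
      by (rule derivative_eq_intros refl | use p in force)+
    then show ?thesis unfolding e using w by (simp add: w_def)
  qed
  show "continuous_on {-c<..<c} (\<lambda>t. \<sigma> * c\<^sup>2 / (c\<^sup>2 - t\<^sup>2) / sqrt (c\<^sup>2 - t\<^sup>2))"
    using pos by (intro continuous_intros) force+
  show "\<sigma> * c\<^sup>2 / (c\<^sup>2 - t\<^sup>2) / sqrt (c\<^sup>2 - t\<^sup>2) > 0" if "t \<in> {-c<..<c}" for t
    using pos[OF that] \<sigma> c by simp
  show "\<exists>t\<in>{-c<..<c}. \<sigma> * t / sqrt (c\<^sup>2 - t\<^sup>2) = x" for x
  proof
    define d where "d = sqrt (\<sigma>\<^sup>2 + x\<^sup>2)"
    have d: "d > 0" "d\<^sup>2 = \<sigma>\<^sup>2 + x\<^sup>2" using \<sigma> by (auto simp: d_def add_pos_nonneg)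
    have "c\<^sup>2 - (c * x / d)\<^sup>2 = c\<^sup>2 * (d\<^sup>2 - x\<^sup>2) / d\<^sup>2"
      using d(1) by (simp add: field_simps)
    also have "\<dots> = (c * \<sigma> / d)\<^sup>2" by (simp add: d power_divide power_mult_distrib)
    finally have "sqrt (c\<^sup>2 - (c * x / d)\<^sup>2) = c * \<sigma> / d" using d \<sigma> c by simp
    then show "\<sigma> * (c * x / d) / sqrt (c\<^sup>2 - (c * x / d)\<^sup>2) = x" using \<sigma> c d(1) by simp
    have "\<bar>x\<bar> < d" unfolding d_def using \<sigma> by (intro real_less_rsqrt) simp
    then have "\<bar>c * x / d\<bar> < c" using c d(1) by (simp add: abs_mult field_simps)
    then have "- c < c * x / d" "c * x / d < c" by linarith+
    then show "c * x / d \<in> {-c<..<c}" by simp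
  qed
qed

lemma nn_integral_tan_substitution:
  fixes f :: "real \<Rightarrow> ennreal"
  assumes f[measurable]: "f \<in> borel_measurable borel"
  shows "(\<integral>\<^sup>+\<alpha>. f (tan \<alpha>) * indicator {-(pi/2)<..<pi/2} \<alpha> \<partial>lborel) = pi * (\<integral>\<^sup>+m. f m \<partial>standard_cauchy)"
proof -
  let ?I = "{-(pi/2)<..<pi/2}"
  have c: "cos t > 0" if "t \<in> ?I" for t using that by (auto intro: cos_gt_zero_pi)
  have "(\<integral>\<^sup>+m. f m * ennreal (1 / (1 + m\<^sup>2)) \<partial>lborel) =
    (\<integral>\<^sup>+t. f (tan t) * ennreal (1 / (1 + (tan t)\<^sup>2)) * ennreal (1 + (tan t)\<^sup>2) * indicator ?I t \<partial>lborel)"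
  proof (rule nn_integral_increasing_substitution)
    show "(tan has_real_derivative 1 + (tan t)\<^sup>2) (at t)" if "t \<in> ?I" for t
      using c[OF that] by (auto intro!: derivative_eq_intros simp: tan_sec inverse_eq_divide divide_simps)
    show "continuous_on ?I (\<lambda>t. 1 + (tan t)\<^sup>2)"
      using c by (intro continuous_intros) force
    show "\<exists>t\<in>?I. tan t = x" for x
      using arctan[of x] by (intro bexI[of _ "arctan x"]) auto
    show "0 < 1 + (tan t)\<^sup>2" for t :: real by (simp add: add_pos_nonneg)
  qed simp
  also have "\<dots> = (\<integral>\<^sup>+t. f (tan t) * indicator ?I t \<partial>lborel)"
  proof (rule nn_integral_cong)
    fix t :: real
    have "1 + (tan t)\<^sup>2 > 0" by (simp add: add_pos_nonneg)
    then have "ennreal (1 / (1 + (tan t)\<^sup>2)) * ennreal (1 + (tan t)\<^sup>2) = 1"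
      by (subst ennreal_mult[symmetric]) auto
    then show "f (tan t) * ennreal (1 / (1 + (tan t)\<^sup>2)) * ennreal (1 + (tan t)\<^sup>2) * indicator ?I t =
      f (tan t) * indicator ?I t"
      by (simp add: mult.assoc)
  qed
  finally have *: "(\<integral>\<^sup>+t. f (tan t) * indicator ?I t \<partial>lborel) = (\<integral>\<^sup>+m. f m * ennreal (1 / (1 + m\<^sup>2)) \<partial>lborel)" ..
  have "pi * (\<integral>\<^sup>+m. f m \<partial>standard_cauchy) =
      (\<integral>\<^sup>+m. pi * (ennreal (1 / (pi * (1 + m\<^sup>2))) * f m) \<partial>lborel)"
    unfolding standard_cauchy_def by (simp add: nn_integral_density nn_integral_cmult)
  also have "\<dots> = (\<integral>\<^sup>+m. f m * ennreal (1 / (1 + m\<^sup>2)) \<partial>lborel)"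
  proof (rule nn_integral_cong)
    fix m :: real
    have "ennreal pi * ennreal (1 / (pi * (1 + m\<^sup>2))) = ennreal (1 / (1 + m\<^sup>2))"
      by (subst ennreal_mult[symmetric]) (auto simp: add_nonneg_nonneg)
    then show "ennreal pi * (ennreal (1 / (pi * (1 + m\<^sup>2))) * f m) = f m * ennreal (1 / (1 + m\<^sup>2))"
      by (metis mult.assoc mult.commute)
  qed
  finally show ?thesis using * by simp
qed

lemma sets_standard_cauchy [simp, measurable_cong]: "sets standard_cauchy = sets borel"
  and space_standard_cauchy [simp]: "space standard_cauchy = UNIV"
  by (simp_all add: standard_cauchy_def)

lemma prob_space_standard_cauchy: "prob_space standard_cauchy"
proof
  have "ennreal pi * emeasure standard_cauchy (space standard_cauchy) = ennreal pi"
    using nn_integral_tan_substitution[of "\<lambda>_. 1"] by (simp add: ennreal_minus)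
  then show "emeasure standard_cauchy (space standard_cauchy) = 1"
    by (metis ennreal_mult_cancel_left ennreal_neq_top mult.right_neutral pi_gt_zero ennreal_eq_0_iff not_le)
qed

text \<open>Cut the interval at the multiple of the period that lies in it and translate the two pieces
separately into the fundamental interval.\<close>

lemma nn_integral_periodic:
  fixes f :: "real \<Rightarrow> ennreal"
  assumes f[measurable]: "f \<in> borel_measurable borel" and c: "c > 0"
    and period: "\<And>x. f (x + c) = f x"
  shows "(\<integral>\<^sup>+x. f x * indicator {a..<a + c} x \<partial>lborel) = (\<integral>\<^sup>+x. f x * indicator {0..<c} x \<partial>lborel)"
proof -
  interpret periodic_fun_simple f c by standard (rule period)
  define k where "k = \<lceil>a / c\<rceil>"
  have k: "a \<le> k * c" "k * c < a + c"
    using c ceiling_correct[of "a / c"] unfolding k_def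
    by (metis le_of_int_ceiling pos_divide_le_eq, simp add: field_simps)
  have shift: "(\<integral>\<^sup>+x. f x * indicator {u..<v} x \<partial>lborel) =
      (\<integral>\<^sup>+x. f x * indicator {u + of_int m * c..<v + of_int m * c} x \<partial>lborel)" for u v and m :: int
  proof -
    have "(\<integral>\<^sup>+x. f x * indicator {u + of_int m * c..<v + of_int m * c} x \<partial>lborel) =
      (\<integral>\<^sup>+x. f x * indicator {u + of_int m * c..<v + of_int m * c} x \<partial>distr lborel borel ((+) (of_int m * c)))"
      by (simp add: lborel_distr_plus)
    also have "\<dots> = (\<integral>\<^sup>+x. f (of_int m * c + x) * indicator {u + of_int m * c..<v + of_int m * c} (of_int m * c + x) \<partial>lborel)"
      by (subst nn_integral_distr) auto
    also have "\<dots> = (\<integral>\<^sup>+x. f x * indicator {u..<v} x \<partial>lborel)"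
      using plus_of_int[of _ m] by (intro nn_integral_cong) (auto simp: indicator_def add.commute)
    finally show ?thesis ..
  qed
  have split: "(\<integral>\<^sup>+x. f x * indicator {u..<w} x \<partial>lborel) =
      (\<integral>\<^sup>+x. f x * indicator {u..<v} x \<partial>lborel) + (\<integral>\<^sup>+x. f x * indicator {v..<w} x \<partial>lborel)"
    if "u \<le> v" "v \<le> w" for u v w
    using that by (subst nn_integral_add[symmetric]) (auto intro!: nn_integral_cong simp: indicator_def)
  have "(\<integral>\<^sup>+x. f x * indicator {a..<a + c} x \<partial>lborel) =
    (\<integral>\<^sup>+x. f x * indicator {a..<k * c} x \<partial>lborel) + (\<integral>\<^sup>+x. f x * indicator {k * c..<a + c} x \<partial>lborel)"
    using k by (intro split) auto
  also have "\<dots> = (\<integral>\<^sup>+x. f x * indicator {a + c - k * c..<c} x \<partial>lborel) +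
      (\<integral>\<^sup>+x. f x * indicator {0..<a + c - k * c} x \<partial>lborel)"
    using shift[of a "k * c" "1 - k"] shift[of "k * c" "a + c" "- k"] by (simp add: algebra_simps)
  also have "\<dots> = (\<integral>\<^sup>+x. f x * indicator {0..<c} x \<partial>lborel)"
    using k split[of 0 "a + c - k * c" c] by (simp add: add.commute)
  finally show ?thesis .
qed

section \<open>Haar measure on the orthogonal group\<close>

text \<open>Lebesgue measure and its image \<open>\<mu>\<close> under \<open>f\<close> are both translation invariant. For two such measures
Fubini gives \<open>\<mu> A * lborel B = lborel A * \<mu> B\<close> for every symmetric set \<open>B\<close>. The unit ball is symmetric
and preserved by \<open>f\<close>, so it fixes the constant.\<close>

lemma lborel_distr_orthogonal_transformation:
  fixes f :: "'a::euclidean_space \<Rightarrow> 'a"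
  assumes f: "orthogonal_transformation f"
  shows "distr lborel borel f = lborel"
proof -
  have lin: "linear f" using f by (rule orthogonal_transformation_linear)
  have f_meas [measurable]: "f \<in> borel_measurable borel"
    by (intro borel_measurable_continuous_onI linear_continuous_on linear_conv_bounded_linear[THEN iffD1] lin)
  have norm_f: "norm (f x) = norm x" for x
    using f by (simp add: orthogonal_transformation)
  have surj: "surj f" using f by (rule orthogonal_transformation_surj)
  let ?\<mu> = "distr lborel borel f"
  have shift_lborel: "(\<integral>\<^sup>+x. g (y + x) \<partial>lborel) = (\<integral>\<^sup>+x. g x \<partial>lborel)"
    if [measurable]: "g \<in> borel_measurable borel" for g :: "'a \<Rightarrow> ennreal" and y
    by (subst (2) lborel_distr_plus[of y, symmetric], subst nn_integral_distr) auto
  have shift_\<mu>: "(\<integral>\<^sup>+x. g (y + x) \<partial>?\<mu>) = (\<integral>\<^sup>+x. g x \<partial>?\<mu>)"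
    if [measurable]: "g \<in> borel_measurable borel" for g :: "'a \<Rightarrow> ennreal" and y
  proof -
    obtain z where z: "y = f z" using surj by auto
    have "(\<integral>\<^sup>+x. g (y + x) \<partial>?\<mu>) = (\<integral>\<^sup>+x. g (f (z + x)) \<partial>lborel)"
      using linear_add[OF lin] by (simp add: nn_integral_distr z)
    also have "\<dots> = (\<integral>\<^sup>+x. g x \<partial>?\<mu>)"
      by (subst shift_lborel[of "\<lambda>x. g (f x)"]) (auto simp: nn_integral_distr)
    finally show ?thesis .
  qed
  let ?B = "ball (0::'a) 1"
  have [measurable]: "?B \<in> sets borel" by simp
  have ball_\<mu>: "emeasure ?\<mu> ?B = emeasure lborel ?B"
    by (subst emeasure_distr) (auto intro!: arg_cong2[where f=emeasure] simp: norm_f)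
  have ball_pos: "emeasure lborel ?B \<noteq> 0" "emeasure lborel ?B \<noteq> \<infinity>"
    using emeasure_lborel_ball_finite[of "0::'a" 1] content_ball_pos[of 1 "0::'a"]
    by (auto simp: measure_def)
  interpret \<mu>: sigma_finite_measure ?\<mu>
  proof
    show "\<exists>A. countable A \<and> A \<subseteq> sets ?\<mu> \<and> \<Union>A = space ?\<mu> \<and> (\<forall>a\<in>A. emeasure ?\<mu> a \<noteq> \<infinity>)"
    proof (intro exI[of _ "range (\<lambda>n::nat. ball 0 (real n))"] conjI ballI)
      show "\<Union>(range (\<lambda>n::nat. ball 0 (real n))) = space ?\<mu>"
        by (auto simp: intro: reals_Archimedean2)
      show "emeasure ?\<mu> A \<noteq> \<infinity>" if A: "A \<in> range (\<lambda>n::nat. ball 0 (real n))" for A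
      proof -
        obtain n where "A = ball 0 (real n)" using A by auto
        then have "f -` A = ball 0 (real n)" by (auto simp: norm_f)
        with A show ?thesis
          using emeasure_lborel_ball_finite[of "0::'a" "real n"] by (subst emeasure_distr) auto
      qed
    qed auto
  qed
  interpret P: pair_sigma_finite ?\<mu> lborel ..
  show ?thesis
  proof (rule measure_eqI)
    fix A assume "A \<in> sets ?\<mu>"
    then have [measurable]: "A \<in> sets borel" by simp
    have "emeasure ?\<mu> A * emeasure lborel ?B = (\<integral>\<^sup>+x. indicator A x * emeasure lborel ?B \<partial>?\<mu>)"
      by (simp add: nn_integral_multc)
    also have "\<dots> = (\<integral>\<^sup>+x. (\<integral>\<^sup>+y. indicator A x * indicator ?B (-x + y) \<partial>lborel) \<partial>?\<mu>)"
    proof (rule nn_integral_cong)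
      fix x :: 'a
      have "(\<integral>\<^sup>+y. indicator ?B (-x + y) \<partial>lborel) = emeasure lborel ?B"
        by (subst shift_lborel[of "indicator ?B"]) (auto intro!: borel_measurable_indicator)
      then show "indicator A x * emeasure lborel ?B = (\<integral>\<^sup>+y. indicator A x * indicator ?B (-x + y) \<partial>lborel)"
        by (subst nn_integral_cmult) auto
    qed
    also have "\<dots> = (\<integral>\<^sup>+y. (\<integral>\<^sup>+x. indicator A x * indicator ?B (-x + y) \<partial>?\<mu>) \<partial>lborel)"
      by (rule P.Fubini'[symmetric]) simp
    also have "\<dots> = (\<integral>\<^sup>+y. (\<integral>\<^sup>+x. indicator A (y + x) * indicator ?B x \<partial>?\<mu>) \<partial>lborel)"
    proof (rule nn_integral_cong)
      fix y :: 'a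
      show "(\<integral>\<^sup>+x. indicator A x * indicator ?B (-x + y) \<partial>?\<mu>) =
          (\<integral>\<^sup>+x. indicator A (y + x) * indicator ?B x \<partial>?\<mu>)"
        using shift_\<mu>[of "\<lambda>x. indicator A x * indicator ?B (-x + y)" y] by (simp add: indicator_def)
    qed
    also have "\<dots> = (\<integral>\<^sup>+x. (\<integral>\<^sup>+y. indicator A (y + x) * indicator ?B x \<partial>lborel) \<partial>?\<mu>)"
      by (rule P.Fubini') simp
    also have "\<dots> = (\<integral>\<^sup>+x. emeasure lborel A * indicator ?B x \<partial>?\<mu>)"
    proof (rule nn_integral_cong)
      fix x
      show "(\<integral>\<^sup>+y. indicator A (y + x) * indicator ?B x \<partial>lborel) = emeasure lborel A * indicator ?B x"
        using shift_lborel[of "indicator A" x] by (simp add: nn_integral_multc add.commute)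
    qed
    also have "\<dots> = emeasure lborel A * emeasure lborel ?B"
      by (simp add: nn_integral_cmult ball_\<mu>)
    finally show "emeasure ?\<mu> A = emeasure lborel A"
      using ball_pos by (auto simp: mult.commute[of _ "emeasure lborel ?B"] ennreal_mult_cancel_left)
  qed simp
qed

lemma measurable_matrix_mult [measurable (raw)]:
  fixes f g :: "'b \<Rightarrow> real ^ 'n ^ 'n"
  assumes "f \<in> borel_measurable M" "g \<in> borel_measurable M"
  shows "(\<lambda>x. f x ** g x) \<in> borel_measurable M"
proof (rule borel_measurable_continuous_Pair[OF assms])
  show "continuous_on UNIV (\<lambda>x. (fst x :: real ^ 'n ^ 'n) ** snd x)"
    unfolding matrix_matrix_mult_def by (intro continuous_intros)
qed

lemma measurable_transpose [measurable (raw)]: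
  fixes f :: "'b \<Rightarrow> real ^ 'n ^ 'n"
  assumes "f \<in> borel_measurable M"
  shows "(\<lambda>x. transpose (f x)) \<in> borel_measurable M"
proof (rule measurable_compose[OF assms borel_measurable_continuous_onI])
  show "continuous_on UNIV (\<lambda>x::real ^ 'n ^ 'n. transpose x)"
    unfolding transpose_def by (intro continuous_intros)
qed

lemma measurable_column [measurable (raw)]:
  fixes f :: "'b \<Rightarrow> real ^ 'n ^ 'n"
  assumes "f \<in> borel_measurable M"
  shows "(\<lambda>x. column k (f x)) \<in> borel_measurable M"
proof (rule measurable_compose[OF assms borel_measurable_continuous_onI])
  show "continuous_on UNIV (\<lambda>x::real ^ 'n ^ 'n. column k x)"
    unfolding column_def by (intro continuous_intros)
qed

lemma measurable_vector_matrix_mult [measurable (raw)]: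
  fixes f :: "'b \<Rightarrow> real ^ 'n" and g :: "'b \<Rightarrow> real ^ 'n ^ 'n"
  assumes "f \<in> borel_measurable M" "g \<in> borel_measurable M"
  shows "(\<lambda>x. f x v* g x) \<in> borel_measurable M"
proof (rule borel_measurable_continuous_Pair[OF assms])
  show "continuous_on UNIV (\<lambda>x. (fst x :: real ^ 'n) v* (snd x :: real ^ 'n ^ 'n))"
    unfolding vector_matrix_mult_def by (intro continuous_intros)
qed

locale haar =
  fixes H :: "(real ^ 'n ^ 'n) measure"
  assumes haar: "haar_orthogonal H"
begin

sublocale prob_space H
  using haar by (simp add: haar_orthogonal_def)

lemma space_haar: "space H = {Q. orthogonal_matrix Q}"
  using haar by (simp add: haar_orthogonal_def)

lemma sets_haar: "sets H = sets (restrict_space borel {Q. orthogonal_matrix Q})"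
  using haar by (simp add: haar_orthogonal_def)

lemma haar_borel [measurable (raw)]: "f \<in> borel_measurable borel \<Longrightarrow> f \<in> borel_measurable H"
  by (subst measurable_cong_sets[OF sets_haar refl]) (rule measurable_restrict_space1)

lemma measurable_into_haar:
  assumes "f \<in> borel_measurable M" "\<And>x. x \<in> space M \<Longrightarrow> orthogonal_matrix (f x)"
  shows "f \<in> measurable M H"
  by (subst measurable_cong_sets[OF refl sets_haar]) (use assms in \<open>auto intro!: measurable_restrict_space2\<close>)

lemma id_borel: "(\<lambda>Q. Q) \<in> borel_measurable H"
  by (rule haar_borel) simp

lemma left_invariant:
  assumes R: "orthogonal_matrix R" and f: "f \<in> borel_measurable H"
  shows "(\<integral>\<^sup>+Q. f (R ** Q) \<partial>H) = (\<integral>\<^sup>+Q. f Q \<partial>H)"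
proof -
  have [measurable]: "(\<lambda>Q. R ** Q) \<in> measurable H H"
    using R by (intro measurable_into_haar measurable_matrix_mult)
      (auto simp: space_haar orthogonal_matrix_mul id_borel)
  have "distr H H (\<lambda>Q. R ** Q) = H" using haar R by (simp add: haar_orthogonal_def)
  then have "(\<integral>\<^sup>+Q. f Q \<partial>H) = (\<integral>\<^sup>+Q. f Q \<partial>distr H H (\<lambda>Q. R ** Q))" by simp
  also have "\<dots> = (\<integral>\<^sup>+Q. f (R ** Q) \<partial>H)" using f by (subst nn_integral_distr) auto
  finally show ?thesis ..
qed

text \<open>This is the uniqueness argument for Haar measure: averaging \<open>f (transpose R ** Q)\<close> over \<open>Q\<close> first
gives the mean of \<open>f\<close> by left invariance; averaging over \<open>R\<close> first gives the mean of
\<open>f \<circ> transpose\<close>, again by left invariance, because \<open>transpose R ** Q\<close> is the transpose of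
\<open>transpose Q ** R\<close>.\<close>

lemma transpose_invariant:
  assumes f: "f \<in> borel_measurable H"
  shows "(\<integral>\<^sup>+Q. f (transpose Q) \<partial>H) = (\<integral>\<^sup>+Q. f Q \<partial>H)"
proof -
  note f[measurable]
  interpret P: pair_sigma_finite H H ..
  have tr[measurable]: "transpose \<in> measurable H H"
    by (intro measurable_into_haar measurable_transpose id_borel) (auto simp: space_haar orthogonal_matrix_transpose)
  have [measurable]: "(\<lambda>x. fst x) \<in> borel_measurable (H \<Otimes>\<^sub>M H)" "(\<lambda>x. snd x) \<in> borel_measurable (H \<Otimes>\<^sub>M H)"
    using measurable_compose[OF measurable_fst id_borel] measurable_compose[OF measurable_snd id_borel] by auto
  have [measurable]: "(\<lambda>x. transpose (fst x) ** snd x) \<in> measurable (H \<Otimes>\<^sub>M H) H"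
    by (intro measurable_into_haar)
      (auto simp: space_pair_measure space_haar orthogonal_matrix_mul orthogonal_matrix_transpose)
  have [measurable]: "(\<lambda>x. transpose (snd x) ** fst x) \<in> measurable (H \<Otimes>\<^sub>M H) H"
    by (intro measurable_into_haar)
      (auto simp: space_pair_measure space_haar orthogonal_matrix_mul orthogonal_matrix_transpose)
  have "(\<integral>\<^sup>+Q. f Q \<partial>H) = (\<integral>\<^sup>+R. (\<integral>\<^sup>+Q. f (transpose R ** Q) \<partial>H) \<partial>H)"
  proof -
    have "(\<integral>\<^sup>+R. (\<integral>\<^sup>+Q. f (transpose R ** Q) \<partial>H) \<partial>H) = (\<integral>\<^sup>+R. (\<integral>\<^sup>+Q. f Q \<partial>H) \<partial>H)"
      by (intro nn_integral_cong left_invariant f) (simp add: space_haar orthogonal_matrix_transpose)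
    then show ?thesis by (simp add: emeasure_space_1)
  qed
  also have "\<dots> = (\<integral>\<^sup>+Q. (\<integral>\<^sup>+R. f (transpose R ** Q) \<partial>H) \<partial>H)"
    by (rule P.Fubini') measurable
  also have "\<dots> = (\<integral>\<^sup>+Q. (\<integral>\<^sup>+R. f (transpose R) \<partial>H) \<partial>H)"
  proof (rule nn_integral_cong)
    fix Q assume Q: "Q \<in> space H"
    have "(\<integral>\<^sup>+R. f (transpose R ** Q) \<partial>H) = (\<integral>\<^sup>+R. f (transpose (transpose Q ** R)) \<partial>H)"
      by (simp add: matrix_transpose_mul transpose_transpose)
    also have "\<dots> = (\<integral>\<^sup>+R. f (transpose R) \<partial>H)"
      using Q by (intro left_invariant[where f="\<lambda>R. f (transpose R)"]) (auto simp: space_haar orthogonal_matrix_transpose)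
    finally show "(\<integral>\<^sup>+R. f (transpose R ** Q) \<partial>H) = (\<integral>\<^sup>+R. f (transpose R) \<partial>H)" .
  qed
  finally show ?thesis by (simp add: emeasure_space_1)
qed

lemma right_invariant:
  assumes R: "orthogonal_matrix R" and f: "f \<in> borel_measurable H"
  shows "(\<integral>\<^sup>+Q. f (Q ** R) \<partial>H) = (\<integral>\<^sup>+Q. f Q \<partial>H)"
proof -
  note f[measurable]
  have tr[measurable]: "transpose \<in> measurable H H"
    by (intro measurable_into_haar measurable_transpose id_borel) (auto simp: space_haar orthogonal_matrix_transpose)
  have [measurable]: "(\<lambda>Q. Q ** R) \<in> measurable H H"
    using R by (intro measurable_into_haar measurable_matrix_mult)
      (auto simp: space_haar orthogonal_matrix_mul id_borel)
  have "(\<integral>\<^sup>+Q. f (Q ** R) \<partial>H) = (\<integral>\<^sup>+Q. f (transpose Q ** R) \<partial>H)"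
    by (rule transpose_invariant[symmetric, where f="\<lambda>Q. f (Q ** R)"]) measurable
  also have "\<dots> = (\<integral>\<^sup>+Q. f (transpose (transpose R ** Q)) \<partial>H)"
    by (simp add: matrix_transpose_mul transpose_transpose)
  also have "\<dots> = (\<integral>\<^sup>+Q. f (transpose Q) \<partial>H)"
    using R by (intro left_invariant[where f="\<lambda>R. f (transpose R)"]) (auto simp: orthogonal_matrix_transpose)
  also have "\<dots> = (\<integral>\<^sup>+Q. f Q \<partial>H)"
    by (rule transpose_invariant) (rule f)
  finally show ?thesis .
qed

text \<open>The vector \<open>a v* Q\<close> of the projections of \<open>a\<close> on the columns of \<open>Q\<close> is uniform on the sphere:
together with the radial part of Lebesgue measure it reproduces Lebesgue measure. Averaging the
rotation invariance of Lebesgue measure over \<open>Q\<close> turns \<open>z\<close> into \<open>z v* Q\<close>, and by left invariance the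
law of the latter depends on \<open>norm z\<close> only.\<close>

lemma nn_integral_lborel_direction:
  fixes a :: "real ^ 'n" and \<Phi> :: "real ^ 'n \<Rightarrow> ennreal"
  assumes a: "norm a = 1" and \<Phi>[measurable]: "\<Phi> \<in> borel_measurable borel"
  shows "(\<integral>\<^sup>+z. \<Phi> z \<partial>lborel) = (\<integral>\<^sup>+Q. (\<integral>\<^sup>+z. \<Phi> (norm (z :: real ^ 'n) *\<^sub>R (a v* Q)) \<partial>lborel) \<partial>H)"
proof -
  interpret P: pair_sigma_finite H lborel ..
  note id_borel[measurable]
  have fst_b: "(\<lambda>x. fst x) \<in> borel_measurable (H \<Otimes>\<^sub>M lborel)"
    using measurable_compose[OF measurable_fst id_borel] by auto
  note fst_b[measurable]
  have "(\<integral>\<^sup>+z. \<Phi> z \<partial>lborel) = (\<integral>\<^sup>+Q. (\<integral>\<^sup>+z. \<Phi> z \<partial>lborel) \<partial>H)"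
    by (simp add: emeasure_space_1)
  also have "\<dots> = (\<integral>\<^sup>+Q. (\<integral>\<^sup>+z. \<Phi> (z v* Q) \<partial>lborel) \<partial>H)"
  proof (rule nn_integral_cong)
    fix Q assume "Q \<in> space H"
    then have "orthogonal_transformation (\<lambda>z. z v* Q)"
      using orthogonal_matrix_transpose[of Q] orthogonal_transformation_matrix[of "\<lambda>z. z v* Q"]
      by (simp add: space_haar flip: transpose_matrix_vector)
    from lborel_distr_orthogonal_transformation[OF this]
    have "(\<integral>\<^sup>+z. \<Phi> z \<partial>lborel) = (\<integral>\<^sup>+z. \<Phi> z \<partial>distr lborel borel (\<lambda>z. z v* Q))" by simp
    also have "\<dots> = (\<integral>\<^sup>+z. \<Phi> (z v* Q) \<partial>lborel)" by (subst nn_integral_distr) measurable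
    finally show "(\<integral>\<^sup>+z. \<Phi> z \<partial>lborel) = (\<integral>\<^sup>+z. \<Phi> (z v* Q) \<partial>lborel)" .
  qed
  also have "\<dots> = (\<integral>\<^sup>+z. (\<integral>\<^sup>+Q. \<Phi> (z v* Q) \<partial>H) \<partial>lborel)"
    by (rule P.Fubini'[symmetric]) measurable
  also have "\<dots> = (\<integral>\<^sup>+z. (\<integral>\<^sup>+Q. \<Phi> (norm (z :: real ^ 'n) *\<^sub>R (a v* Q)) \<partial>H) \<partial>lborel)"
  proof (rule nn_integral_cong)
    fix z :: "real ^ 'n"
    have "norm (norm z *\<^sub>R a) = norm z" using a by simp
    then obtain f where f: "orthogonal_transformation f" "f (norm z *\<^sub>R a) = z"
      by (rule orthogonal_transformation_exists)
    define R where "R = matrix f"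
    have R: "orthogonal_matrix R" and Rz: "R *v (norm z *\<^sub>R a) = z"
      using f orthogonal_transformation_matrix[of f] by (auto simp: R_def matrix_works)
    have "(\<integral>\<^sup>+Q. \<Phi> (z v* Q) \<partial>H) = (\<integral>\<^sup>+Q. \<Phi> ((norm z *\<^sub>R a) v* (transpose R ** Q)) \<partial>H)"
      by (simp add: vector_matrix_mul_assoc[symmetric] Rz transpose_transpose)
    also have "\<dots> = (\<integral>\<^sup>+Q. \<Phi> ((norm z *\<^sub>R a) v* Q) \<partial>H)"
      using R by (intro left_invariant[where f="\<lambda>Q. \<Phi> ((norm z *\<^sub>R a) v* Q)"]) (auto simp: orthogonal_matrix_transpose)
    finally show "(\<integral>\<^sup>+Q. \<Phi> (z v* Q) \<partial>H) = (\<integral>\<^sup>+Q. \<Phi> (norm z *\<^sub>R (a v* Q)) \<partial>H)"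
      by (simp add: scaleR_vector_matrix_assoc)
  qed
  also have "\<dots> = (\<integral>\<^sup>+Q. (\<integral>\<^sup>+z. \<Phi> (norm (z :: real ^ 'n) *\<^sub>R (a v* Q)) \<partial>lborel) \<partial>H)"
    by (rule P.Fubini') measurable
  finally show ?thesis .
qed

end

section \<open>The planar law of the projections of a fixed vector\<close>

lemma nn_integral_lborel_split_plane:
  fixes F :: "'a::euclidean_space \<Rightarrow> ennreal" and b1 b2 :: 'a
  defines "R \<equiv> Basis - {b1, b2}"
  assumes b: "b1 \<in> Basis" "b2 \<in> Basis" "b1 \<noteq> b2" and F[measurable]: "F \<in> borel_measurable borel"
  shows "(\<integral>\<^sup>+z. F z \<partial>lborel) = (\<integral>\<^sup>+f. (\<integral>\<^sup>+y. (\<integral>\<^sup>+x.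
     F (x *\<^sub>R b1 + y *\<^sub>R b2 + (\<Sum>b\<in>R. f b *\<^sub>R b)) \<partial>lborel) \<partial>lborel) \<partial>(\<Pi>\<^sub>M b\<in>R. lborel))"
proof -
  interpret product_sigma_finite "\<lambda>_::'a. lborel :: real measure" ..
  have R: "Basis = insert b1 (insert b2 R)" "b1 \<notin> insert b2 R" "b2 \<notin> R" "finite R"
    using b by (auto simp: R_def)
  define G where "G = (\<lambda>f. F (\<Sum>b\<in>Basis. f b *\<^sub>R b))"
  have G[measurable]: "G \<in> borel_measurable (\<Pi>\<^sub>M b\<in>Basis. lborel)" unfolding G_def by measurable
  then have G1: "G \<in> borel_measurable (\<Pi>\<^sub>M b\<in>insert b1 (insert b2 R). lborel)" using R by simp
  have "(\<integral>\<^sup>+z. F z \<partial>lborel) = (\<integral>\<^sup>+f. G f \<partial>(\<Pi>\<^sub>M b\<in>Basis. lborel))"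
    unfolding G_def by (subst lborel_eq, subst nn_integral_distr) auto
  also have "\<dots> = (\<integral>\<^sup>+f. (\<integral>\<^sup>+x. G (f(b1 := x)) \<partial>lborel) \<partial>(\<Pi>\<^sub>M b\<in>insert b2 R. lborel))"
    using R G1 by (subst R(1), subst product_nn_integral_insert) auto
  also have "\<dots> = (\<integral>\<^sup>+f. (\<integral>\<^sup>+y. (\<integral>\<^sup>+x. G (f(b2 := y, b1 := x)) \<partial>lborel) \<partial>lborel) \<partial>(\<Pi>\<^sub>M b\<in>R. lborel))"
  proof (rule product_nn_integral_insert)
    have "(\<lambda>(f, x). G (f(b1 := x))) \<in> borel_measurable ((\<Pi>\<^sub>M b\<in>insert b2 R. lborel) \<Otimes>\<^sub>M lborel)"
      using measurable_compose[OF measurable_add_dim G1] by (simp add: split_beta')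
    then show "(\<lambda>f. \<integral>\<^sup>+x. G (f(b1 := x)) \<partial>lborel) \<in> borel_measurable (\<Pi>\<^sub>M b\<in>insert b2 R. lborel)"
      by (simp add: lborel.borel_measurable_nn_integral)
  qed (use R in auto)
  also have "\<dots> = (\<integral>\<^sup>+f. (\<integral>\<^sup>+y. (\<integral>\<^sup>+x.
     F (x *\<^sub>R b1 + y *\<^sub>R b2 + (\<Sum>b\<in>R. f b *\<^sub>R b)) \<partial>lborel) \<partial>lborel) \<partial>(\<Pi>\<^sub>M b\<in>R. lborel))"
  proof (intro nn_integral_cong)
    fix f :: "'a \<Rightarrow> real" and x y :: real
    have "(\<Sum>b\<in>R. (f(b2 := y, b1 := x)) b *\<^sub>R b) = (\<Sum>b\<in>R. f b *\<^sub>R b)"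
      by (intro sum.cong) (auto simp: R_def)
    then have "(\<Sum>b\<in>Basis. (f(b2 := y, b1 := x)) b *\<^sub>R b) = x *\<^sub>R b1 + y *\<^sub>R b2 + (\<Sum>b\<in>R. f b *\<^sub>R b)"
      using R(2-4) b(3) unfolding R(1) by (simp del: fun_upd_apply add: sum.insert) (simp add: add.assoc)
    then show "G (f(b2 := y, b1 := x)) = F (x *\<^sub>R b1 + y *\<^sub>R b2 + (\<Sum>b\<in>R. f b *\<^sub>R b))"
      by (simp only: G_def)
  qed
  finally show ?thesis .
qed

text \<open>For a vector with first two coordinates \<open>x, y\<close> and remaining part of length \<open>\<rho>\<close>, the first two
coordinates of its direction are \<open>x\<close> and \<open>y\<close> divided by the length \<open>sqrt (x\<^sup>2 + y\<^sup>2 + \<rho>\<^sup>2)\<close>. At fixed \<open>\<rho>\<close>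
this maps the plane onto the open unit disc, and the inverse map has Jacobian
\<open>\<rho>\<^sup>2 / (1 - t\<^sup>2 - v\<^sup>2)\<^sup>2\<close>. Two one-dimensional central projections, one for each coordinate, replace
a two-dimensional change of variables.\<close>

lemma nn_integral_gnomonic_plane:
  fixes F :: "real \<times> real \<Rightarrow> ennreal"
  assumes \<rho>: "\<rho> > 0" and F[measurable]: "F \<in> borel_measurable (borel \<Otimes>\<^sub>M borel)"
  shows "(\<integral>\<^sup>+y. (\<integral>\<^sup>+x. F (x / sqrt (x\<^sup>2 + y\<^sup>2 + \<rho>\<^sup>2), y / sqrt (x\<^sup>2 + y\<^sup>2 + \<rho>\<^sup>2)) \<partial>lborel) \<partial>lborel) =
    ennreal (\<rho>\<^sup>2) * (\<integral>\<^sup>+t. (\<integral>\<^sup>+v. F (t, v) * ennreal (1 / (1 - t\<^sup>2 - v\<^sup>2)\<^sup>2) *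
      indicator {v. t\<^sup>2 + v\<^sup>2 < 1} v \<partial>lborel) \<partial>lborel)"
proof -
  have sq: "0 < 1 - t\<^sup>2" if "t \<in> {-1<..<1}" for t :: real
    using that by (simp add: abs_square_less_1 abs_less_iff)
  have inner_x: "(\<integral>\<^sup>+x. F (x / sqrt (x\<^sup>2 + y\<^sup>2 + \<rho>\<^sup>2), y / sqrt (x\<^sup>2 + y\<^sup>2 + \<rho>\<^sup>2)) \<partial>lborel) =
    (\<integral>\<^sup>+t. F (t, y * sqrt (1 - t\<^sup>2) / sqrt (y\<^sup>2 + \<rho>\<^sup>2)) *
       ennreal (sqrt (y\<^sup>2 + \<rho>\<^sup>2) / (1 - t\<^sup>2) / sqrt (1 - t\<^sup>2)) * indicator {-1<..<1} t \<partial>lborel)" for y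
  proof -
    define \<sigma> where "\<sigma> = sqrt (y\<^sup>2 + \<rho>\<^sup>2)"
    have \<sigma>: "\<sigma> > 0" "\<sigma>\<^sup>2 = y\<^sup>2 + \<rho>\<^sup>2" using \<rho> by (auto simp: \<sigma>_def add_nonneg_pos)
    have "F (\<sigma> * t / sqrt (1\<^sup>2 - t\<^sup>2) / sqrt ((\<sigma> * t / sqrt (1\<^sup>2 - t\<^sup>2))\<^sup>2 + y\<^sup>2 + \<rho>\<^sup>2),
        y / sqrt ((\<sigma> * t / sqrt (1\<^sup>2 - t\<^sup>2))\<^sup>2 + y\<^sup>2 + \<rho>\<^sup>2)) =
      F (t, y * sqrt (1 - t\<^sup>2) / \<sigma>)" if t: "t \<in> {-1<..<1}" for t
    proof -
      define s where "s = sqrt (1 - t\<^sup>2)"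
      have s: "s > 0" "s\<^sup>2 = 1 - t\<^sup>2" using sq[OF t] by (auto simp: s_def)
      have "(\<sigma> * t / s)\<^sup>2 + y\<^sup>2 + \<rho>\<^sup>2 = \<sigma>\<^sup>2 * (t\<^sup>2 + s\<^sup>2) / s\<^sup>2"
        using s(1) \<sigma>(2) by (simp add: field_simps)
      also have "\<dots> = (\<sigma> / s)\<^sup>2" by (simp add: s(2) power_divide)
      finally have e: "sqrt ((\<sigma> * t / s)\<^sup>2 + y\<^sup>2 + \<rho>\<^sup>2) = \<sigma> / s" using s \<sigma> by simp
      show ?thesis using s \<sigma> by (simp add: e flip: s_def)
    qed
    then show ?thesis
      unfolding \<sigma>_def[symmetric]
      by (subst nn_integral_gnomonic_substitution[OF \<sigma>(1), of 1])
        (auto intro!: nn_integral_cong simp: indicator_def)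
  qed
  have inner_y: "(\<integral>\<^sup>+y. F (t, y * sqrt (1 - t\<^sup>2) / sqrt (y\<^sup>2 + \<rho>\<^sup>2)) *
       ennreal (sqrt (y\<^sup>2 + \<rho>\<^sup>2) / (1 - t\<^sup>2) / sqrt (1 - t\<^sup>2)) * indicator {-1<..<1} t \<partial>lborel) =
    ennreal (\<rho>\<^sup>2) * (\<integral>\<^sup>+v. F (t, v) * ennreal (1 / (1 - t\<^sup>2 - v\<^sup>2)\<^sup>2) * indicator {v. t\<^sup>2 + v\<^sup>2 < 1} v \<partial>lborel)" for t
  proof (cases "t \<in> {-1<..<1}")
    case True
    define c where "c = sqrt (1 - t\<^sup>2)"
    have c: "c > 0" "c\<^sup>2 = 1 - t\<^sup>2" using sq[OF True] by (auto simp: c_def)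
    have "(\<integral>\<^sup>+y. F (t, y * c / sqrt (y\<^sup>2 + \<rho>\<^sup>2)) * ennreal (sqrt (y\<^sup>2 + \<rho>\<^sup>2) / c\<^sup>2 / c) \<partial>lborel) =
      (\<integral>\<^sup>+v. F (t, (\<rho> * v / sqrt (c\<^sup>2 - v\<^sup>2)) * c / sqrt ((\<rho> * v / sqrt (c\<^sup>2 - v\<^sup>2))\<^sup>2 + \<rho>\<^sup>2)) *
         ennreal (sqrt ((\<rho> * v / sqrt (c\<^sup>2 - v\<^sup>2))\<^sup>2 + \<rho>\<^sup>2) / c\<^sup>2 / c) *
         ennreal (\<rho> * c\<^sup>2 / (c\<^sup>2 - v\<^sup>2) / sqrt (c\<^sup>2 - v\<^sup>2)) * indicator {-c<..<c} v \<partial>lborel)"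
      by (rule nn_integral_gnomonic_substitution[OF \<rho> c(1)]) measurable
    also have "\<dots> = (\<integral>\<^sup>+v. ennreal (\<rho>\<^sup>2) * (F (t, v) * ennreal (1 / (1 - t\<^sup>2 - v\<^sup>2)\<^sup>2) *
        indicator {v. t\<^sup>2 + v\<^sup>2 < 1} v) \<partial>lborel)"
    proof (rule nn_integral_cong)
      fix v :: real
      have dom: "t\<^sup>2 + v\<^sup>2 < 1 \<longleftrightarrow> v \<in> {-c<..<c}"
        using c abs_le_square_iff[of c v] by auto
      show "F (t, (\<rho> * v / sqrt (c\<^sup>2 - v\<^sup>2)) * c / sqrt ((\<rho> * v / sqrt (c\<^sup>2 - v\<^sup>2))\<^sup>2 + \<rho>\<^sup>2)) *
         ennreal (sqrt ((\<rho> * v / sqrt (c\<^sup>2 - v\<^sup>2))\<^sup>2 + \<rho>\<^sup>2) / c\<^sup>2 / c) *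
         ennreal (\<rho> * c\<^sup>2 / (c\<^sup>2 - v\<^sup>2) / sqrt (c\<^sup>2 - v\<^sup>2)) * indicator {-c<..<c} v =
        ennreal (\<rho>\<^sup>2) * (F (t, v) * ennreal (1 / (1 - t\<^sup>2 - v\<^sup>2)\<^sup>2) * indicator {v. t\<^sup>2 + v\<^sup>2 < 1} v)"
      proof (cases "v \<in> {-c<..<c}")
        case True
        define d where "d = sqrt (c\<^sup>2 - v\<^sup>2)"
        have d: "d > 0" "d\<^sup>2 = c\<^sup>2 - v\<^sup>2" using True dom c by (auto simp: d_def)
        have "(\<rho> * v / d)\<^sup>2 + \<rho>\<^sup>2 = \<rho>\<^sup>2 * (v\<^sup>2 + d\<^sup>2) / d\<^sup>2" using d(1) by (simp add: field_simps)
        also have "\<dots> = (\<rho> * c / d)\<^sup>2" by (simp add: d(2) power_divide power_mult_distrib)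
        finally have e: "sqrt ((\<rho> * v / d)\<^sup>2 + \<rho>\<^sup>2) = \<rho> * c / d" using \<rho> c d by simp
        have e2: "\<rho> * v / d * c / (\<rho> * c / d) = v" using \<rho> c d by simp
        have e3: "(\<rho> * c / d / c\<^sup>2 / c) * (\<rho> * c\<^sup>2 / d\<^sup>2 / d) = \<rho>\<^sup>2 * (1 / (d\<^sup>2)\<^sup>2)"
          using \<rho> c(1) d(1) by (simp add: field_simps power2_eq_square)
        have "ennreal (\<rho> * c / d / c\<^sup>2 / c) * ennreal (\<rho> * c\<^sup>2 / d\<^sup>2 / d) = ennreal (\<rho>\<^sup>2) * ennreal (1 / (d\<^sup>2)\<^sup>2)"
        proof -
          have "ennreal (\<rho> * c / d / c\<^sup>2 / c) * ennreal (\<rho> * c\<^sup>2 / d\<^sup>2 / d) =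
              ennreal ((\<rho> * c / d / c\<^sup>2 / c) * (\<rho> * c\<^sup>2 / d\<^sup>2 / d))"
            using \<rho> c(1) d(1) by (intro ennreal_mult[symmetric]) auto
          also have "\<dots> = ennreal (\<rho>\<^sup>2) * ennreal (1 / (d\<^sup>2)\<^sup>2)"
            unfolding e3 by (rule ennreal_mult) auto
          finally show ?thesis .
        qed
        then show ?thesis
          using True dom unfolding d_def[symmetric] e e2
          unfolding c(2)[symmetric] d(2)[symmetric]
          by (simp add: mult.assoc mult.left_commute[of "ennreal (\<rho>\<^sup>2)"])
      qed (use dom in auto)
    qed
    also have "\<dots> = ennreal (\<rho>\<^sup>2) * (\<integral>\<^sup>+v. F (t, v) * ennreal (1 / (1 - t\<^sup>2 - v\<^sup>2)\<^sup>2) * indicator {v. t\<^sup>2 + v\<^sup>2 < 1} v \<partial>lborel)"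
      by (rule nn_integral_cmult) measurable
    finally show ?thesis using True by (simp add: c(2) flip: c_def)
  next
    case False
    then have "1 \<le> t\<^sup>2" using abs_square_less_1[of t] by (auto simp: abs_less_iff not_less)
    then have "{v. t\<^sup>2 + v\<^sup>2 < 1} = {}" by (auto simp: not_less intro: add_increasing2)
    then show ?thesis using False by simp
  qed
  have "(\<integral>\<^sup>+y. (\<integral>\<^sup>+x. F (x / sqrt (x\<^sup>2 + y\<^sup>2 + \<rho>\<^sup>2), y / sqrt (x\<^sup>2 + y\<^sup>2 + \<rho>\<^sup>2)) \<partial>lborel) \<partial>lborel) =
    (\<integral>\<^sup>+t. (\<integral>\<^sup>+y. F (t, y * sqrt (1 - t\<^sup>2) / sqrt (y\<^sup>2 + \<rho>\<^sup>2)) *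
       ennreal (sqrt (y\<^sup>2 + \<rho>\<^sup>2) / (1 - t\<^sup>2) / sqrt (1 - t\<^sup>2)) * indicator {-1<..<1} t \<partial>lborel) \<partial>lborel)"
    unfolding inner_x by (rule lborel_pair.Fubini') measurable
  also have "\<dots> = (\<integral>\<^sup>+t. ennreal (\<rho>\<^sup>2) * (\<integral>\<^sup>+v. F (t, v) * ennreal (1 / (1 - t\<^sup>2 - v\<^sup>2)\<^sup>2) *
      indicator {v. t\<^sup>2 + v\<^sup>2 < 1} v \<partial>lborel) \<partial>lborel)"
    unfolding inner_y ..
  also have "\<dots> = ennreal (\<rho>\<^sup>2) * (\<integral>\<^sup>+t. (\<integral>\<^sup>+v. F (t, v) * ennreal (1 / (1 - t\<^sup>2 - v\<^sup>2)\<^sup>2) *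
      indicator {v. t\<^sup>2 + v\<^sup>2 < 1} v \<partial>lborel) \<partial>lborel)"
    by (rule nn_integral_cmult) measurable
  finally show ?thesis .
qed

lemma AE_lborel_inner_neq_0:
  fixes b :: "'a::euclidean_space"
  assumes "b \<in> Basis"
  shows "AE z in lborel. z \<bullet> b \<noteq> 0"
proof -
  have "negligible {z::'a. z \<bullet> b = 0}" using assms by (rule negligible_standard_hyperplane)
  then have "{z::'a. z \<bullet> b = 0} \<in> null_sets lborel"
    by (auto simp: negligible_iff_null_sets null_sets_completion_iff)
  then show ?thesis by (rule AE_I') auto
qed

lemma norm_power2_vec: "(norm z)\<^sup>2 = (\<Sum>l\<in>UNIV. (z $ l)\<^sup>2)" for z :: "real ^ 'n"
  unfolding power2_norm_eq_inner inner_vec_def by (simp add: power2_eq_square)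

lemma norm_vector_matrix_mult:
  fixes Q :: "real ^ 'n ^ 'n"
  assumes "orthogonal_matrix Q"
  shows "norm (a v* Q) = norm a"
proof -
  have "orthogonal_transformation (\<lambda>z. z v* Q)"
    using assms orthogonal_matrix_transpose[of Q] orthogonal_transformation_matrix[of "\<lambda>z. z v* Q"]
    by (simp flip: transpose_matrix_vector)
  then show ?thesis by (simp add: orthogonal_transformation)
qed

context haar begin

lemma AE_projection_neq_0:
  assumes a: "norm a = 1"
  shows "AE Q in H. a \<bullet> column k Q \<noteq> 0"
proof -
  note id_borel[measurable]
  let ?N = "{z :: real ^ 'n. z $ k = 0}"
  have "closed ?N" by (intro closed_Collect_eq continuous_intros)
  then have N[measurable]: "?N \<in> sets borel" by simp
  have "AE z in lborel. z \<bullet> axis k (1::real) \<noteq> 0"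
    by (rule AE_lborel_inner_neq_0) (auto simp: Basis_vec_def)
  then have "AE z in lborel. (indicator ?N z :: ennreal) = 0"
    by eventually_elim (auto simp: inner_axis)
  then have "(\<integral>\<^sup>+z. indicator ?N z \<partial>lborel) = 0"
    by (subst nn_integral_0_iff_AE) auto
  then have 0: "(\<integral>\<^sup>+Q. (\<integral>\<^sup>+z. indicator ?N (norm (z :: real ^ 'n) *\<^sub>R (a v* Q)) \<partial>lborel) \<partial>H) = 0"
    using nn_integral_lborel_direction[OF a, of "indicator ?N"] by simp
  have "AE Q in H. (\<integral>\<^sup>+z. indicator ?N (norm (z :: real ^ 'n) *\<^sub>R (a v* Q)) \<partial>lborel) = 0"
  proof (rule nn_integral_0_iff_AE[THEN iffD1, OF _ 0])
    have [measurable]: "(\<lambda>x. fst x) \<in> borel_measurable (H \<Otimes>\<^sub>M lborel)"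
      using measurable_compose[OF measurable_fst id_borel] by auto
    show "(\<lambda>Q. \<integral>\<^sup>+z. indicator ?N (norm (z :: real ^ 'n) *\<^sub>R (a v* Q)) \<partial>lborel) \<in> borel_measurable H"
      by measurable
  qed
  then show ?thesis
  proof eventually_elim
    case (elim Q)
    show ?case
    proof
      assume "a \<bullet> column k Q = 0"
      then have "(a v* Q) $ k = 0" by (simp add: vector_matrix_mult_def inner_vec_def column_def)
      then have "(\<integral>\<^sup>+z. indicator ?N (norm (z :: real ^ 'n) *\<^sub>R (a v* Q)) \<partial>lborel) = (\<integral>\<^sup>+z. 1 \<partial>(lborel :: (real ^ 'n) measure))"
        by (intro nn_integral_cong) simp
      with elim show False by simp
    qed
  qed
qed

text \<open>A third column \<open>k\<close> exists, and \<open>a\<close> is almost surely not orthogonal to it.\<close>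

lemma AE_projection_less_1:
  assumes a: "norm a = 1" and p: "CARD('n) \<ge> 3" and ij: "i \<noteq> j"
  shows "AE Q in H. (a \<bullet> column i Q)\<^sup>2 + (a \<bullet> column j Q)\<^sup>2 < 1"
proof -
  obtain k where k: "k \<noteq> i" "k \<noteq> j"
  proof -
    have "\<not> UNIV \<subseteq> {i, j}"
      using card_mono[of "{i, j}" UNIV] p card_insert_le_m1[of 2 "{j}" i] ij by auto
    then show ?thesis using that by auto
  qed
  show ?thesis using AE_projection_neq_0[OF a, of k] AE_space
  proof eventually_elim
    case (elim Q)
    have comp: "(a v* Q) $ l = a \<bullet> column l Q" for l
      by (simp add: vector_matrix_mult_def inner_vec_def column_def)
    have "1 = (norm (a v* Q))\<^sup>2"
      using norm_vector_matrix_mult[of Q a] elim a by (simp add: space_haar)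
    also have "\<dots> = (\<Sum>l\<in>UNIV. (a \<bullet> column l Q)\<^sup>2)"
      by (simp add: norm_power2_vec comp)
    also have "\<dots> \<ge> (\<Sum>l\<in>{i, j, k}. (a \<bullet> column l Q)\<^sup>2)"
      by (intro sum_mono2) auto
    finally have "(a \<bullet> column i Q)\<^sup>2 + (a \<bullet> column j Q)\<^sup>2 + (a \<bullet> column k Q)\<^sup>2 \<le> 1"
      using k ij by (simp add: add.assoc)
    moreover have "(a \<bullet> column k Q)\<^sup>2 > 0" using elim by simp
    ultimately show ?case by linarith
  qed
qed

text \<open>The two projections of \<open>a\<close> have a rotationally symmetric density which is equivalent to Lebesgue
measure on the unit disc; \<open>m\<close> is the reciprocal of this density, as a function of the squared radius.
Integrate \<open>\<kappa> (d z) * F\<close>, evaluated at the direction of \<open>z\<close>, over the whole space in two ways. In polar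
form the direction is uniform and the radius contributes a function \<open>m0\<close> of the squared length of the
two projections. In Cartesian form the central projection of the coordinate plane of \<open>i, j\<close> produces
Lebesgue measure on the disc with the factor \<open>1 / (1 - r\<^sup>2)\<^sup>2\<close>. Comparing the two expresses \<open>m\<close>
by \<open>m0\<close>, which is positive below \<open>1\<close> because its integrand is.\<close>

lemma planar_projection_density:
  assumes a: "norm a = 1" and p: "CARD('n) \<ge> 3" and ij: "i \<noteq> j"
  obtains m :: "real \<Rightarrow> ennreal" where
    "m \<in> borel_measurable borel"
    "\<And>q. q < 1 \<Longrightarrow> 0 < m q"
    "\<And>F. F \<in> borel_measurable (borel \<Otimes>\<^sub>M borel) \<Longrightarrow>
      (\<integral>\<^sup>+Q. F (a \<bullet> column i Q, a \<bullet> column j Q) * m ((a \<bullet> column i Q)\<^sup>2 + (a \<bullet> column j Q)\<^sup>2) \<partial>H) =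
      (\<integral>\<^sup>+t. (\<integral>\<^sup>+v. F (t, v) * indicator {v. t\<^sup>2 + v\<^sup>2 < 1} v \<partial>lborel) \<partial>lborel)"
proof -
  note id_borel[measurable]
  define e where "e l = axis l (1::real)" for l :: 'n
  have eB: "e l \<in> Basis" for l by (auto simp: e_def Basis_vec_def)
  have e_inner: "z \<bullet> e l = z $ l" for z l by (simp add: e_def inner_axis)
  have eij: "e i \<noteq> e j" using ij by (simp add: e_def axis_eq_axis)
  define B where "B = Basis - {e i, e j}"
  obtain k where k: "k \<noteq> i" "k \<noteq> j"
  proof -
    have "\<not> UNIV \<subseteq> {i, j}"
      using card_mono[of "{i, j}" UNIV] p card_insert_le_m1[of 2 "{j}" i] ij by auto
    then show ?thesis using that by auto
  qed
  \<comment> \<open>The factor \<open>1 / q\<close> cancels the Jacobian factor \<open>\<rho>\<^sup>2\<close>; the Gaussian makes the constant \<open>C\<close> finite.\<close>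
  define \<kappa> where "\<kappa> q = ennreal (exp (- q / 2) / q)" for q :: real
  have [measurable]: "\<kappa> \<in> borel_measurable borel" unfolding \<kappa>_def by measurable
  \<comment> \<open>The squared distance of \<open>z\<close> from the coordinate plane of \<open>i, j\<close>.\<close>
  define d where "d z = (norm z)\<^sup>2 - (z $ i)\<^sup>2 - (z $ j)\<^sup>2" for z :: "real ^ 'n"
  have [measurable]: "d \<in> borel_measurable borel" unfolding d_def by measurable
  have d_pos: "d z > 0" if "z $ k \<noteq> 0" for z
  proof -
    have "(norm z)\<^sup>2 = (\<Sum>l\<in>UNIV. (z $ l)\<^sup>2)"
      by (rule norm_power2_vec)
    also have "\<dots> \<ge> (\<Sum>l\<in>{i, j, k}. (z $ l)\<^sup>2)" by (intro sum_mono2) auto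
    finally have "(z $ i)\<^sup>2 + (z $ j)\<^sup>2 + (z $ k)\<^sup>2 \<le> (norm z)\<^sup>2" using k ij by (simp add: add.assoc)
    moreover have "(z $ k)\<^sup>2 > 0" using that by simp
    ultimately show ?thesis unfolding d_def by linarith
  qed
  define S where "S f = (\<Sum>b\<in>B. (f b)\<^sup>2)" for f :: "real ^ 'n \<Rightarrow> real"
  have [measurable]: "S \<in> borel_measurable (\<Pi>\<^sub>M b\<in>B. lborel)"
    unfolding S_def by measurable
  have S_nonneg: "S f \<ge> 0" for f unfolding S_def by (intro sum_nonneg) auto
  define C where "C = (\<integral>\<^sup>+f. \<kappa> (S f) * ennreal (S f) \<partial>(\<Pi>\<^sub>M b\<in>B. lborel))"
  define m0 where "m0 q = (\<integral>\<^sup>+z. \<kappa> ((norm z)\<^sup>2 * (1 - q)) \<partial>(lborel :: (real ^ 'n) measure))" for q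
  have [measurable]: "m0 \<in> borel_measurable borel" unfolding m0_def by measurable
  define W where "W F = (\<integral>\<^sup>+t. (\<integral>\<^sup>+v. F (t, v) * ennreal (1 / (1 - t\<^sup>2 - v\<^sup>2)\<^sup>2) *
      indicator {v. t\<^sup>2 + v\<^sup>2 < 1} v \<partial>lborel) \<partial>lborel)" for F :: "real \<times> real \<Rightarrow> ennreal"
  let ?\<Phi> = "\<lambda>F z. \<kappa> (d z) * F (z $ i / norm z, z $ j / norm z)"
  have cartesian: "(\<integral>\<^sup>+z. ?\<Phi> F z \<partial>lborel) = C * W F"
    if [measurable]: "F \<in> borel_measurable (borel \<Otimes>\<^sub>M borel)" for F
  proof -
    have comps: "(x *\<^sub>R e i + y *\<^sub>R e j + (\<Sum>b\<in>B. f b *\<^sub>R b)) $ i = x"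
      "(x *\<^sub>R e i + y *\<^sub>R e j + (\<Sum>b\<in>B. f b *\<^sub>R b)) $ j = y"
      "(norm (x *\<^sub>R e i + y *\<^sub>R e j + (\<Sum>b\<in>B. f b *\<^sub>R b)))\<^sup>2 = x\<^sup>2 + y\<^sup>2 + S f" for x y f
    proof -
      let ?z = "x *\<^sub>R e i + y *\<^sub>R e j + (\<Sum>b\<in>B. f b *\<^sub>R b)"
      define g where "g = f(e i := x, e j := y)"
      have Bas: "Basis = insert (e i) (insert (e j) B)" and notB: "e i \<notin> B" "e j \<notin> B" "finite B"
        using eB by (auto simp: B_def)
      have "(\<Sum>b\<in>B. f b *\<^sub>R b) = (\<Sum>b\<in>B. g b *\<^sub>R b)"
        using notB by (intro sum.cong) (auto simp: g_def)
      then have z: "?z = (\<Sum>b\<in>Basis. g b *\<^sub>R b)"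
        using eij notB unfolding Bas by (simp add: g_def add.assoc)
      have zb: "?z \<bullet> b = g b" if "b \<in> Basis" for b
        using that unfolding z by (rule inner_sum_left_Basis)
      show "?z $ i = x" "?z $ j = y"
        using zb[OF eB[of i]] zb[OF eB[of j]] eij by (simp_all add: e_inner g_def)
      have "(norm ?z)\<^sup>2 = (\<Sum>b\<in>Basis. (?z \<bullet> b)\<^sup>2)"
        unfolding power2_norm_eq_inner by (subst euclidean_inner) (simp add: power2_eq_square)
      also have "\<dots> = (\<Sum>b\<in>Basis. (g b)\<^sup>2)" by (intro sum.cong) (auto simp: zb)
      also have "\<dots> = x\<^sup>2 + y\<^sup>2 + (\<Sum>b\<in>B. (g b)\<^sup>2)"
        using eij notB unfolding Bas by (simp add: g_def)
      also have "(\<Sum>b\<in>B. (g b)\<^sup>2) = S f"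
        unfolding S_def using notB by (intro sum.cong) (auto simp: g_def)
      finally show "(norm ?z)\<^sup>2 = x\<^sup>2 + y\<^sup>2 + S f" .
    qed
    have norm_eq: "norm (x *\<^sub>R e i + y *\<^sub>R e j + (\<Sum>b\<in>B. f b *\<^sub>R b)) = sqrt (x\<^sup>2 + y\<^sup>2 + S f)" for x y f
      by (rule real_sqrt_unique[OF comps(3) norm_ge_zero, symmetric])
    have d_eq: "d (x *\<^sub>R e i + y *\<^sub>R e j + (\<Sum>b\<in>B. f b *\<^sub>R b)) = S f" for x y f
      unfolding d_def comps by simp
    have "(\<integral>\<^sup>+z. ?\<Phi> F z \<partial>lborel) =
      (\<integral>\<^sup>+f. (\<integral>\<^sup>+y. (\<integral>\<^sup>+x. \<kappa> (S f) * F (x / sqrt (x\<^sup>2 + y\<^sup>2 + S f), y / sqrt (x\<^sup>2 + y\<^sup>2 + S f))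
        \<partial>lborel) \<partial>lborel) \<partial>(\<Pi>\<^sub>M b\<in>B. lborel))"
    proof (subst nn_integral_lborel_split_plane[OF eB eB eij])
      show "?\<Phi> F \<in> borel_measurable borel" by measurable
    qed (simp only: B_def[symmetric] d_eq comps(1,2) norm_eq)
    also have "\<dots> = (\<integral>\<^sup>+f. \<kappa> (S f) * ennreal (S f) * W F \<partial>(\<Pi>\<^sub>M b\<in>B. lborel))"
    proof (rule nn_integral_cong)
      fix f
      show "(\<integral>\<^sup>+y. (\<integral>\<^sup>+x. \<kappa> (S f) * F (x / sqrt (x\<^sup>2 + y\<^sup>2 + S f), y / sqrt (x\<^sup>2 + y\<^sup>2 + S f)) \<partial>lborel) \<partial>lborel) =
        \<kappa> (S f) * ennreal (S f) * W F"
      proof (cases "S f = 0")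
        case False
        then have "sqrt (S f) > 0" using S_nonneg[of f] by simp
        then show ?thesis
          using nn_integral_gnomonic_plane[of "sqrt (S f)" F] S_nonneg[of f]
          by (simp add: nn_integral_cmult W_def mult.assoc)
      qed (simp add: \<kappa>_def)
    qed
    also have "\<dots> = C * W F" unfolding C_def by (rule nn_integral_multc) measurable
    finally show ?thesis .
  qed
  have polar: "(\<integral>\<^sup>+z. ?\<Phi> F z \<partial>lborel) =
      (\<integral>\<^sup>+Q. F (a \<bullet> column i Q, a \<bullet> column j Q) * m0 ((a \<bullet> column i Q)\<^sup>2 + (a \<bullet> column j Q)\<^sup>2) \<partial>H)"
    if [measurable]: "F \<in> borel_measurable (borel \<Otimes>\<^sub>M borel)" for F
  proof -
    have "(\<integral>\<^sup>+z. ?\<Phi> F z \<partial>lborel) = (\<integral>\<^sup>+Q. (\<integral>\<^sup>+z. ?\<Phi> F (norm (z :: real ^ 'n) *\<^sub>R (a v* Q)) \<partial>lborel) \<partial>H)"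
      by (rule nn_integral_lborel_direction[OF a]) measurable
    also have "\<dots> = (\<integral>\<^sup>+Q. F (a \<bullet> column i Q, a \<bullet> column j Q) * m0 ((a \<bullet> column i Q)\<^sup>2 + (a \<bullet> column j Q)\<^sup>2) \<partial>H)"
    proof (rule nn_integral_cong)
      fix Q assume "Q \<in> space H"
      then have n: "norm (a v* Q) = 1" using norm_vector_matrix_mult[of Q a] a by (simp add: space_haar)
      have comp: "(a v* Q) $ l = a \<bullet> column l Q" for l
        by (simp add: vector_matrix_mult_def inner_vec_def column_def)
      have "(\<integral>\<^sup>+z. ?\<Phi> F (norm (z :: real ^ 'n) *\<^sub>R (a v* Q)) \<partial>lborel) =
        (\<integral>\<^sup>+z. F (a \<bullet> column i Q, a \<bullet> column j Q) * \<kappa> ((norm (z :: real ^ 'n))\<^sup>2 * (1 - ((a \<bullet> column i Q)\<^sup>2 + (a \<bullet> column j Q)\<^sup>2))) \<partial>lborel)"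
      proof (rule nn_integral_cong)
        fix z :: "real ^ 'n"
        show "?\<Phi> F (norm z *\<^sub>R (a v* Q)) = F (a \<bullet> column i Q, a \<bullet> column j Q) * \<kappa> ((norm z)\<^sup>2 * (1 - ((a \<bullet> column i Q)\<^sup>2 + (a \<bullet> column j Q)\<^sup>2)))"
        proof (cases "z = 0")
          case False
          have "d (norm z *\<^sub>R (a v* Q)) = (norm z)\<^sup>2 * (1 - ((a \<bullet> column i Q)\<^sup>2 + (a \<bullet> column j Q)\<^sup>2))"
            by (simp add: d_def n comp power_mult_distrib algebra_simps)
          then show ?thesis using False by (simp add: n comp mult.commute)
        qed (simp add: d_def \<kappa>_def)
      qed
      also have "\<dots> = F (a \<bullet> column i Q, a \<bullet> column j Q) * m0 ((a \<bullet> column i Q)\<^sup>2 + (a \<bullet> column j Q)\<^sup>2)"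
        unfolding m0_def by (rule nn_integral_cmult) measurable
      finally show "(\<integral>\<^sup>+z. ?\<Phi> F (norm (z :: real ^ 'n) *\<^sub>R (a v* Q)) \<partial>lborel) = \<dots>" .
    qed
    finally show ?thesis .
  qed
  have C_fin: "C \<noteq> \<infinity>"
  proof -
    interpret product_sigma_finite "\<lambda>_::real ^ 'n. lborel :: real measure" ..
    have "C \<le> (\<integral>\<^sup>+f. (\<Prod>b\<in>B. ennreal (exp (- (f b)\<^sup>2 / 2))) \<partial>(\<Pi>\<^sub>M b\<in>B. lborel))"
      unfolding C_def
    proof (rule nn_integral_mono)
      fix f
      have "\<kappa> (S f) * ennreal (S f) \<le> ennreal (exp (- S f / 2))"
        using S_nonneg[of f] by (cases "S f = 0") (auto simp: \<kappa>_def simp flip: ennreal_mult)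
      also have "- S f / 2 = (\<Sum>b\<in>B. - (f b)\<^sup>2 / 2)"
        by (simp add: S_def sum_negf sum_divide_distrib)
      also have "ennreal (exp \<dots>) = (\<Prod>b\<in>B. ennreal (exp (- (f b)\<^sup>2 / 2)))"
        by (simp add: exp_sum prod_ennreal B_def)
      finally show "\<kappa> (S f) * ennreal (S f) \<le> (\<Prod>b\<in>B. ennreal (exp (- (f b)\<^sup>2 / 2)))" .
    qed
    also have "\<dots> = (\<Prod>b\<in>B. (\<integral>\<^sup>+x. ennreal (exp (- x\<^sup>2 / 2)) \<partial>lborel))"
      by (rule product_nn_integral_prod) (auto simp: B_def)
    also have "\<dots> < \<infinity>"
    proof -
      have "(\<integral>\<^sup>+x. ennreal (exp (- x\<^sup>2 / 2)) \<partial>lborel) =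
          (\<integral>\<^sup>+x. ennreal (sqrt (2 * pi)) * ennreal (std_normal_density x) \<partial>lborel)"
        by (intro nn_integral_cong) (simp add: normal_density_def flip: ennreal_mult)
      also have "\<dots> = ennreal (sqrt (2 * pi)) * (\<integral>\<^sup>+x. ennreal (std_normal_density x) \<partial>lborel)"
        by (rule nn_integral_cmult) measurable
      also have "(\<integral>\<^sup>+x. ennreal (std_normal_density x) \<partial>lborel) = 1"
        using prob_space.emeasure_space_1[OF prob_space_normal_density[of 1 0]]
        by (simp add: emeasure_density)
      finally have "(\<integral>\<^sup>+x. ennreal (exp (- x\<^sup>2 / 2)) \<partial>lborel) < \<infinity>" by simp
      then show ?thesis by (simp add: power_less_top_ennreal)
    qed
    finally show ?thesis by simp
  qed
  have C_pos: "C \<noteq> 0"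
  proof
    assume "C = 0"
    then have "(\<integral>\<^sup>+z. \<kappa> (d z) \<partial>lborel) = 0" using cartesian[of "\<lambda>_. 1"] by simp
    then have "AE z in lborel. \<kappa> (d z) = 0" by (subst (asm) nn_integral_0_iff_AE) auto
    moreover have "AE z in lborel. z \<bullet> e k \<noteq> 0" by (rule AE_lborel_inner_neq_0) (rule eB)
    ultimately have "AE z in (lborel :: (real ^ 'n) measure). False"
    proof eventually_elim
      case (elim z)
      then show ?case using d_pos[of z] by (simp add: e_inner \<kappa>_def)
    qed
    then show False by (simp add: eventually_False ae_filter_eq_bot_iff)
  qed
  have m0_pos: "m0 q \<noteq> 0" if "q < 1" for q
  proof
    assume "m0 q = 0"
    then have "AE z in (lborel :: (real ^ 'n) measure). \<kappa> ((norm z)\<^sup>2 * (1 - q)) = 0"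
      unfolding m0_def by (subst (asm) nn_integral_0_iff_AE) auto
    moreover have "AE z in (lborel :: (real ^ 'n) measure). z \<bullet> e k \<noteq> 0" by (rule AE_lborel_inner_neq_0) (rule eB)
    ultimately have "AE z in (lborel :: (real ^ 'n) measure). False"
    proof eventually_elim
      case (elim z)
      then have "z \<noteq> 0" by auto
      then have "(norm z)\<^sup>2 * (1 - q) > 0" using that by simp
      then have "\<kappa> ((norm z)\<^sup>2 * (1 - q)) \<noteq> 0" unfolding \<kappa>_def by (simp only: ennreal_eq_0_iff not_le) simp
      then show ?case using elim by simp
    qed
    then show False by (simp add: eventually_False ae_filter_eq_bot_iff)
  qed
  define w where "w q = ennreal (if q < 1 then (1 - q)\<^sup>2 else 0)" for q :: real
  have [measurable]: "w \<in> borel_measurable borel" unfolding w_def by measurable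
  \<comment> \<open>Almost surely \<open>q < 1\<close>, by \<open>AE_projection_less_1\<close>; the value \<open>1\<close> is a default.\<close>
  define m where "m q = (if q < 1 then w q * m0 q / C else 1)" for q
  show thesis
  proof (rule that)
    show "m \<in> borel_measurable borel" unfolding m_def by measurable
    show "0 < m q" if "q < 1" for q
    proof -
      have "w q \<noteq> 0" using that by (simp add: w_def)
      then show ?thesis using m0_pos[OF that] that C_fin
        by (simp add: m_def ennreal_zero_less_divide less_top zero_less_iff_neq_zero)
    qed
    fix F :: "real \<times> real \<Rightarrow> ennreal" assume [measurable]: "F \<in> borel_measurable (borel \<Otimes>\<^sub>M borel)"
    let ?q = "\<lambda>Q. (a \<bullet> column i Q)\<^sup>2 + (a \<bullet> column j Q)\<^sup>2"
    let ?F = "\<lambda>(t, v). F (t, v) * w (t\<^sup>2 + v\<^sup>2)"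
    have "C * (\<integral>\<^sup>+t. (\<integral>\<^sup>+v. F (t, v) * indicator {v. t\<^sup>2 + v\<^sup>2 < 1} v \<partial>lborel) \<partial>lborel) = C * W ?F"
    proof -
      have "F (t, v) * indicator {v. t\<^sup>2 + v\<^sup>2 < 1} v =
        ?F (t, v) * ennreal (1 / (1 - t\<^sup>2 - v\<^sup>2)\<^sup>2) * indicator {v. t\<^sup>2 + v\<^sup>2 < 1} v" for t v
      proof (cases "t\<^sup>2 + v\<^sup>2 < 1")
        case True
        then have "w (t\<^sup>2 + v\<^sup>2) * ennreal (1 / (1 - t\<^sup>2 - v\<^sup>2)\<^sup>2) = 1"
          by (simp add: w_def diff_diff_eq flip: ennreal_mult)
        then show ?thesis by (simp add: mult.assoc)
      qed simp
      then show ?thesis unfolding W_def by presburger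
    qed
    also have "\<dots> = (\<integral>\<^sup>+Q. F (a \<bullet> column i Q, a \<bullet> column j Q) * w (?q Q) * m0 (?q Q) \<partial>H)"
      using cartesian[of ?F] polar[of ?F] by simp
    also have "\<dots> = (\<integral>\<^sup>+Q. C * (F (a \<bullet> column i Q, a \<bullet> column j Q) * m (?q Q)) \<partial>H)"
      using AE_projection_less_1[OF a p ij]
    proof (intro nn_integral_cong_AE, eventually_elim)
      case (elim Q)
      have "C * (x / C) = x" for x
        using C_fin C_pos by (simp add: ennreal_times_divide mult.commute[of C] ennreal_mult_divide_eq)
      then show ?case using elim by (simp add: m_def mult.assoc mult.left_commute[of C])
    qed
    also have "\<dots> = C * (\<integral>\<^sup>+Q. F (a \<bullet> column i Q, a \<bullet> column j Q) * m (?q Q) \<partial>H)"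
      by (rule nn_integral_cmult) (unfold m_def, measurable)
    finally show "(\<integral>\<^sup>+Q. F (a \<bullet> column i Q, a \<bullet> column j Q) * m (?q Q) \<partial>H) =
      (\<integral>\<^sup>+t. (\<integral>\<^sup>+v. F (t, v) * indicator {v. t\<^sup>2 + v\<^sup>2 < 1} v \<partial>lborel) \<partial>lborel)"
      using C_fin C_pos by (simp add: ennreal_mult_cancel_left)
  qed
qed

text \<open>The law of a single projection is equivalent to Lebesgue measure on \<open>{-1<..<1}\<close>. The vertical slices
of the unit disc have positive length exactly over that interval.\<close>

lemma AE_projection_iff:
  assumes a: "norm a = 1" and p: "CARD('n) \<ge> 3" and ij: "i \<noteq> j" and N[measurable]: "N \<in> sets borel"
  shows "(AE Q in H. a \<bullet> column i Q \<notin> N) \<longleftrightarrow> (AE t in lborel. t \<in> {-1<..<1} \<longrightarrow> t \<notin> N)"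
proof -
  note id_borel[measurable]
  obtain m where m[measurable]: "m \<in> borel_measurable borel" and m_pos: "\<And>q. q < 1 \<Longrightarrow> 0 < m q"
    and density: "\<And>F. F \<in> borel_measurable (borel \<Otimes>\<^sub>M borel) \<Longrightarrow>
      (\<integral>\<^sup>+Q. F (a \<bullet> column i Q, a \<bullet> column j Q) * m ((a \<bullet> column i Q)\<^sup>2 + (a \<bullet> column j Q)\<^sup>2) \<partial>H) =
      (\<integral>\<^sup>+t. (\<integral>\<^sup>+v. F (t, v) * indicator {v. t\<^sup>2 + v\<^sup>2 < 1} v \<partial>lborel) \<partial>lborel)"
    by (rule planar_projection_density[OF a p ij]) (rule that)
  define L where "L t = emeasure lborel {v::real. t\<^sup>2 + v\<^sup>2 < 1}" for t :: real
  have L_eq: "L t = (\<integral>\<^sup>+v. indicator {v. t\<^sup>2 + v\<^sup>2 < 1} v \<partial>lborel)" for t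
    unfolding L_def by (rule nn_integral_indicator[symmetric]) simp
  have [measurable]: "L \<in> borel_measurable borel" unfolding L_eq by measurable
  have L0: "L t = 0 \<longleftrightarrow> t \<notin> {-1<..<1}" for t
  proof (cases "t \<in> {-1<..<1}")
    case True
    define c where "c = sqrt (1 - t\<^sup>2)"
    have "0 < 1 - t\<^sup>2" using True by (simp add: abs_square_less_1 abs_less_iff)
    then have c: "c > 0" "c\<^sup>2 = 1 - t\<^sup>2" by (auto simp: c_def)
    have "t\<^sup>2 + v\<^sup>2 < 1 \<longleftrightarrow> v \<in> {-c<..<c}" for v
      using c abs_le_square_iff[of c v] by auto
    then have "{v. t\<^sup>2 + v\<^sup>2 < 1} = {-c<..<c}" by blast
    then show ?thesis using True c by (simp add: L_def)
  next
    case False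
    then have "1 \<le> t\<^sup>2" using abs_square_less_1[of t] by (auto simp: abs_less_iff not_less)
    then have "{v. t\<^sup>2 + v\<^sup>2 < 1} = {}" by (auto simp: not_less intro: add_increasing2)
    then show ?thesis using False by (simp add: L_def)
  qed
  have "(AE Q in H. a \<bullet> column i Q \<notin> N) \<longleftrightarrow>
      (AE Q in H. indicator N (a \<bullet> column i Q) * m ((a \<bullet> column i Q)\<^sup>2 + (a \<bullet> column j Q)\<^sup>2) = 0)"
  proof
    assume "AE Q in H. a \<bullet> column i Q \<notin> N"
    then show "AE Q in H. indicator N (a \<bullet> column i Q) * m ((a \<bullet> column i Q)\<^sup>2 + (a \<bullet> column j Q)\<^sup>2) = 0"
      by eventually_elim simp
  next
    assume "AE Q in H. indicator N (a \<bullet> column i Q) * m ((a \<bullet> column i Q)\<^sup>2 + (a \<bullet> column j Q)\<^sup>2) = 0"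
    with AE_projection_less_1[OF a p ij] show "AE Q in H. a \<bullet> column i Q \<notin> N"
    proof eventually_elim
      case (elim Q)
      then show ?case using m_pos[of "(a \<bullet> column i Q)\<^sup>2 + (a \<bullet> column j Q)\<^sup>2"] by (auto simp: indicator_def split: if_splits)
    qed
  qed
  also have "\<dots> \<longleftrightarrow> (\<integral>\<^sup>+Q. indicator N (a \<bullet> column i Q) * m ((a \<bullet> column i Q)\<^sup>2 + (a \<bullet> column j Q)\<^sup>2) \<partial>H) = 0"
    by (rule nn_integral_0_iff_AE[symmetric]) measurable
  also have "\<dots> \<longleftrightarrow> (\<integral>\<^sup>+t. (\<integral>\<^sup>+v. indicator N t * indicator {v. t\<^sup>2 + v\<^sup>2 < 1} v \<partial>lborel) \<partial>lborel) = 0"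
    using density[of "\<lambda>(t, v). indicator N t"] by simp
  also have "\<dots> \<longleftrightarrow> (\<integral>\<^sup>+t. indicator N t * L t \<partial>lborel) = 0"
    unfolding L_eq by (simp add: nn_integral_cmult)
  also have "\<dots> \<longleftrightarrow> (AE t in lborel. indicator N t * L t = 0)"
    by (rule nn_integral_0_iff_AE) measurable
  also have "\<dots> \<longleftrightarrow> (AE t in lborel. t \<in> {-1<..<1} \<longrightarrow> t \<notin> N)"
    by (rule AE_cong) (auto simp: L0 indicator_def)
  finally show ?thesis .
qed

section \<open>Rotations in an oriented plane\<close>

text \<open>Rotating the two columns in their plane is multiplication from the right by a rotation in the
coordinate plane of \<open>i, j\<close>. This is the source of the uniform angle given the plane.\<close>

lemma plane_rotation_invariant:
  fixes F :: "(real ^ 'n) \<times> (real ^ 'n) \<Rightarrow> ennreal"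
  assumes ij: "i \<noteq> j" and cs: "c\<^sup>2 + s\<^sup>2 = 1" and F[measurable]: "F \<in> borel_measurable borel"
  shows "(\<integral>\<^sup>+Q. F (c *\<^sub>R column i Q + s *\<^sub>R column j Q, - s *\<^sub>R column i Q + c *\<^sub>R column j Q) \<partial>H) =
    (\<integral>\<^sup>+Q. F (column i Q, column j Q) \<partial>H)"
proof -
  note id_borel[measurable]
  define rot where "rot x = x + ((c - 1) * x $ i - s * x $ j) *\<^sub>R axis i 1 + (s * x $ i + (c - 1) * x $ j) *\<^sub>R axis j 1"
    for x :: "real ^ 'n"
  have lin: "linear rot"
    by (rule linearI) (simp_all add: rot_def algebra_simps)
  have "rot x \<bullet> rot y = x \<bullet> y" for x y
  proof -
    let ?A = "(c - 1) * x $ i - s * x $ j" and ?B = "s * x $ i + (c - 1) * x $ j"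
    let ?A' = "(c - 1) * y $ i - s * y $ j" and ?B' = "s * y $ i + (c - 1) * y $ j"
    have 1: "axis i (1::real) \<bullet> axis j 1 = 0" "axis j (1::real) \<bullet> axis i 1 = 0"
      "axis i (1::real) \<bullet> axis i 1 = 1" "axis j (1::real) \<bullet> axis j 1 = 1"
      "axis i (1::real) $ j = 0" "axis j (1::real) $ i = 0"
      using ij by (simp_all add: inner_axis_axis) (simp_all add: axis_def)
    have "rot x \<bullet> rot y = x \<bullet> y + (?A * y $ i + ?B * y $ j + ?A' * x $ i + ?B' * x $ j + ?A * ?A' + ?B * ?B')"
      unfolding rot_def
      by (simp add: inner_add_left inner_add_right 1 inner_axis inner_axis' algebra_simps)
    also have "?A * y $ i + ?B * y $ j + ?A' * x $ i + ?B' * x $ j + ?A * ?A' + ?B * ?B' =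
       (c\<^sup>2 + s\<^sup>2 - 1) * (x $ i * y $ i + x $ j * y $ j)"
      by algebra
    finally show ?thesis by (simp add: cs)
  qed
  then have orth: "orthogonal_transformation rot" using lin by (simp add: orthogonal_transformation_def)
  define R where "R = matrix rot"
  have R: "orthogonal_matrix R" and Rx: "R *v x = rot x" for x
    using orth orthogonal_transformation_matrix[of rot] lin by (auto simp: R_def matrix_works)
  have "column i (Q ** R) = c *\<^sub>R column i Q + s *\<^sub>R column j Q"
    "column j (Q ** R) = - s *\<^sub>R column i Q + c *\<^sub>R column j Q" for Q :: "real ^ 'n ^ 'n"
  proof -
    have col: "column k (Q ** R) = Q *v rot (axis k 1)" for k
      by (simp add: matrix_vector_mult_basis[symmetric] matrix_vector_mul_assoc[symmetric] Rx)
    have "rot (axis i 1) = c *\<^sub>R axis i 1 + s *\<^sub>R axis j 1" "rot (axis j 1) = - s *\<^sub>R axis i 1 + c *\<^sub>R axis j 1"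
      using ij by (simp_all add: rot_def axis_def algebra_simps vec_eq_iff)
    then show "column i (Q ** R) = c *\<^sub>R column i Q + s *\<^sub>R column j Q"
      "column j (Q ** R) = - s *\<^sub>R column i Q + c *\<^sub>R column j Q"
      by (simp_all only: col matrix_vector_right_distrib matrix_vector_mult_scaleR matrix_vector_mult_basis)
  qed
  then show ?thesis
    using right_invariant[OF R, of "\<lambda>Q. F (column i Q, column j Q)"] by simp
qed

end

lemma oriented_span_rotate:
  assumes cs: "c\<^sup>2 + s\<^sup>2 = 1"
  shows "oriented_span (c *\<^sub>R u + s *\<^sub>R v, - s *\<^sub>R u + c *\<^sub>R v) = oriented_span (u, v)"
proof -
  let ?u = "c *\<^sub>R u + s *\<^sub>R v" and ?v = "- s *\<^sub>R u + c *\<^sub>R v"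
  have u: "u = c *\<^sub>R ?u - s *\<^sub>R ?v" and v: "v = s *\<^sub>R ?u + c *\<^sub>R ?v"
  proof -
    have "c *\<^sub>R ?u - s *\<^sub>R ?v = (c\<^sup>2 + s\<^sup>2) *\<^sub>R u" "s *\<^sub>R ?u + c *\<^sub>R ?v = (c\<^sup>2 + s\<^sup>2) *\<^sub>R v"
      by (simp_all add: algebra_simps power2_eq_square)
    then show "u = c *\<^sub>R ?u - s *\<^sub>R ?v" "v = s *\<^sub>R ?u + c *\<^sub>R ?v" by (simp_all add: cs)
  qed
  have span: "span {?u, ?v} = span {u, v}"
  proof (rule span_eq[THEN iffD2], intro conjI)
    have "u \<in> span {u, v}" "v \<in> span {u, v}" by (auto intro: span_base)
    then show "{?u, ?v} \<subseteq> span {u, v}"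
      by (simp add: span_add span_scale span_diff)
    have "u \<in> span {?u, ?v}" by (subst u) (intro span_diff span_scale span_base; simp)
    moreover have "v \<in> span {?u, ?v}" by (subst v) (intro span_add span_scale span_base; simp)
    ultimately show "{u, v} \<subseteq> span {?u, ?v}" by simp
  qed
  have det: "(x \<bullet> ?u) * (y \<bullet> ?v) - (x \<bullet> ?v) * (y \<bullet> ?u) = (x \<bullet> u) * (y \<bullet> v) - (x \<bullet> v) * (y \<bullet> u)" for x y
  proof -
    have "(x \<bullet> ?u) * (y \<bullet> ?v) - (x \<bullet> ?v) * (y \<bullet> ?u) =
        (c\<^sup>2 + s\<^sup>2) * ((x \<bullet> u) * (y \<bullet> v) - (x \<bullet> v) * (y \<bullet> u))"
      by (simp add: inner_add_right inner_diff_right algebra_simps power2_eq_square)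
    then show ?thesis by (simp add: cs)
  qed
  show ?thesis unfolding oriented_span_def prod.case span det ..
qed

lemma two_frames_borel [measurable]: "(two_frames :: ((real ^ 'n) \<times> (real ^ 'n)) set) \<in> sets borel"
proof -
  have "closed (two_frames :: ((real ^ 'n) \<times> (real ^ 'n)) set)"
    unfolding two_frames_def split_beta'
    by (intro closed_Collect_conj closed_Collect_eq continuous_intros)
  then show ?thesis by simp
qed

text \<open>The generating family of the quotient sigma-algebra is already closed under complements and
countable unions, so that measurability of a set of planes is measurability of its set of frames.\<close>

lemma sets_oriented_planes:
  "sets (oriented_planes :: ('n::finite) oriented_plane measure) =
    {A. A \<subseteq> oriented_span ` two_frames \<and> two_frames \<inter> oriented_span -` A \<in> sets borel}"
    (is "_ = ?S")
proof -
  have "sigma_algebra (oriented_span ` two_frames) ?S"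
  proof (rule sigma_algebra_iff2[THEN iffD2], intro conjI ballI allI impI)
    fix A assume A: "A \<in> ?S"
    have "two_frames \<inter> oriented_span -` (oriented_span ` two_frames - A) =
      two_frames - (two_frames \<inter> oriented_span -` A)" by auto
    then show "oriented_span ` two_frames - A \<in> ?S" using A by auto
  next
    fix A :: "nat \<Rightarrow> 'n oriented_plane set" assume A: "range A \<subseteq> ?S"
    have "two_frames \<inter> oriented_span -` (\<Union>n. A n) = (\<Union>n. two_frames \<inter> oriented_span -` A n)" by auto
    moreover have "(\<Union>n. two_frames \<inter> oriented_span -` A n) \<in> sets borel"
      using A by (intro sets.countable_UN) auto
    ultimately show "(\<Union>n. A n) \<in> ?S" using A by auto
  qed auto
  then show ?thesis
    unfolding oriented_planes_def by (rule sigma_algebra.sets_measure_of_eq)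
qed

lemma space_oriented_planes: "space oriented_planes = oriented_span ` two_frames"
  unfolding oriented_planes_def by (rule space_measure_of) auto

text \<open>The quantity is the squared length of the orthogonal projection of \<open>a\<close> to the plane, which does not
depend on the orthonormal basis chosen.\<close>

lemma plane_projection_norm_unique:
  fixes a :: "real ^ 'n"
  assumes "(u, v) \<in> two_frames" "(u', v') \<in> two_frames" "oriented_span (u, v) = oriented_span (u', v')"
  shows "(a \<bullet> u)\<^sup>2 + (a \<bullet> v)\<^sup>2 = (a \<bullet> u')\<^sup>2 + (a \<bullet> v')\<^sup>2"
proof -
  have S: "span {u, v} = span {u', v'}" using assms by (simp add: oriented_span_def)
  define proj where "proj = (\<lambda>(u, v). (a \<bullet> u) *\<^sub>R u + (a \<bullet> v) *\<^sub>R v)"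
  have proj: "proj (u, v) \<in> span {u, v}" "\<And>x. x \<in> span {u, v} \<Longrightarrow> (a - proj (u, v)) \<bullet> x = 0"
    "a \<bullet> proj (u, v) = (a \<bullet> u)\<^sup>2 + (a \<bullet> v)\<^sup>2"
    if f: "(u, v) \<in> two_frames" for u v
  proof -
    have "u \<in> span {u, v}" "v \<in> span {u, v}" by (auto intro: span_base)
    then show "proj (u, v) \<in> span {u, v}" by (simp add: proj_def span_add span_scale)
    have uu: "u \<bullet> u = 1" "v \<bullet> v = 1" "u \<bullet> v = 0" "v \<bullet> u = 0"
      using f by (auto simp: two_frames_def norm_eq_1 inner_commute)
    show "(a - proj (u, v)) \<bullet> x = 0" if "x \<in> span {u, v}" for x
      using that
    proof (induction rule: span_induct_alt)
      case (step c x y)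
      then show ?case using uu by (auto simp: proj_def inner_add_right inner_diff_left inner_add_left)
    qed simp
    show "a \<bullet> proj (u, v) = (a \<bullet> u)\<^sup>2 + (a \<bullet> v)\<^sup>2"
      by (simp add: proj_def inner_add_right power2_eq_square)
  qed
  let ?d = "proj (u, v) - proj (u', v')"
  have "?d \<in> span {u, v}" "?d \<in> span {u', v'}" using proj(1)[OF assms(1)] proj(1)[OF assms(2)] S by (auto intro: span_diff)
  then have "?d \<bullet> ?d = 0"
    using proj(2)[OF assms(1), of ?d] proj(2)[OF assms(2), of ?d] by (simp add: inner_diff_left)
  then have "proj (u, v) = proj (u', v')" by simp
  then show ?thesis using proj(3)[OF assms(1)] proj(3)[OF assms(2)] by simp
qed

text \<open>The radius \<open>r\<close> is thus a measurable function of the oriented plane.\<close>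

lemma planes_with_projection_norm:
  fixes a :: "real ^ 'n" and D :: "real set"
  assumes D: "D \<in> sets borel"
  obtains A where "A \<in> sets oriented_planes"
    "\<And>u v. (u, v) \<in> two_frames \<Longrightarrow> oriented_span (u, v) \<in> A \<longleftrightarrow> (a \<bullet> u)\<^sup>2 + (a \<bullet> v)\<^sup>2 \<in> D"
proof
  let ?E = "{w \<in> two_frames. (a \<bullet> fst w)\<^sup>2 + (a \<bullet> snd w)\<^sup>2 \<in> D}"
  show iff: "oriented_span (u, v) \<in> oriented_span ` ?E \<longleftrightarrow> (a \<bullet> u)\<^sup>2 + (a \<bullet> v)\<^sup>2 \<in> D"
    if "(u, v) \<in> two_frames" for u v
  proof
    assume "oriented_span (u, v) \<in> oriented_span ` ?E"
    then obtain u' v' where "oriented_span (u, v) = oriented_span (u', v')" "(u', v') \<in> ?E"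
      by (auto simp del: fst_conv snd_conv)
    then show "(a \<bullet> u)\<^sup>2 + (a \<bullet> v)\<^sup>2 \<in> D"
      using plane_projection_norm_unique[OF that, of u' v' a] by simp
  qed (use that in auto)
  have "two_frames \<inter> oriented_span -` (oriented_span ` ?E) = ?E"
  proof (rule set_eqI)
    fix w show "w \<in> two_frames \<inter> oriented_span -` (oriented_span ` ?E) \<longleftrightarrow> w \<in> ?E"
      using iff[of "fst w" "snd w"] by (auto simp only: Int_iff vimage_eq mem_Collect_eq prod.collapse)
  qed
  moreover have "?E \<in> sets borel"
  proof -
    have "(\<lambda>w. (a \<bullet> fst w)\<^sup>2 + (a \<bullet> snd w)\<^sup>2) \<in> borel_measurable borel"
      by (intro borel_measurable_continuous_onI continuous_intros)
    from measurable_sets_borel[OF this D] have "two_frames \<inter> ((\<lambda>w. (a \<bullet> fst w)\<^sup>2 + (a \<bullet> snd w)\<^sup>2) -` D) \<in> sets borel"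
      by auto
    also have "two_frames \<inter> ((\<lambda>w. (a \<bullet> fst w)\<^sup>2 + (a \<bullet> snd w)\<^sup>2) -` D) = ?E" by auto
    finally show ?thesis .
  qed
  ultimately show "oriented_span ` ?E \<in> sets oriented_planes"
    by (auto simp: sets_oriented_planes)
qed

text \<open>Here \<open>(x, y)\<close> is rotated by the angle \<open>\<theta>\<close>. In polar coordinates the integrand is
\<open>f (sg (r * cos \<alpha>) * (- tan \<alpha>))\<close> with \<open>\<alpha> = \<theta> - \<phi>\<close>, and adding its values at \<open>\<alpha>\<close> and
\<open>- \<alpha>\<close> removes the sign, because \<open>r * cos \<alpha>\<close> is even in \<open>\<alpha>\<close>.\<close>

lemma nn_integral_circle_tan:
  assumes sg[measurable]: "sg \<in> borel_measurable borel" and sg1: "\<And>t. sg t \<in> {-1, 1 :: real}"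
    and f[measurable]: "f \<in> borel_measurable borel" and xy: "(x, y) \<noteq> (0, 0)"
  shows "(\<integral>\<^sup>+\<theta>. f (sg (cos \<theta> * x + sin \<theta> * y) * ((- sin \<theta> * x + cos \<theta> * y) / (cos \<theta> * x + sin \<theta> * y))) *
      indicator {-pi..<pi} \<theta> \<partial>lborel) = ennreal (2 * pi) * (\<integral>\<^sup>+m. f m \<partial>standard_cauchy)"
proof -
  obtain r \<phi> where r: "x = r * cos \<phi>" "y = r * sin \<phi>" using polar_Ex by blast
  have r0: "r \<noteq> 0" using xy r by auto
  define h where "h \<alpha> = f (sg (r * cos \<alpha>) * (- tan \<alpha>))" for \<alpha>
  have [measurable]: "h \<in> borel_measurable borel" unfolding h_def tan_def by measurable
  have [measurable]: "(\<lambda>x. f (tan x)) \<in> borel_measurable borel" "(\<lambda>x. f (- tan x)) \<in> borel_measurable borel" unfolding tan_def by measurable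
  have "f (sg (cos \<theta> * x + sin \<theta> * y) * ((- sin \<theta> * x + cos \<theta> * y) / (cos \<theta> * x + sin \<theta> * y))) = h (- \<phi> + \<theta>)" for \<theta>
  proof -
    have "cos \<theta> * x + sin \<theta> * y = r * cos (- \<phi> + \<theta>)" by (simp add: r cos_diff algebra_simps)
    moreover have "- sin \<theta> * x + cos \<theta> * y = r * - sin (- \<phi> + \<theta>)" by (simp add: r sin_diff algebra_simps)
    ultimately show ?thesis using r0 by (simp add: h_def tan_def)
  qed
  then have "(\<integral>\<^sup>+\<theta>. f (sg (cos \<theta> * x + sin \<theta> * y) * ((- sin \<theta> * x + cos \<theta> * y) / (cos \<theta> * x + sin \<theta> * y))) *
      indicator {-pi..<pi} \<theta> \<partial>lborel) =
    (\<integral>\<^sup>+\<theta>. h (- \<phi> + \<theta>) * indicator {-pi - \<phi>..<-pi - \<phi> + 2 * pi} (- \<phi> + \<theta>) \<partial>lborel)"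
    by (intro nn_integral_cong) (auto simp: indicator_def)
  also have "\<dots> = (\<integral>\<^sup>+\<alpha>. h \<alpha> * indicator {-pi - \<phi>..<-pi - \<phi> + 2 * pi} \<alpha> \<partial>distr lborel borel ((+) (- \<phi>)))"
    by (subst nn_integral_distr) auto
  also have "\<dots> = (\<integral>\<^sup>+\<alpha>. h \<alpha> * indicator {-pi - \<phi>..<-pi - \<phi> + 2 * pi} \<alpha> \<partial>lborel)"
    by (simp only: lborel_distr_plus)
  also have "\<dots> = (\<integral>\<^sup>+\<alpha>. h \<alpha> * indicator {-pi..<-pi + 2 * pi} \<alpha> \<partial>lborel)"
    using nn_integral_periodic[of h "2 * pi" "-pi - \<phi>"] nn_integral_periodic[of h "2 * pi" "-pi"]
    by (simp add: h_def)
  also have "\<dots> = (\<integral>\<^sup>+\<alpha>. h \<alpha> * indicator {-pi<..<pi} \<alpha> \<partial>lborel)" (is "_ = ?J")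
    using AE_lborel_singleton[of "-pi"]
    by (intro nn_integral_cong_AE) (auto simp: indicator_def elim!: eventually_mono)
  also have "?J = ennreal (2 * pi) * (\<integral>\<^sup>+m. f m \<partial>standard_cauchy)"
  proof -
    have reflect: "(\<integral>\<^sup>+\<alpha>. g \<alpha> * indicator {-pi<..<pi} \<alpha> \<partial>lborel) = (\<integral>\<^sup>+\<alpha>. g (- \<alpha>) * indicator {-pi<..<pi} \<alpha> \<partial>lborel)"
      if [measurable]: "g \<in> borel_measurable borel" for g :: "real \<Rightarrow> ennreal"
    proof -
      have "(\<integral>\<^sup>+\<alpha>. g \<alpha> * indicator {-pi<..<pi} \<alpha> \<partial>lborel) = (\<integral>\<^sup>+\<alpha>. g \<alpha> * indicator {-pi<..<pi} \<alpha> \<partial>distr lborel borel uminus)"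
        by (simp only: lborel_distr_uminus)
      also have "\<dots> = (\<integral>\<^sup>+\<alpha>. g (- \<alpha>) * indicator {-pi<..<pi} (- \<alpha>) \<partial>lborel)" by (subst nn_integral_distr) auto
      also have "\<dots> = (\<integral>\<^sup>+\<alpha>. g (- \<alpha>) * indicator {-pi<..<pi} \<alpha> \<partial>lborel)"
        by (intro nn_integral_cong) (auto simp: indicator_def)
      finally show ?thesis .
    qed
    have sum: "h \<alpha> + h (- \<alpha>) = f (tan \<alpha>) + f (tan (- \<alpha>))" for \<alpha>
      using sg1[of "r * cos \<alpha>"] by (auto simp: h_def add.commute)
    have double: "(\<integral>\<^sup>+\<alpha>. g \<alpha> * indicator {-pi<..<pi} \<alpha> \<partial>lborel) + (\<integral>\<^sup>+\<alpha>. g \<alpha> * indicator {-pi<..<pi} \<alpha> \<partial>lborel) =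
      (\<integral>\<^sup>+\<alpha>. (g \<alpha> + g (- \<alpha>)) * indicator {-pi<..<pi} \<alpha> \<partial>lborel)"
      if [measurable]: "g \<in> borel_measurable borel" for g :: "real \<Rightarrow> ennreal"
      by (subst (2) reflect, simp, subst nn_integral_add[symmetric]) (auto simp: distrib_right)
    have "?J + ?J = (\<integral>\<^sup>+\<alpha>. (f (tan \<alpha>) + f (tan (- \<alpha>))) * indicator {-pi<..<pi} \<alpha> \<partial>lborel)"
      by (subst double) (simp_all only: sum, measurable)
    also have "\<dots> = (\<integral>\<^sup>+\<alpha>. f (tan \<alpha>) * indicator {-pi<..<pi} \<alpha> \<partial>lborel) + (\<integral>\<^sup>+\<alpha>. f (tan \<alpha>) * indicator {-pi<..<pi} \<alpha> \<partial>lborel)"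
      by (subst double) auto
    finally have "?J = (\<integral>\<^sup>+\<alpha>. f (tan \<alpha>) * indicator {-pi<..<pi} \<alpha> \<partial>lborel)"
      by (simp add: mult_2[symmetric] ennreal_mult_cancel_left)
    also have "\<dots> = (\<integral>\<^sup>+\<alpha>. f (tan \<alpha>) * indicator {-pi..<-pi + pi} \<alpha> + f (tan \<alpha>) * indicator {0..<0 + pi} \<alpha> \<partial>lborel)"
      using AE_lborel_singleton[of "-pi"]
      by (intro nn_integral_cong_AE) (auto simp: indicator_def elim!: eventually_mono)
    also have "\<dots> = (\<integral>\<^sup>+\<alpha>. f (tan \<alpha>) * indicator {-pi..<-pi + pi} \<alpha> \<partial>lborel) + (\<integral>\<^sup>+\<alpha>. f (tan \<alpha>) * indicator {0..<0 + pi} \<alpha> \<partial>lborel)"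
      by (rule nn_integral_add) measurable
    also have "\<dots> = 2 * (\<integral>\<^sup>+\<alpha>. f (tan \<alpha>) * indicator {-(pi/2)..<-(pi/2) + pi} \<alpha> \<partial>lborel)"
      using nn_integral_periodic[of "\<lambda>\<alpha>. f (tan \<alpha>)" pi "-pi"] nn_integral_periodic[of "\<lambda>\<alpha>. f (tan \<alpha>)" pi "-(pi/2)"]
      by (simp add: mult_2)
    also have "(\<integral>\<^sup>+\<alpha>. f (tan \<alpha>) * indicator {-(pi/2)..<-(pi/2) + pi} \<alpha> \<partial>lborel) =
        (\<integral>\<^sup>+\<alpha>. f (tan \<alpha>) * indicator {-(pi/2)<..<pi/2} \<alpha> \<partial>lborel)"
      using AE_lborel_singleton[of "-(pi/2)"]
      by (intro nn_integral_cong_AE) (auto simp: indicator_def elim!: eventually_mono)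
    also have "\<dots> = pi * (\<integral>\<^sup>+m. f m \<partial>standard_cauchy)" by (rule nn_integral_tan_substitution) simp
    finally show ?thesis by (simp add: ennreal_mult mult.assoc)
  qed
  finally show ?thesis .
qed

section \<open>The product given the oriented plane\<close>

lemma two_frames_rotate:
  assumes cs: "c\<^sup>2 + s\<^sup>2 = 1" and uv: "(u, v) \<in> two_frames"
  shows "(c *\<^sub>R u + s *\<^sub>R v, - s *\<^sub>R u + c *\<^sub>R v) \<in> two_frames"
proof -
  have uu: "u \<bullet> u = 1" "v \<bullet> v = 1" "u \<bullet> v = 0" "v \<bullet> u = 0"
    using uv by (auto simp: two_frames_def norm_eq_1 inner_commute)
  then show ?thesis
    using cs by (simp add: two_frames_def norm_eq_1 inner_add_left inner_add_right inner_diff_left inner_diff_right power2_eq_square)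
qed

context haar begin

abbreviation plane :: "'n \<Rightarrow> 'n \<Rightarrow> real ^ 'n ^ 'n \<Rightarrow> 'n oriented_plane" where
  "plane i j Q \<equiv> oriented_span (column i Q, column j Q)"

lemma columns_two_frames:
  assumes "i \<noteq> j" "Q \<in> space H"
  shows "(column i Q, column j Q) \<in> two_frames"
  using assms by (auto simp: space_haar two_frames_def orthogonal_matrix_orthonormal_columns orthogonal_def)

lemma plane_measurable:
  assumes ij: "i \<noteq> j"
  shows "plane i j \<in> measurable H oriented_planes"
proof (rule measurableI)
  fix Q assume "Q \<in> space H"
  then show "plane i j Q \<in> space oriented_planes"
    using columns_two_frames[OF ij] by (auto simp: space_oriented_planes)
next
  note id_borel[measurable]
  fix A :: "'n oriented_plane set" assume "A \<in> sets oriented_planes"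
  then have G[measurable]: "two_frames \<inter> oriented_span -` A \<in> sets borel" by (simp add: sets_oriented_planes)
  have "{Q \<in> space H. (column i Q, column j Q) \<in> two_frames \<inter> oriented_span -` A} \<in> sets H" by measurable
  also have "{Q \<in> space H. (column i Q, column j Q) \<in> two_frames \<inter> oriented_span -` A} = plane i j -` A \<inter> space H"
    using columns_two_frames[OF ij] by auto
  finally show "plane i j -` A \<inter> space H \<in> sets H" .
qed

text \<open>A rotation of the frame in its plane keeps the plane, hence the event \<open>plane i j Q \<in> A\<close>, and keeps
Haar measure. Averaging over all rotations turns the integrand into the integral over a circle.\<close>

lemma nn_integral_quotient_on_planes:
  assumes a: "norm a = 1" and ij: "i \<noteq> j" and A: "A \<in> sets oriented_planes"
    and sg[measurable]: "sg \<in> borel_measurable borel" and sg1: "\<And>t. sg t \<in> {-1, 1 :: real}"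
    and f[measurable]: "f \<in> borel_measurable borel"
  shows "(\<integral>\<^sup>+Q. indicator A (plane i j Q) * f (sg (a \<bullet> column i Q) * ((a \<bullet> column j Q) / (a \<bullet> column i Q))) \<partial>H) =
    emeasure H {Q \<in> space H. plane i j Q \<in> A} * (\<integral>\<^sup>+m. f m \<partial>standard_cauchy)"
proof -
  note id_borel[measurable]
  interpret P: pair_sigma_finite lborel H ..
  have [measurable]: "(\<lambda>x. snd x) \<in> borel_measurable ((lborel :: real measure) \<Otimes>\<^sub>M H)"
    using measurable_compose[OF measurable_snd id_borel] by auto
  define G where "G = two_frames \<inter> oriented_span -` A"
  have [measurable]: "G \<in> sets borel" using A by (simp add: G_def sets_oriented_planes)
  have G_iff: "(column i Q, column j Q) \<in> G \<longleftrightarrow> plane i j Q \<in> A" if "Q \<in> space H" for Q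
    using columns_two_frames[OF ij that] by (simp add: G_def)
  define F where "F w = indicator G w * f (sg (a \<bullet> fst w) * ((a \<bullet> snd w) / (a \<bullet> fst w)))" for w
  have [measurable]: "(fst :: (real ^ 'n) \<times> (real ^ 'n) \<Rightarrow> _) \<in> borel_measurable borel" "(snd :: (real ^ 'n) \<times> (real ^ 'n) \<Rightarrow> _) \<in> borel_measurable borel"
    by (intro borel_measurable_continuous_onI continuous_intros)+
  have F[measurable]: "F \<in> borel_measurable borel" unfolding F_def by measurable
  define rot where "rot \<theta> Q = (cos \<theta> *\<^sub>R column i Q + sin \<theta> *\<^sub>R column j Q, - sin \<theta> *\<^sub>R column i Q + cos \<theta> *\<^sub>R column j Q)"
    for \<theta> and Q :: "real ^ 'n ^ 'n"
  let ?I = "\<integral>\<^sup>+Q. F (column i Q, column j Q) \<partial>H"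
  let ?K = "\<integral>\<^sup>+m. f m \<partial>standard_cauchy"
  have [measurable]: "(\<lambda>x. rot (fst x) (snd x)) \<in> borel_measurable (lborel \<Otimes>\<^sub>M H)"
    unfolding rot_def by measurable
  have "ennreal (2 * pi) * ?I = (\<integral>\<^sup>+\<theta>. ?I * indicator {-pi..<pi} \<theta> \<partial>lborel)"
    by (subst nn_integral_cmult_indicator) (simp_all add: mult.commute)
  also have "\<dots> = (\<integral>\<^sup>+\<theta>. (\<integral>\<^sup>+Q. F (rot \<theta> Q) * indicator {-pi..<pi} \<theta> \<partial>H) \<partial>lborel)"
  proof (rule nn_integral_cong)
    fix \<theta> :: real
    have [measurable]: "rot \<theta> \<in> borel_measurable H" unfolding rot_def by measurable
    have "?I = (\<integral>\<^sup>+Q. F (rot \<theta> Q) \<partial>H)"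
      unfolding rot_def by (rule plane_rotation_invariant[OF ij _ F, symmetric]) simp
    then show "?I * indicator {-pi..<pi} \<theta> = (\<integral>\<^sup>+Q. F (rot \<theta> Q) * indicator {-pi..<pi} \<theta> \<partial>H)"
      by (subst nn_integral_multc) auto
  qed
  also have "\<dots> = (\<integral>\<^sup>+Q. (\<integral>\<^sup>+\<theta>. F (rot \<theta> Q) * indicator {-pi..<pi} \<theta> \<partial>lborel) \<partial>H)"
    by (rule P.Fubini'[symmetric]) (simp add: split_beta')
  also have "\<dots> = (\<integral>\<^sup>+Q. indicator {Q \<in> space H. plane i j Q \<in> A} Q * (ennreal (2 * pi) * ?K) \<partial>H)"
  proof (rule nn_integral_cong_AE)
    show "AE Q in H. (\<integral>\<^sup>+\<theta>. F (rot \<theta> Q) * indicator {-pi..<pi} \<theta> \<partial>lborel) =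
      indicator {Q \<in> space H. plane i j Q \<in> A} Q * (ennreal (2 * pi) * ?K)"
      using AE_projection_neq_0[OF a, of i] AE_space[of H]
    proof eventually_elim
      case (elim Q)
      let ?x = "a \<bullet> column i Q" and ?y = "a \<bullet> column j Q"
      have G_rot: "rot \<theta> Q \<in> G \<longleftrightarrow> (column i Q, column j Q) \<in> G" for \<theta>
        unfolding G_def rot_def using columns_two_frames[OF ij elim(2)]
        by (simp only: Int_iff vimage_eq two_frames_rotate oriented_span_rotate sin_cos_squared_add2)
      have "(\<integral>\<^sup>+\<theta>. F (rot \<theta> Q) * indicator {-pi..<pi} \<theta> \<partial>lborel) =
        (\<integral>\<^sup>+\<theta>. indicator G (column i Q, column j Q) * (f (sg (cos \<theta> * ?x + sin \<theta> * ?y) * ((- sin \<theta> * ?x + cos \<theta> * ?y) / (cos \<theta> * ?x + sin \<theta> * ?y))) *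
          indicator {-pi..<pi} \<theta>) \<partial>lborel)"
      proof (rule nn_integral_cong)
        fix \<theta>
        have "indicator G (rot \<theta> Q) = (indicator G (column i Q, column j Q) :: ennreal)"
          using G_rot[of \<theta>] by (simp add: indicator_def)
        moreover have "a \<bullet> fst (rot \<theta> Q) = cos \<theta> * ?x + sin \<theta> * ?y" "a \<bullet> snd (rot \<theta> Q) = - sin \<theta> * ?x + cos \<theta> * ?y"
          by (simp_all add: rot_def inner_add_right inner_diff_right)
        ultimately show "F (rot \<theta> Q) * indicator {-pi..<pi} \<theta> =
          indicator G (column i Q, column j Q) * (f (sg (cos \<theta> * ?x + sin \<theta> * ?y) * ((- sin \<theta> * ?x + cos \<theta> * ?y) / (cos \<theta> * ?x + sin \<theta> * ?y))) *
          indicator {-pi..<pi} \<theta>)"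
          by (simp only: F_def mult.assoc)
      qed
      also have "\<dots> = indicator G (column i Q, column j Q) * (ennreal (2 * pi) * ?K)"
      proof -
        have "(\<lambda>\<theta>. f (sg (cos \<theta> * ?x + sin \<theta> * ?y) * ((- sin \<theta> * ?x + cos \<theta> * ?y) / (cos \<theta> * ?x + sin \<theta> * ?y))) *
          indicator {-pi..<pi} \<theta>) \<in> borel_measurable lborel"
          by measurable
        moreover have "(?x, ?y) \<noteq> (0, 0)" using elim(1) by simp
        note nn_integral_circle_tan[OF sg sg1 f this]
        ultimately show ?thesis by (simp only: nn_integral_cmult)
      qed
      finally show ?case using G_iff[OF elim(2)] elim(2) by (simp add: indicator_def)
    qed
  qed
  also have "\<dots> = emeasure H {Q \<in> space H. plane i j Q \<in> A} * (ennreal (2 * pi) * ?K)"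
  proof -
    have "{Q \<in> space H. plane i j Q \<in> A} \<in> sets H"
      using measurable_sets[OF plane_measurable[OF ij] A] by (simp add: vimage_def Int_def conj_commute)
    then show ?thesis by (simp add: nn_integral_multc)
  qed
  finally have "?I = emeasure H {Q \<in> space H. plane i j Q \<in> A} * ?K"
    by (simp add: mult.left_commute[of _ "ennreal (2 * pi)"] ennreal_mult_cancel_left)
  moreover have "?I = (\<integral>\<^sup>+Q. indicator A (plane i j Q) * f (sg (a \<bullet> column i Q) * ((a \<bullet> column j Q) / (a \<bullet> column i Q))) \<partial>H)"
    by (intro nn_integral_cong) (simp add: F_def G_iff indicator_def)
  ultimately show ?thesis by simp
qed

text \<open>When the kernel is almost everywhere constant, the conditional law statement is independence of the
product and the plane together with the marginal law of the product.\<close>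

lemma cauchy_on_planes_iff:
  assumes ij: "i \<noteq> j" and X[measurable]: "(\<lambda>Q. T (column i Q) \<bullet> column j Q) \<in> borel_measurable H"
  shows "cauchy_on_planes H i j T \<longleftrightarrow> (\<forall>A\<in>sets oriented_planes. \<forall>B\<in>sets borel.
     emeasure H {Q \<in> space H. plane i j Q \<in> A \<and> T (column i Q) \<bullet> column j Q \<in> B} =
     emeasure H {Q \<in> space H. plane i j Q \<in> A} * emeasure standard_cauchy B)"
proof -
  note pm[measurable] = plane_measurable[OF ij]
  let ?N = "distr H oriented_planes (plane i j)"
  have emA: "emeasure ?N A = emeasure H {Q \<in> space H. plane i j Q \<in> A}" if "A \<in> sets oriented_planes" for A
    using that by (subst emeasure_distr) (auto intro!: arg_cong2[where f=emeasure])
  have const: "(\<integral>\<^sup>+y\<in>A. emeasure standard_cauchy B \<partial>?N) = emeasure H {Q \<in> space H. plane i j Q \<in> A} * emeasure standard_cauchy B"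
    if "A \<in> sets oriented_planes" for A B
    using that by (subst nn_integral_cmult_indicator) (simp_all add: emA mult.commute)
  show ?thesis
  proof
    assume "cauchy_on_planes H i j T"
    then obtain K where K: "conditional_law H oriented_planes (plane i j) (\<lambda>Q. T (column i Q) \<bullet> column j Q) K"
      "AE P in ?N. K P = standard_cauchy"
      by (auto simp: cauchy_on_planes_def Let_def)
    show "\<forall>A\<in>sets oriented_planes. \<forall>B\<in>sets borel.
     emeasure H {Q \<in> space H. plane i j Q \<in> A \<and> T (column i Q) \<bullet> column j Q \<in> B} =
     emeasure H {Q \<in> space H. plane i j Q \<in> A} * emeasure standard_cauchy B"
    proof (intro ballI)
      fix A :: "'n oriented_plane set" and B :: "real set" assume A: "A \<in> sets oriented_planes" and B: "B \<in> sets borel"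
      have "emeasure H {Q \<in> space H. plane i j Q \<in> A \<and> T (column i Q) \<bullet> column j Q \<in> B} =
        (\<integral>\<^sup>+y\<in>A. emeasure (K y) B \<partial>?N)"
        using K(1) A B by (simp add: conditional_law_def)
      also have "\<dots> = (\<integral>\<^sup>+y\<in>A. emeasure standard_cauchy B \<partial>?N)"
        using K(2) by (intro nn_integral_cong_AE) (auto elim!: eventually_mono)
      finally show "emeasure H {Q \<in> space H. plane i j Q \<in> A \<and> T (column i Q) \<bullet> column j Q \<in> B} =
        emeasure H {Q \<in> space H. plane i j Q \<in> A} * emeasure standard_cauchy B"
        using const[OF A, of B] by simp
    qed
  next
    assume *: "\<forall>A\<in>sets oriented_planes. \<forall>B\<in>sets borel.
     emeasure H {Q \<in> space H. plane i j Q \<in> A \<and> T (column i Q) \<bullet> column j Q \<in> B} =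
     emeasure H {Q \<in> space H. plane i j Q \<in> A} * emeasure standard_cauchy B"
    have "standard_cauchy \<in> space (prob_algebra borel)"
      using prob_space_standard_cauchy by (simp add: space_prob_algebra)
    then have "conditional_law H oriented_planes (plane i j) (\<lambda>Q. T (column i Q) \<bullet> column j Q) (\<lambda>_. standard_cauchy)"
      using * const by (simp add: conditional_law_def)
    then show "cauchy_on_planes H i j T"
      by (auto simp: cauchy_on_planes_def Let_def)
  qed
qed

lemma tangent_field_product_measurable:
  assumes T: "tangent_field T"
  shows "(\<lambda>Q. T (column i Q) \<bullet> column j Q) \<in> borel_measurable H"
proof -
  note id_borel[measurable]
  have "(\<lambda>Q. column i Q) \<in> measurable H unit_sphere"
    unfolding unit_sphere_def
    by (rule measurable_restrict_space2) (auto simp: space_haar orthogonal_matrix_orthonormal_columns)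
  moreover have "T \<in> borel_measurable unit_sphere" using T by (simp add: tangent_field_def)
  ultimately have [measurable]: "(\<lambda>Q. T (column i Q)) \<in> borel_measurable H" by (rule measurable_compose)
  show ?thesis by measurable
qed

lemma AE_tangent_field_product:
  assumes a: "norm a = 1" and ij: "i \<noteq> j"
    and T: "agree_off_equator a T (\<lambda>u. \<psi> (a \<bullet> u) *\<^sub>R (a - (a \<bullet> u) *\<^sub>R u))"
  shows "AE Q in H. T (column i Q) \<bullet> column j Q = \<psi> (a \<bullet> column i Q) * (a \<bullet> column j Q)"
  using AE_projection_neq_0[OF a, of i] AE_space[of H]
proof eventually_elim
  case (elim Q)
  have f: "norm (column i Q) = 1" "column i Q \<bullet> column j Q = 0"
    using columns_two_frames[OF ij elim(2)] by (auto simp: two_frames_def)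
  then have "T (column i Q) = \<psi> (a \<bullet> column i Q) *\<^sub>R (a - (a \<bullet> column i Q) *\<^sub>R column i Q)"
    using T elim(1) by (simp add: agree_off_equator_def)
  then show ?case using f by (simp add: inner_diff_left)
qed

lemma cauchy_on_planes_if_reciprocal:
  assumes a: "norm a = 1" and p: "CARD('n) \<ge> 3" and ij: "i \<noteq> j"
    and \<psi>[measurable]: "\<psi> \<in> borel_measurable borel" and T: "tangent_field T"
    and T\<psi>: "agree_off_equator a T (\<lambda>u. \<psi> (a \<bullet> u) *\<^sub>R (a - (a \<bullet> u) *\<^sub>R u))"
    and rec: "AE t in lborel. t \<in> {-1<..<1} \<longrightarrow> \<bar>\<psi> t\<bar> = 1 / \<bar>t\<bar>"
  shows "cauchy_on_planes H i j T"
proof -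
  note X[measurable] = tangent_field_product_measurable[OF T, of i j]
  note pm[measurable] = plane_measurable[OF ij]
  \<comment> \<open>Almost surely \<open>\<psi> t = sg t / t\<close> at \<open>t = a \<bullet> column i Q\<close>; unlike \<open>\<psi>\<close>, the function \<open>sg\<close> is a sign everywhere.\<close>
  define sg :: "real \<Rightarrow> real" where "sg t = (if t * \<psi> t \<ge> 0 then 1 else -1)" for t
  have [measurable]: "sg \<in> borel_measurable borel" unfolding sg_def by measurable
  have "{t. \<bar>\<psi> t\<bar> \<noteq> 1 / \<bar>t\<bar>} \<in> sets borel" by measurable
  from AE_projection_iff[OF a p ij this] rec
  have "AE Q in H. \<bar>\<psi> (a \<bullet> column i Q)\<bar> = 1 / \<bar>a \<bullet> column i Q\<bar>" by simp
  then have XQ: "AE Q in H. T (column i Q) \<bullet> column j Q = sg (a \<bullet> column i Q) * ((a \<bullet> column j Q) / (a \<bullet> column i Q))"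
    using AE_tangent_field_product[OF a ij T\<psi>] AE_projection_neq_0[OF a, of i]
  proof eventually_elim
    case (elim Q)
    have "\<psi> t = sg t / t" if "\<bar>\<psi> t\<bar> = 1 / \<bar>t\<bar>" "t \<noteq> 0" for t
      using that by (auto simp: sg_def field_simps abs_if zero_le_mult_iff split: if_splits)
    from this[OF elim(1,3)] show ?case using elim(2) by simp
  qed
  show ?thesis
  proof (rule cauchy_on_planes_iff[OF ij X, THEN iffD2], intro ballI)
    fix A :: "'n oriented_plane set" and B :: "real set"
    assume A[measurable]: "A \<in> sets oriented_planes" and B[measurable]: "B \<in> sets borel"
    let ?E = "{Q \<in> space H. plane i j Q \<in> A \<and> T (column i Q) \<bullet> column j Q \<in> B}"
    have "emeasure H ?E = (\<integral>\<^sup>+Q. indicator ?E Q \<partial>H)"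
      by (rule nn_integral_indicator[symmetric]) measurable
    also have "\<dots> = (\<integral>\<^sup>+Q. indicator A (plane i j Q) * indicator B (sg (a \<bullet> column i Q) * ((a \<bullet> column j Q) / (a \<bullet> column i Q))) \<partial>H)"
      using XQ AE_space[of H] by (intro nn_integral_cong_AE, eventually_elim) (auto simp: indicator_def)
    also have "\<dots> = emeasure H {Q \<in> space H. plane i j Q \<in> A} * (\<integral>\<^sup>+m. indicator B m \<partial>standard_cauchy)"
      by (rule nn_integral_quotient_on_planes[OF a ij A]) (auto simp: sg_def)
    finally show "emeasure H ?E = emeasure H {Q \<in> space H. plane i j Q \<in> A} * emeasure standard_cauchy B"
      by simp
  qed
qed

text \<open>Independence of the plane is used through the radius only: it determines the joint law of the squared
radius and the product, which is therefore the same for all fields with the Cauchy property.\<close>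

lemma cauchy_on_planes_joint_law:
  assumes a: "norm a = 1" and ij: "i \<noteq> j" and T: "tangent_field T" and cauchy: "cauchy_on_planes H i j T"
    and g[measurable]: "g \<in> borel_measurable (borel \<Otimes>\<^sub>M borel)"
  shows "(\<integral>\<^sup>+Q. g ((a \<bullet> column i Q)\<^sup>2 + (a \<bullet> column j Q)\<^sup>2, T (column i Q) \<bullet> column j Q) \<partial>H) =
    (\<integral>\<^sup>+Q. (\<integral>\<^sup>+x. g ((a \<bullet> column i Q)\<^sup>2 + (a \<bullet> column j Q)\<^sup>2, x) \<partial>standard_cauchy) \<partial>H)"
proof -
  note id_borel[measurable]
  note X[measurable] = tangent_field_product_measurable[OF T, of i j]
  define r where "r Q = (a \<bullet> column i Q)\<^sup>2 + (a \<bullet> column j Q)\<^sup>2" for Q :: "real ^ 'n ^ 'n"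
  have r[measurable]: "r \<in> borel_measurable H" unfolding r_def by measurable
  interpret S: prob_space standard_cauchy by (rule prob_space_standard_cauchy)
  interpret D: prob_space "distr H borel r" by (rule prob_space_distr) simp
  have "distr H borel r \<Otimes>\<^sub>M standard_cauchy = distr H (borel \<Otimes>\<^sub>M borel) (\<lambda>Q. (r Q, T (column i Q) \<bullet> column j Q))"
  proof (rule pair_measure_eqI)
    show "sigma_finite_measure (distr H borel r)" "sigma_finite_measure standard_cauchy" ..
    show "sets (distr H borel r \<Otimes>\<^sub>M standard_cauchy) =
      sets (distr H (borel \<Otimes>\<^sub>M borel) (\<lambda>Q. (r Q, T (column i Q) \<bullet> column j Q)))"
      by (simp cong: sets_pair_measure_cong)
    fix D B assume "D \<in> sets (distr H borel r)" "B \<in> sets standard_cauchy"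
    then have [measurable]: "D \<in> sets borel" "B \<in> sets borel" by auto
    obtain A where A: "A \<in> sets oriented_planes"
      and A_iff: "\<And>u v. (u, v) \<in> two_frames \<Longrightarrow> oriented_span (u, v) \<in> A \<longleftrightarrow> (a \<bullet> u)\<^sup>2 + (a \<bullet> v)\<^sup>2 \<in> D"
      by (rule planes_with_projection_norm[of D a]) auto
    have A_iff': "plane i j Q \<in> A \<longleftrightarrow> r Q \<in> D" if "Q \<in> space H" for Q
      using A_iff[OF columns_two_frames[OF ij that]] by (simp add: r_def)
    have "emeasure (distr H (borel \<Otimes>\<^sub>M borel) (\<lambda>Q. (r Q, T (column i Q) \<bullet> column j Q))) (D \<times> B) =
      emeasure H {Q \<in> space H. plane i j Q \<in> A \<and> T (column i Q) \<bullet> column j Q \<in> B}"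
      by (subst emeasure_distr) (auto simp: A_iff' intro!: arg_cong2[where f=emeasure])
    also have "\<dots> = emeasure H {Q \<in> space H. plane i j Q \<in> A} * emeasure standard_cauchy B"
      using cauchy_on_planes_iff[OF ij X] cauchy A by simp
    also have "emeasure H {Q \<in> space H. plane i j Q \<in> A} = emeasure (distr H borel r) D"
      by (subst emeasure_distr) (auto simp: A_iff' intro!: arg_cong2[where f=emeasure])
    finally show "emeasure (distr H borel r) D * emeasure standard_cauchy B =
      emeasure (distr H (borel \<Otimes>\<^sub>M borel) (\<lambda>Q. (r Q, T (column i Q) \<bullet> column j Q))) (D \<times> B)" ..
  qed
  then have "(\<integral>\<^sup>+w. g w \<partial>distr H (borel \<Otimes>\<^sub>M borel) (\<lambda>Q. (r Q, T (column i Q) \<bullet> column j Q))) =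
    (\<integral>\<^sup>+w. g w \<partial>(distr H borel r \<Otimes>\<^sub>M standard_cauchy))" by simp
  also have "\<dots> = (\<integral>\<^sup>+q. (\<integral>\<^sup>+x. g (q, x) \<partial>standard_cauchy) \<partial>distr H borel r)"
    by (rule S.nn_integral_fst[symmetric]) measurable
  also have "\<dots> = (\<integral>\<^sup>+Q. (\<integral>\<^sup>+x. g (r Q, x) \<partial>standard_cauchy) \<partial>H)"
    by (rule nn_integral_distr) (auto intro: S.borel_measurable_nn_integral)
  finally show ?thesis
    by (subst (asm) nn_integral_distr) (auto simp: r_def)
qed

end

section \<open>Recovering the profile from its moments\<close>

lemma nn_integral_powr_finite:
  fixes s b :: real
  assumes "s < 1"
  shows "(\<integral>\<^sup>+x\<in>{0<..<b}. ennreal (x powr - s) \<partial>lborel) < \<infinity>"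
proof (cases "b > 0")
  case True
  have "((\<lambda>x. x powr - s) has_integral (b powr (- s + 1) / (- s + 1))) {0..b}"
    using assms True by (intro has_integral_powr_from_0) auto
  then have *: "(\<integral>\<^sup>+x. ennreal (indicator {0..b} x * x powr - s) \<partial>lborel) = ennreal (b powr (- s + 1) / (- s + 1))"
    by (rule nn_integral_has_integral_lebesgue[rotated]) simp
  have "(\<integral>\<^sup>+x\<in>{0<..<b}. ennreal (x powr - s) \<partial>lborel) \<le> (\<integral>\<^sup>+x. ennreal (indicator {0..b} x * x powr - s) \<partial>lborel)"
    by (intro nn_integral_mono) (auto simp: indicator_def)
  then show ?thesis unfolding * by (simp add: le_less_trans)
qed simp

text \<open>Substituting \<open>y = sqrt q * v\<close> produces the factor \<open>q powr ((s + 1) / 2 - \<beta>)\<close>. The exponent \<open>\<beta>\<close> is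
chosen to make it disappear, and \<open>\<beta> < 1\<close> keeps the remaining beta integral finite.\<close>

lemma power_weight_slice:
  fixes s c :: real
  defines "\<beta> \<equiv> (s + 1) / 2"
  assumes s: "0 < s" "s < 1"
  obtains C where "C \<noteq> 0" "C \<noteq> \<infinity>"
    "\<And>q. q > 0 \<Longrightarrow> (\<integral>\<^sup>+y. ennreal (\<bar>y\<bar> powr s * (q - y\<^sup>2) powr - \<beta>) * indicator {y. y\<^sup>2 < q} y \<partial>lborel) = C"
proof
  define C where "C = (\<integral>\<^sup>+v. ennreal (\<bar>v\<bar> powr s * (1 - v\<^sup>2) powr - \<beta>) * indicator {v. v\<^sup>2 < 1} v \<partial>lborel)"
  have \<beta>: "0 < \<beta>" "\<beta> < 1" using s by (auto simp: \<beta>_def)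
  show "(\<integral>\<^sup>+y. ennreal (\<bar>y\<bar> powr s * (q - y\<^sup>2) powr - \<beta>) * indicator {y. y\<^sup>2 < q} y \<partial>lborel) = C" if q: "q > 0" for q
  proof -
    let ?g = "\<lambda>y. ennreal (\<bar>y\<bar> powr s * (q - y\<^sup>2) powr - \<beta>) * indicator {y. y\<^sup>2 < q} y"
    define r where "r = sqrt q"
    have r: "r > 0" "r\<^sup>2 = q" using q by (auto simp: r_def)
    have "(\<integral>\<^sup>+y. ?g y \<partial>lborel) = ennreal r * (\<integral>\<^sup>+v. ?g (0 + r * v) \<partial>lborel)"
      using r by (subst nn_integral_real_affine[of ?g r 0]) auto
    also have "\<dots> = (\<integral>\<^sup>+v. ennreal r * ?g (0 + r * v) \<partial>lborel)"
      by (rule nn_integral_cmult[symmetric]) measurable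
    also have "\<dots> = C"
      unfolding C_def
    proof (rule nn_integral_cong)
      fix v
      have 1: "(r * v)\<^sup>2 < q \<longleftrightarrow> v\<^sup>2 < 1" using q by (simp add: power_mult_distrib r)
      show "ennreal r * ?g (0 + r * v) = ennreal (\<bar>v\<bar> powr s * (1 - v\<^sup>2) powr - \<beta>) * indicator {v. v\<^sup>2 < 1} v"
      proof (cases "v\<^sup>2 < 1")
        case True
        have "q - (r * v)\<^sup>2 = r\<^sup>2 * (1 - v\<^sup>2)" by (simp add: power_mult_distrib r algebra_simps)
        then have "(q - (r * v)\<^sup>2) powr - \<beta> = (r\<^sup>2) powr - \<beta> * (1 - v\<^sup>2) powr - \<beta>"
          using True by (simp add: powr_mult)
        moreover have "(r\<^sup>2) powr - \<beta> = r powr (- 2 * \<beta>)"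
          using r(1) by (simp add: powr_powr flip: powr_numeral)
        moreover have "\<bar>r * v\<bar> powr s = r powr s * \<bar>v\<bar> powr s" using r(1) by (simp add: abs_mult powr_mult)
        moreover have "r * (r powr s * r powr (- 2 * \<beta>)) = 1"
        proof -
          have "r * (r powr s * r powr (- 2 * \<beta>)) = r powr (1 + (s + - 2 * \<beta>))"
            using r(1) by (simp only: powr_add powr_one)
          also have "1 + (s + - 2 * \<beta>) = 0" by (simp add: \<beta>_def field_simps)
          finally show ?thesis using r(1) by simp
        qed
        ultimately have "r * (\<bar>r * v\<bar> powr s * (q - (r * v)\<^sup>2) powr - \<beta>) = \<bar>v\<bar> powr s * (1 - v\<^sup>2) powr - \<beta>"
          by (simp add: algebra_simps)
        then have "ennreal r * ennreal (\<bar>r * v\<bar> powr s * (q - (r * v)\<^sup>2) powr - \<beta>) = ennreal (\<bar>v\<bar> powr s * (1 - v\<^sup>2) powr - \<beta>)"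
          using r(1) by (subst ennreal_mult[symmetric]) auto
        then show ?thesis using True 1 by simp
      qed (use 1 in simp)
    qed
    finally show ?thesis .
  qed
  show "C \<noteq> 0"
  proof
    assume "C = 0"
    then have "AE v in lborel. ennreal (\<bar>v\<bar> powr s * (1 - v\<^sup>2) powr - \<beta>) * indicator {v. v\<^sup>2 < 1} v = 0"
      unfolding C_def by (subst (asm) nn_integral_0_iff_AE) auto
    then have "AE v in lborel. \<not> (v \<in> {0<..<1::real})"
    proof eventually_elim
      case (elim v)
      show ?case
      proof
        assume v: "v \<in> {0<..<1}"
        then have "v\<^sup>2 < 1" by (simp add: abs_square_less_1)
        then show False using elim v by (simp add: indicator_def ennreal_eq_0_iff not_le mult_le_0_iff)
      qed
    qed
    then have "{0<..<1::real} \<in> null_sets lborel"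
      by (subst AE_iff_null_sets) auto
    then show False by (simp add: null_sets_def)
  qed
  show "C \<noteq> \<infinity>"
  proof -
    let ?h = "\<lambda>v. ennreal ((1 - v) powr - \<beta>) * indicator {0..<1} v"
    have "(\<integral>\<^sup>+v. ?h v \<partial>lborel) = (\<integral>\<^sup>+u. ?h (1 + - 1 * u) \<partial>lborel)"
      by (subst nn_integral_real_affine[of ?h "-1" 1]) auto
    also have "\<dots> \<le> (\<integral>\<^sup>+x\<in>{0<..<2}. ennreal (x powr - \<beta>) \<partial>lborel)"
      by (intro nn_integral_mono) (auto simp: indicator_def)
    also have "\<dots> < \<infinity>" using \<beta> by (intro nn_integral_powr_finite) simp
    finally have half: "(\<integral>\<^sup>+v. ?h v \<partial>lborel) < \<infinity>" .
    have "C \<le> (\<integral>\<^sup>+v. ?h v + ?h (- v) \<partial>lborel)"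
      unfolding C_def
    proof (rule nn_integral_mono)
      fix v :: real
      show "ennreal (\<bar>v\<bar> powr s * (1 - v\<^sup>2) powr - \<beta>) * indicator {v. v\<^sup>2 < 1} v \<le> ?h v + ?h (- v)"
      proof (cases "v\<^sup>2 < 1")
        case True
        then have v: "\<bar>v\<bar> < 1" by (simp add: abs_square_less_1)
        have "\<bar>v\<bar> * \<bar>v\<bar> \<le> \<bar>v\<bar> * 1" using v by (intro mult_left_mono) auto
        then have "1 - \<bar>v\<bar> \<le> 1 - v\<^sup>2" by (simp add: power2_eq_square)
        then have "(1 - v\<^sup>2) powr - \<beta> \<le> (1 - \<bar>v\<bar>) powr - \<beta>"
          using v \<beta> by (intro powr_mono2') auto
        moreover have "\<bar>v\<bar> powr s \<le> 1" using v s by (intro powr_le1) auto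
        ultimately have "\<bar>v\<bar> powr s * (1 - v\<^sup>2) powr - \<beta> \<le> 1 * (1 - \<bar>v\<bar>) powr - \<beta>"
          by (intro mult_mono) auto
        then have "ennreal (\<bar>v\<bar> powr s * (1 - v\<^sup>2) powr - \<beta>) \<le> ennreal ((1 - \<bar>v\<bar>) powr - \<beta>)"
          by (simp add: ennreal_leI)
        also have "\<dots> \<le> ?h v + ?h (- v)" using v by (cases "v \<ge> 0") (auto simp: indicator_def add_increasing2 add_increasing)
        finally show ?thesis using True by simp
      qed simp
    qed
    also have "\<dots> = (\<integral>\<^sup>+v. ?h v \<partial>lborel) + (\<integral>\<^sup>+v. ?h (- v) \<partial>lborel)"
      by (rule nn_integral_add) measurable
    also have "(\<integral>\<^sup>+v. ?h (- v) \<partial>lborel) = (\<integral>\<^sup>+v. ?h v \<partial>distr lborel borel uminus)"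
      by (subst nn_integral_distr) auto
    also have "\<dots> = (\<integral>\<^sup>+v. ?h v \<partial>lborel)" by (simp only: lborel_distr_uminus)
    also have "(\<integral>\<^sup>+v. ?h v \<partial>lborel) + (\<integral>\<^sup>+v. ?h v \<partial>lborel) < \<infinity>" using half by simp
    finally show ?thesis by simp
  qed
qed

lemma AE_eq_if_interval_integrals_eq:
  fixes f g :: "real \<Rightarrow> ennreal"
  assumes f[measurable]: "f \<in> borel_measurable borel" and g[measurable]: "g \<in> borel_measurable borel"
    and eq: "\<And>R. 0 < R \<Longrightarrow> R \<le> b \<Longrightarrow> (\<integral>\<^sup>+x\<in>{0<..<R}. f x \<partial>lborel) = (\<integral>\<^sup>+x\<in>{0<..<R}. g x \<partial>lborel)"
    and fin: "(\<integral>\<^sup>+x\<in>{0<..<b}. g x \<partial>lborel) < \<infinity>"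
  shows "AE x in lborel. x \<in> {0<..<b} \<longrightarrow> f x = g x"
proof (cases "b > 0")
  case b: True
  let ?f = "\<lambda>x. f x * indicator {0<..<b} x" and ?g = "\<lambda>x. g x * indicator {0<..<b} x"
  have split: "(\<integral>\<^sup>+x\<in>{0<..<b}. h x \<partial>lborel) = (\<integral>\<^sup>+x\<in>{0<..<R}. h x \<partial>lborel) +
      (\<integral>\<^sup>+x. h x * indicator {0<..<b} x * indicator {R<..} x \<partial>lborel)"
    if [measurable]: "h \<in> borel_measurable borel" and R: "0 < R" "R < b" for h :: "real \<Rightarrow> ennreal" and R
  proof -
    have "(\<integral>\<^sup>+x\<in>{0<..<b}. h x \<partial>lborel) =
      (\<integral>\<^sup>+x. h x * indicator {0<..<R} x + h x * indicator {0<..<b} x * indicator {R<..} x \<partial>lborel)"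
      using AE_lborel_singleton[of R] R
      by (intro nn_integral_cong_AE) (auto simp: indicator_def elim!: eventually_mono)
    then show ?thesis by (simp add: nn_integral_add)
  qed
  have tail: "(\<integral>\<^sup>+x. ?f x * indicator {R<..} x \<partial>lborel) = (\<integral>\<^sup>+x. ?g x * indicator {R<..} x \<partial>lborel)" for R
  proof -
    consider "R \<le> 0" | "0 < R" "R < b" | "b \<le> R" by linarith
    then show ?thesis
    proof cases
      case 1
      then have "h x * indicator {0<..<b} x * indicator {R<..} x = (h x * indicator {0<..<b} x :: ennreal)" for h x
        by (auto simp: indicator_def)
      then show ?thesis using eq[of b] b by simp
    next
      case 2
      have "(\<integral>\<^sup>+x\<in>{0<..<R}. g x \<partial>lborel) \<le> (\<integral>\<^sup>+x\<in>{0<..<b}. g x \<partial>lborel)"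
        using 2 by (intro nn_integral_mono) (auto simp: indicator_def)
      then have "(\<integral>\<^sup>+x\<in>{0<..<R}. g x \<partial>lborel) < \<infinity>" using fin by (rule le_less_trans)
      then show ?thesis
        using split[OF f 2] split[OF g 2] eq[of b] eq[of R] 2 b by (auto simp: ennreal_add_left_cancel)
    next
      case 3
      then show ?thesis by (intro nn_integral_cong) (auto simp: indicator_def)
    qed
  qed
  have "density lborel ?f = density lborel ?g"
  proof (rule measure_eqI_lessThan)
    fix R :: real
    show "emeasure (density lborel ?f) {R<..} = emeasure (density lborel ?g) {R<..}"
      using tail[of R] by (simp add: emeasure_density)
    have "emeasure (density lborel ?f) {R<..} = (\<integral>\<^sup>+x. ?g x * indicator {R<..} x \<partial>lborel)"
      using tail[of R] by (simp add: emeasure_density)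
    also have "\<dots> \<le> (\<integral>\<^sup>+x\<in>{0<..<b}. g x \<partial>lborel)" by (intro nn_integral_mono) (auto simp: indicator_def)
    also have "\<dots> < \<infinity>" by (rule fin)
    finally show "emeasure (density lborel ?f) {R<..} < \<infinity>" .
  qed simp_all
  then have "AE x in lborel. ?f x = ?g x"
    by (intro sigma_finite_measure.density_unique[OF sigma_finite_lborel]) auto
  then show ?thesis by eventually_elim (auto simp: indicator_def)
qed simp

lemma nn_integral_symmetric_interval:
  fixes h :: "real \<Rightarrow> ennreal"
  assumes [measurable]: "h \<in> borel_measurable borel"
  shows "(\<integral>\<^sup>+x\<in>{-R<..<R}. h x \<partial>lborel) = (\<integral>\<^sup>+x\<in>{0<..<R}. (h x + h (- x)) \<partial>lborel)"
proof -
  have "(\<integral>\<^sup>+x\<in>{-R<..<R}. h x \<partial>lborel) =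
      (\<integral>\<^sup>+x. h x * indicator {0<..<R} x + h x * indicator {-R<..<0} x \<partial>lborel)"
    using AE_lborel_singleton[of 0]
    by (intro nn_integral_cong_AE) (auto simp: indicator_def elim!: eventually_mono)
  also have "\<dots> = (\<integral>\<^sup>+x. h x * indicator {0<..<R} x \<partial>lborel) + (\<integral>\<^sup>+x. h x * indicator {-R<..<0} x \<partial>distr lborel borel uminus)"
    by (simp add: nn_integral_add lborel_distr_uminus)
  also have "(\<integral>\<^sup>+x. h x * indicator {-R<..<0} x \<partial>distr lborel borel uminus) = (\<integral>\<^sup>+x. h (- x) * indicator {0<..<R} x \<partial>lborel)"
    by (subst nn_integral_distr) (auto intro!: nn_integral_cong simp: indicator_def)
  finally show ?thesis by (simp add: nn_integral_add[symmetric] distrib_right)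
qed

context haar begin

text \<open>The moment of order \<open>s\<close> of the product is integrated against a weight in the radius that is supported
in the disc of radius \<open>R\<close>. By \<open>power_weight_slice\<close> the integral over \<open>y\<close> along every vertical slice
of that disc is the same constant \<open>C\<close>, so that only the integral of \<open>\<bar>\<psi> x\<bar> powr s\<close> over the interval
is left.\<close>

lemma cauchy_moments_unique:
  fixes s R :: real
  assumes a: "norm a = 1" and p: "CARD('n) \<ge> 3" and ij: "i \<noteq> j" and s: "0 < s" "s < 1" and R: "0 < R" "R \<le> 1"
    and \<psi>: "\<psi> \<in> borel_measurable borel" and T: "tangent_field T"
    and T\<psi>: "agree_off_equator a T (\<lambda>u. \<psi> (a \<bullet> u) *\<^sub>R (a - (a \<bullet> u) *\<^sub>R u))"
    and cauchy: "cauchy_on_planes H i j T"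
    and \<psi>': "\<psi>' \<in> borel_measurable borel" and T': "tangent_field T'"
    and T\<psi>': "agree_off_equator a T' (\<lambda>u. \<psi>' (a \<bullet> u) *\<^sub>R (a - (a \<bullet> u) *\<^sub>R u))"
    and cauchy': "cauchy_on_planes H i j T'"
  shows "(\<integral>\<^sup>+x\<in>{-R<..<R}. ennreal (\<bar>\<psi> x\<bar> powr s) \<partial>lborel) = (\<integral>\<^sup>+x\<in>{-R<..<R}. ennreal (\<bar>\<psi>' x\<bar> powr s) \<partial>lborel)"
proof -
  note id_borel[measurable]
  define \<beta> where "\<beta> = (s + 1) / 2"
  obtain C where C: "C \<noteq> 0" "C \<noteq> \<infinity>"
    and slice: "\<And>q. q > 0 \<Longrightarrow> (\<integral>\<^sup>+y. ennreal (\<bar>y\<bar> powr s * (q - y\<^sup>2) powr - \<beta>) * indicator {y. y\<^sup>2 < q} y \<partial>lborel) = C"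
    using power_weight_slice[OF s] unfolding \<beta>_def by blast
  obtain m where m[measurable]: "m \<in> borel_measurable borel" and "\<And>q. q < 1 \<Longrightarrow> 0 < m q"
    and density: "\<And>F. F \<in> borel_measurable (borel \<Otimes>\<^sub>M borel) \<Longrightarrow>
      (\<integral>\<^sup>+Q. F (a \<bullet> column i Q, a \<bullet> column j Q) * m ((a \<bullet> column i Q)\<^sup>2 + (a \<bullet> column j Q)\<^sup>2) \<partial>H) =
      (\<integral>\<^sup>+t. (\<integral>\<^sup>+v. F (t, v) * indicator {v. t\<^sup>2 + v\<^sup>2 < 1} v \<partial>lborel) \<partial>lborel)"
    by (rule planar_projection_density[OF a p ij]) (rule that)
  \<comment> \<open>The factor \<open>m\<close> in \<open>g\<close> converts the law of the projections into Lebesgue measure on the disc.\<close>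
  define k where "k q = ennreal ((R\<^sup>2 - q) powr - \<beta>) * indicator {..<R\<^sup>2} q" for q
  have [measurable]: "k \<in> borel_measurable borel" unfolding k_def by measurable
  define g where "g = (\<lambda>(q, x). ennreal (\<bar>x\<bar> powr s) * k q * m q)"
  have g[measurable]: "g \<in> borel_measurable (borel \<Otimes>\<^sub>M borel)" unfolding g_def by measurable
  define E where "E = (\<integral>\<^sup>+Q. (\<integral>\<^sup>+x. g ((a \<bullet> column i Q)\<^sup>2 + (a \<bullet> column j Q)\<^sup>2, x) \<partial>standard_cauchy) \<partial>H)"
  have key: "C * (\<integral>\<^sup>+x\<in>{-R<..<R}. ennreal (\<bar>\<psi> x\<bar> powr s) \<partial>lborel) = E"
    if [measurable]: "\<psi> \<in> borel_measurable borel" and T: "tangent_field T"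
    and T\<psi>: "agree_off_equator a T (\<lambda>u. \<psi> (a \<bullet> u) *\<^sub>R (a - (a \<bullet> u) *\<^sub>R u))"
    and cauchy: "cauchy_on_planes H i j T" for \<psi> T
  proof -
    define F where "F = (\<lambda>(t, v). ennreal (\<bar>\<psi> t * v\<bar> powr s) * k (t\<^sup>2 + v\<^sup>2))"
    have F[measurable]: "F \<in> borel_measurable (borel \<Otimes>\<^sub>M borel)" unfolding F_def by measurable
    have "E = (\<integral>\<^sup>+Q. g ((a \<bullet> column i Q)\<^sup>2 + (a \<bullet> column j Q)\<^sup>2, T (column i Q) \<bullet> column j Q) \<partial>H)"
      unfolding E_def by (rule cauchy_on_planes_joint_law[OF a ij T cauchy g, symmetric])
    also have "\<dots> = (\<integral>\<^sup>+Q. F (a \<bullet> column i Q, a \<bullet> column j Q) * m ((a \<bullet> column i Q)\<^sup>2 + (a \<bullet> column j Q)\<^sup>2) \<partial>H)"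
      using AE_tangent_field_product[OF a ij T\<psi>]
      by (intro nn_integral_cong_AE) (auto simp: g_def F_def elim!: eventually_mono)
    also have "\<dots> = (\<integral>\<^sup>+t. (\<integral>\<^sup>+v. F (t, v) * indicator {v. t\<^sup>2 + v\<^sup>2 < 1} v \<partial>lborel) \<partial>lborel)"
      by (rule density[OF F])
    also have "\<dots> = (\<integral>\<^sup>+t. C * (ennreal (\<bar>\<psi> t\<bar> powr s) * indicator {-R<..<R} t) \<partial>lborel)"
    proof (rule nn_integral_cong)
      fix t :: real
      have R1: "R\<^sup>2 \<le> 1" using R by (simp add: power_le_one)
      have tR: "t\<^sup>2 < R\<^sup>2 \<longleftrightarrow> t \<in> {-R<..<R}" using R abs_le_square_iff[of R t] by auto
      have "F (t, v) * indicator {v. t\<^sup>2 + v\<^sup>2 < 1} v =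
          ennreal (\<bar>\<psi> t\<bar> powr s) * (ennreal (\<bar>v\<bar> powr s * ((R\<^sup>2 - t\<^sup>2) - v\<^sup>2) powr - \<beta>) * indicator {v. v\<^sup>2 < R\<^sup>2 - t\<^sup>2} v)" for v
      proof (cases "v\<^sup>2 < R\<^sup>2 - t\<^sup>2")
        case True
        then have "t\<^sup>2 + v\<^sup>2 < R\<^sup>2" "t\<^sup>2 + v\<^sup>2 < 1" using R1 by auto
        then show ?thesis using True
          by (simp add: F_def k_def abs_mult powr_mult ennreal_mult diff_diff_eq mult.assoc)
      qed (auto simp: F_def k_def)
      then have "(\<integral>\<^sup>+v. F (t, v) * indicator {v. t\<^sup>2 + v\<^sup>2 < 1} v \<partial>lborel) =
        ennreal (\<bar>\<psi> t\<bar> powr s) * (\<integral>\<^sup>+v. ennreal (\<bar>v\<bar> powr s * ((R\<^sup>2 - t\<^sup>2) - v\<^sup>2) powr - \<beta>) * indicator {v. v\<^sup>2 < R\<^sup>2 - t\<^sup>2} v \<partial>lborel)"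
        by (simp add: nn_integral_cmult)
      also have "\<dots> = C * (ennreal (\<bar>\<psi> t\<bar> powr s) * indicator {-R<..<R} t)"
      proof (cases "t\<^sup>2 < R\<^sup>2")
        case True
        then show ?thesis using slice[of "R\<^sup>2 - t\<^sup>2"] tR by (simp add: mult.commute)
      next
        case False
        then have "\<not> v\<^sup>2 < R\<^sup>2 - t\<^sup>2" for v :: real using zero_le_power2[of v] by linarith
        then have "{v::real. v\<^sup>2 < R\<^sup>2 - t\<^sup>2} = {}" by simp
        then show ?thesis using False tR by simp
      qed
      finally show "(\<integral>\<^sup>+v. F (t, v) * indicator {v. t\<^sup>2 + v\<^sup>2 < 1} v \<partial>lborel) =
        C * (ennreal (\<bar>\<psi> t\<bar> powr s) * indicator {-R<..<R} t)" .
    qed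
    also have "\<dots> = C * (\<integral>\<^sup>+x\<in>{-R<..<R}. ennreal (\<bar>\<psi> x\<bar> powr s) \<partial>lborel)"
      by (rule nn_integral_cmult) measurable
    finally show ?thesis ..
  qed
  show ?thesis
    using trans[OF key[OF \<psi> T T\<psi> cauchy] key[OF \<psi>' T' T\<psi>' cauchy', symmetric]] C
    unfolding ennreal_mult_cancel_left by simp
qed

text \<open>Compare with the field \<open>T0\<close> of the profile \<open>1 / t\<close>, which has the Cauchy property by
\<open>cauchy_on_planes_if_reciprocal\<close>. Moments over symmetric intervals only determine the sum of the
contributions of \<open>x\<close> and \<open>- x\<close>; the two orders \<open>1/4\<close> and \<open>1/2\<close> together separate them.\<close>

lemma reciprocal_if_cauchy_on_planes:
  assumes a: "norm a = 1" and p: "CARD('n) \<ge> 3" and ij: "i \<noteq> j"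
    and \<psi>[measurable]: "\<psi> \<in> borel_measurable borel" and T: "tangent_field T"
    and T\<psi>: "agree_off_equator a T (\<lambda>u. \<psi> (a \<bullet> u) *\<^sub>R (a - (a \<bullet> u) *\<^sub>R u))"
    and cauchy: "cauchy_on_planes H i j T"
  shows "AE t in lborel. t \<in> {-1<..<1} \<longrightarrow> \<bar>\<psi> t\<bar> = 1 / \<bar>t\<bar>"
proof -
  \<comment> \<open>Written with the profile rather than as the reciprocal field, it is tangent on the equator as well, since \<open>1 / 0 = 0\<close>.\<close>
  define T0 where "T0 u = (1 / (a \<bullet> u)) *\<^sub>R (a - (a \<bullet> u) *\<^sub>R u)" for u
  have "T0 \<in> borel_measurable borel" unfolding T0_def by measurable
  then have T0: "tangent_field T0"
    unfolding tangent_field_def unit_sphere_def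
    by (auto intro!: measurable_restrict_space1 simp: T0_def inner_diff_right inner_commute norm_eq_1)
  have T0_agree: "agree_off_equator a T0 (\<lambda>u. (1 / (a \<bullet> u)) *\<^sub>R (a - (a \<bullet> u) *\<^sub>R u))"
    by (simp add: agree_off_equator_def T0_def)
  have T0_cauchy: "cauchy_on_planes H i j T0"
    by (rule cauchy_on_planes_if_reciprocal[OF a p ij _ T0 T0_agree]) auto
  have moment: "AE x in lborel. x \<in> {0<..<1} \<longrightarrow> \<bar>\<psi> x\<bar> powr s + \<bar>\<psi> (- x)\<bar> powr s = 2 * x powr - s"
    if s: "0 < s" "s < 1" for s
  proof -
    let ?f = "\<lambda>x. ennreal (\<bar>\<psi> x\<bar> powr s) + ennreal (\<bar>\<psi> (- x)\<bar> powr s)"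
    let ?g = "\<lambda>x. ennreal (\<bar>1 / x\<bar> powr s) + ennreal (\<bar>1 / - x\<bar> powr s)"
    have "AE x in lborel. x \<in> {0<..<1} \<longrightarrow> ?f x = ?g x"
    proof (rule AE_eq_if_interval_integrals_eq)
      show "(\<integral>\<^sup>+x\<in>{0<..<R}. ?f x \<partial>lborel) = (\<integral>\<^sup>+x\<in>{0<..<R}. ?g x \<partial>lborel)" if R: "0 < R" "R \<le> 1" for R
        using cauchy_moments_unique[OF a p ij s R \<psi> T T\<psi> cauchy _ T0 T0_agree T0_cauchy]
          nn_integral_symmetric_interval[of "\<lambda>x. ennreal (\<bar>\<psi> x\<bar> powr s)" R]
          nn_integral_symmetric_interval[of "\<lambda>x. ennreal (\<bar>1 / x\<bar> powr s)" R]
        by simp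
      have "(\<integral>\<^sup>+x\<in>{0<..<1}. ?g x \<partial>lborel) = (\<integral>\<^sup>+x. 2 * (ennreal (x powr - s) * indicator {0<..<1} x) \<partial>lborel)"
        by (intro nn_integral_cong) (auto simp: indicator_def powr_minus powr_divide inverse_eq_divide mult_2)
      also have "\<dots> = 2 * (\<integral>\<^sup>+x\<in>{0<..<1}. ennreal (x powr - s) \<partial>lborel)" by (rule nn_integral_cmult) measurable
      also have "\<dots> < \<infinity>" using nn_integral_powr_finite[of s 1] s by (simp add: ennreal_mult_less_top)
      finally show "(\<integral>\<^sup>+x\<in>{0<..<1}. ?g x \<partial>lborel) < \<infinity>" .
    qed measurable
    then show ?thesis
    proof eventually_elim
      case (elim x)
      show ?case
      proof
        assume x: "x \<in> {0<..<1}"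
        have "ennreal (\<bar>\<psi> x\<bar> powr s + \<bar>\<psi> (- x)\<bar> powr s) = ennreal (2 * x powr - s)"
          using elim x by (simp add: powr_minus powr_divide inverse_eq_divide flip: ennreal_plus)
        then show "\<bar>\<psi> x\<bar> powr s + \<bar>\<psi> (- x)\<bar> powr s = 2 * x powr - s"
          by (subst (asm) ennreal_inj) auto
      qed
    qed
  qed
  have pos: "AE x in lborel. x \<in> {0<..<1} \<longrightarrow> \<bar>\<psi> x\<bar> = 1 / \<bar>x\<bar> \<and> \<bar>\<psi> (- x)\<bar> = 1 / \<bar>x\<bar>"
    using moment[of "1/4", simplified] moment[of "1/2", simplified]
  proof eventually_elim
    case (elim x)
    show ?case
    proof
      assume x: "x \<in> {0<..<1}"
      define A where "A = (x * \<bar>\<psi> x\<bar>) powr (1/4)"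
      define B where "B = (x * \<bar>\<psi> (- x)\<bar>) powr (1/4)"
      have sq: "(y powr (1/4))\<^sup>2 = y powr (1/2)" if "y \<ge> 0" for y :: real
        using that by (simp add: power2_eq_square flip: powr_add)
      have scale: "(x * y) powr s + (x * z) powr s = 2"
        if "y powr s + z powr s = 2 * x powr - s" "y \<ge> 0" "z \<ge> 0" for y z s
      proof -
        have "(x * y) powr s + (x * z) powr s = x powr s * (y powr s + z powr s)"
          using that(2,3) x by (simp add: powr_mult distrib_left)
        also have "\<dots> = 2 * (x powr s * x powr - s)" by (simp only: that(1) mult.left_commute)
        also have "x powr s * x powr - s = 1" using x by (simp flip: powr_add)
        finally show ?thesis by simp
      qed
      have "A + B = 2" "A\<^sup>2 + B\<^sup>2 = 2"
        using elim x scale[of "\<bar>\<psi> x\<bar>" "1/4" "\<bar>\<psi> (- x)\<bar>"] scale[of "\<bar>\<psi> x\<bar>" "1/2" "\<bar>\<psi> (- x)\<bar>"]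
        by (simp_all add: A_def B_def sq)
      then have "(A - 1)\<^sup>2 + (B - 1)\<^sup>2 = 0" by (simp add: power2_diff)
      then have AB: "A = 1" "B = 1" by (simp_all add: sum_power2_eq_zero_iff)
      have root: "y = 1" if "y powr (1/4) = 1" "y \<ge> 0" for y :: real
      proof -
        have "(y powr (1/4)) powr 4 = y" using that(2) by (simp add: powr_powr)
        then show ?thesis unfolding that(1) by simp
      qed
      have "x * \<bar>\<psi> x\<bar> = 1" "x * \<bar>\<psi> (- x)\<bar> = 1"
        using root[OF AB(1)[unfolded A_def]] root[OF AB(2)[unfolded B_def]] x by simp_all
      then show "\<bar>\<psi> x\<bar> = 1 / \<bar>x\<bar> \<and> \<bar>\<psi> (- x)\<bar> = 1 / \<bar>x\<bar>" using x by (simp add: field_simps)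
    qed
  qed
  then have "AE x in distr lborel borel uminus. x \<in> {0<..<1} \<longrightarrow> \<bar>\<psi> x\<bar> = 1 / \<bar>x\<bar> \<and> \<bar>\<psi> (- x)\<bar> = 1 / \<bar>x\<bar>"
    by (simp only: lborel_distr_uminus)
  then have "AE x in lborel. - x \<in> {0<..<1} \<longrightarrow> \<bar>\<psi> (- x)\<bar> = 1 / \<bar>x\<bar> \<and> \<bar>\<psi> x\<bar> = 1 / \<bar>x\<bar>"
    by (subst (asm) AE_distr_iff) auto
  with pos AE_lborel_singleton[of 0] show ?thesis
    by eventually_elim auto
qed

end

section \<open>Signs, parity and continuity\<close>

lemma norm_tangential_part:
  fixes a u :: "real ^ 'n"
  assumes "norm a = 1" "norm u = 1"
  shows "(norm (a - (a \<bullet> u) *\<^sub>R u))\<^sup>2 = 1 - (a \<bullet> u)\<^sup>2"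
proof -
  have "a \<bullet> a = 1" "u \<bullet> u = 1" using assms by (simp_all add: norm_eq_1)
  then show ?thesis
    unfolding power2_norm_eq_inner by (simp add: inner_diff_left inner_diff_right inner_commute power2_eq_square)
qed

lemma reciprocal_field_eq:
  assumes "a \<bullet> u \<noteq> 0"
  shows "reciprocal_field a u = (1 / (a \<bullet> u)) *\<^sub>R (a - (a \<bullet> u) *\<^sub>R u)"
  using assms by (simp add: reciprocal_field_def scaleR_diff_right)

text \<open>The values of the profile at \<open>\<plusminus> 1\<close> do not influence the field, because the tangential part of \<open>a\<close>
vanishes at the poles \<open>\<plusminus> a\<close>.\<close>

lemma agree_off_equator_profile_cong:
  fixes a :: "real ^ 'n"
  assumes a: "norm a = 1" and eq: "\<And>t. t \<in> {-1<..<0} \<union> {0<..<1} \<Longrightarrow> \<psi> t = \<phi> t"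
  shows "agree_off_equator a T (\<lambda>u. \<psi> (a \<bullet> u) *\<^sub>R (a - (a \<bullet> u) *\<^sub>R u)) \<longleftrightarrow>
    agree_off_equator a T (\<lambda>u. \<phi> (a \<bullet> u) *\<^sub>R (a - (a \<bullet> u) *\<^sub>R u))"
proof -
  have "\<psi> (a \<bullet> u) *\<^sub>R (a - (a \<bullet> u) *\<^sub>R u) = \<phi> (a \<bullet> u) *\<^sub>R (a - (a \<bullet> u) *\<^sub>R u)"
    if "norm u = 1" "a \<bullet> u \<noteq> 0" for u
  proof (cases "\<bar>a \<bullet> u\<bar> < 1")
    case True
    then have "a \<bullet> u \<in> {-1<..<0} \<union> {0<..<1}" using that(2) by (auto simp: abs_less_iff)
    then show ?thesis using eq[of "a \<bullet> u"] by simp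
  next
    case False
    moreover have "\<bar>a \<bullet> u\<bar> \<le> 1" using Cauchy_Schwarz_ineq2[of a u] a that by simp
    ultimately have "(a \<bullet> u)\<^sup>2 = 1" by (simp add: abs_square_eq_1)
    then have "a - (a \<bullet> u) *\<^sub>R u = 0" using norm_tangential_part[OF a that(1)] by simp
    then show ?thesis by simp
  qed
  then show ?thesis by (auto simp add: agree_off_equator_def simp del: scaleR_cancel_right)
qed

text \<open>Every height \<open>t\<close> strictly between the poles is attained at some \<open>u\<close>, and the tangential part of \<open>a\<close> is
the same at \<open>u\<close> and at \<open>- u\<close>.\<close>

lemma odd_profile:
  fixes a :: "real ^ 'n"
  assumes a: "norm a = 1" and p: "CARD('n) \<ge> 2"
    and T: "agree_off_equator a T (\<lambda>u. \<psi> (a \<bullet> u) *\<^sub>R (a - (a \<bullet> u) *\<^sub>R u))"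
    and odd: "agree_off_equator a (\<lambda>u. T (- u)) (\<lambda>u. - T u)"
    and t: "t \<in> {-1<..<0} \<union> {0<..<1}"
  shows "\<psi> (- t) = - \<psi> t"
proof -
  have "2 \<le> DIM(real ^ 'n)" using p by simp
  then obtain y where y: "y \<noteq> 0" "orthogonal a y" by (rule orthogonal_to_vector_exists)
  define b where "b = y /\<^sub>R norm y"
  have b: "b \<bullet> b = 1" "a \<bullet> b = 0" "b \<bullet> a = 0" and aa: "a \<bullet> a = 1"
    using y a by (auto simp: b_def orthogonal_def inner_commute norm_eq_1 power2_norm_eq_inner[symmetric] dot_square_norm power2_eq_square)
  have t1: "t \<noteq> 0" "t\<^sup>2 < 1" using t by (auto simp: abs_square_less_1)
  define u where "u = t *\<^sub>R a + sqrt (1 - t\<^sup>2) *\<^sub>R b"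
  have au: "a \<bullet> u = t" by (simp add: u_def inner_add_right aa b)
  have "u \<bullet> u = t\<^sup>2 + (sqrt (1 - t\<^sup>2))\<^sup>2"
    by (simp add: u_def inner_add_right inner_add_left aa b power2_eq_square)
  then have u: "norm u = 1" using t1 by (simp add: norm_eq_1)
  have "\<psi> (- t) *\<^sub>R (a - t *\<^sub>R u) = T (- u)"
    using T u au t1 by (simp add: agree_off_equator_def)
  also have "\<dots> = - T u" using odd u au t1 by (simp add: agree_off_equator_def)
  also have "\<dots> = - \<psi> t *\<^sub>R (a - t *\<^sub>R u)"
    using T u au t1 by (simp add: agree_off_equator_def)
  finally have "(\<psi> (- t) + \<psi> t) *\<^sub>R (a - t *\<^sub>R u) = 0" by (simp add: scaleR_add_left)
  moreover have "a - t *\<^sub>R u \<noteq> 0" using norm_tangential_part[OF a u] au t1 by auto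
  ultimately show ?thesis by simp
qed

text \<open>By continuity the equation holds everywhere: the set where it fails is open and null. Then
\<open>t * \<psi> t\<close> is continuous on an interval with values in \<open>{-1, 1}\<close>.\<close>

lemma continuous_unimodular_AE_constant:
  fixes \<psi> :: "real \<Rightarrow> real"
  assumes cont: "continuous_on {0<..<1} \<psi>"
    and rec: "AE t in lborel. t \<in> {0<..<1} \<longrightarrow> \<bar>\<psi> t\<bar> = 1 / \<bar>t\<bar>"
  obtains c where "c \<in> {-1, 1}" "\<And>t. t \<in> {0<..<1} \<Longrightarrow> \<psi> t = c / t"
proof -
  let ?I = "{0<..<1::real}"
  let ?g = "\<lambda>t. t * \<psi> t"
  have g: "continuous_on ?I ?g" using cont by (intro continuous_intros)
  have abs1: "\<bar>?g t\<bar> = 1" if t: "t \<in> ?I" for t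
  proof (rule ccontr)
    assume ne: "\<bar>?g t\<bar> \<noteq> 1"
    let ?S = "?I \<inter> (\<lambda>t. \<bar>?g t\<bar>) -` (- {1})"
    have "continuous_on ?I (\<lambda>t. \<bar>?g t\<bar>)" using g by (rule continuous_on_rabs)
    then have S: "open ?S" by (intro continuous_open_preimage) auto
    have "AE t in lborel. t \<notin> ?S"
      using rec by eventually_elim (auto simp: abs_mult)
    then have "?S \<in> null_sets lborel" using S by (subst AE_iff_null_sets) auto
    then have "negligible ?S" by (auto simp: negligible_iff_null_sets null_sets_completionI)
    moreover have "t \<in> ?S" using ne t by simp
    ultimately show False using open_not_negligible[OF S] by blast
  qed
  then have "?g ` ?I \<subseteq> {-1, 1}" by (force simp: abs_if split: if_splits)
  then have "finite (?g ` ?I)" by (rule finite_subset) simp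
  then have "?g constant_on ?I"
    using g by (intro continuous_finite_range_constant) auto
  then obtain c where c: "\<And>t. t \<in> ?I \<Longrightarrow> ?g t = c" by (auto simp: constant_on_def)
  have "\<bar>c\<bar> = 1" using abs1[of "1/2"] c[of "1/2"] by simp
  then have "c \<in> {-1, 1}" by (auto simp: abs_if split: if_splits)
  then show thesis using c by (intro that[of c]) (auto simp: field_simps)
qed

lemma (in haar) AE_sphere_iff:
  assumes a: "norm a = 1" and p: "CARD('n) \<ge> 3" and N[measurable]: "N \<in> sets borel"
  shows "(AE u in distr H unit_sphere (column i). a \<bullet> u \<notin> N) \<longleftrightarrow> (AE t in lborel. t \<in> {-1<..<1} \<longrightarrow> t \<notin> N)"
proof -
  note id_borel[measurable]
  obtain j where ij: "i \<noteq> j"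
  proof -
    have "\<not> UNIV \<subseteq> {i}" using card_mono[of "{i}" UNIV] p by auto
    then obtain j where "j \<noteq> i" by auto
    then show ?thesis using that[of j] by simp
  qed
  have col: "column i \<in> measurable H unit_sphere"
    unfolding unit_sphere_def
    by (rule measurable_restrict_space2) (auto simp: space_haar orthogonal_matrix_orthonormal_columns)
  have "(\<lambda>u. a \<bullet> u) \<in> borel_measurable unit_sphere"
    unfolding unit_sphere_def by (intro measurable_restrict_space1) simp
  then have "{u \<in> space unit_sphere. a \<bullet> u \<notin> N} \<in> sets unit_sphere" by measurable
  from AE_distr_iff[OF col this] AE_projection_iff[OF a p ij N] show ?thesis by simp
qed

theorem theorem6p3:
  fixes H :: "(real ^ 'n ^ 'n) measure" and i j :: 'n
    and a :: "real ^ 'n" and \<psi> :: "real \<Rightarrow> real" and T :: "real ^ 'n \<Rightarrow> real ^ 'n"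
  assumes p: "CARD('n) \<ge> 3"
    and H: "haar_orthogonal H"
    and ij: "i \<noteq> j"
    and a: "a \<in> sphere 0 1"
    and psi: "\<psi> \<in> borel_measurable (restrict_space borel ({-1<..<0} \<union> {0<..<1}))"
    and T: "tangent_field T"
    and T_psi: "agree_off_equator a T (\<lambda>u. \<psi> (a \<bullet> u) *\<^sub>R (a - (a \<bullet> u) *\<^sub>R u))"
  shows
    "(cauchy_on_planes H i j T \<longleftrightarrow>
        (AE t in lborel. t \<in> {-1<..<1} \<longrightarrow> \<bar>\<psi> t\<bar> = 1 / \<bar>t\<bar>)) \<and>
     (cauchy_on_planes H i j T \<and> agree_off_equator a (\<lambda>u. T (- u)) (\<lambda>u. - T u) \<longrightarrow>
        (\<exists>\<epsilon>. sign_function \<epsilon> \<and>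
           (AE u in distr H unit_sphere (column i). T u = \<epsilon> \<bar>a \<bullet> u\<bar> *\<^sub>R reciprocal_field a u))) \<and>
     (\<forall>\<epsilon> S. sign_function \<epsilon> \<and> tangent_field S \<and>
        agree_off_equator a S (\<lambda>u. \<epsilon> \<bar>a \<bullet> u\<bar> *\<^sub>R reciprocal_field a u) \<longrightarrow>
        cauchy_on_planes H i j S) \<and>
     (cauchy_on_planes H i j T \<and> agree_off_equator a (\<lambda>u. T (- u)) (\<lambda>u. - T u) \<and>
      continuous_on {-1<..<0} \<psi> \<and> continuous_on {0<..<1} \<psi> \<longrightarrow>
        (\<forall>\<epsilon>. sign_function \<epsilon> \<and>
           (AE u in distr H unit_sphere (column i). T u = \<epsilon> \<bar>a \<bullet> u\<bar> *\<^sub>R reciprocal_field a u) \<longrightarrow>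
           (\<exists>c \<in> {-1, 1}. AE t in lborel. t \<in> {0<..<1} \<longrightarrow> \<epsilon> t = c)) \<and>
        (agree_off_equator a T (reciprocal_field a) \<or>
         agree_off_equator a T (\<lambda>u. - reciprocal_field a u)))"
proof -
  interpret haar H by unfold_locales (rule H)
  let ?D = "{-1<..<0} \<union> {0<..<1::real}"
  have na: "norm a = 1" using a by simp
  have p2: "CARD('n) \<ge> 2" using p by simp
  \<comment> \<open>A Borel function on the whole line with the same field off the equator.\<close>
  define \<phi> where "\<phi> t = (if t \<in> ?D then \<psi> t else 0)" for t
  have phi[measurable]: "\<phi> \<in> borel_measurable borel"
    unfolding \<phi>_def using psi by (subst (asm) measurable_restrict_space_iff[where c=0]) auto
  have T_phi: "agree_off_equator a T (\<lambda>u. \<phi> (a \<bullet> u) *\<^sub>R (a - (a \<bullet> u) *\<^sub>R u))"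
    using T_psi agree_off_equator_profile_cong[OF na, of \<psi> \<phi> T] by (simp add: \<phi>_def)
  have AE_phi: "(AE t in lborel. t \<in> {-1<..<1} \<longrightarrow> \<bar>\<phi> t\<bar> = 1 / \<bar>t\<bar>) \<longleftrightarrow>
      (AE t in lborel. t \<in> {-1<..<1} \<longrightarrow> \<bar>\<psi> t\<bar> = 1 / \<bar>t\<bar>)"
  proof -
    have "\<bar>\<phi> t\<bar> = 1 / \<bar>t\<bar> \<longleftrightarrow> \<bar>\<psi> t\<bar> = 1 / \<bar>t\<bar>" if "t \<in> {-1<..<1}" "t \<noteq> 0" for t
      using that by (auto simp: \<phi>_def)
    then show ?thesis
      using AE_lborel_singleton[of 0] by (intro iffI; elim AE_mp; auto elim!: eventually_mono)
  qed
  have equiv: "cauchy_on_planes H i j T \<longleftrightarrow> (AE t in lborel. t \<in> {-1<..<1} \<longrightarrow> \<bar>\<psi> t\<bar> = 1 / \<bar>t\<bar>)"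
    using cauchy_on_planes_if_reciprocal[OF na p ij phi T T_phi] reciprocal_if_cauchy_on_planes[OF na p ij phi T T_phi]
    unfolding AE_phi by blast
  have extend: "(\<lambda>t. if t \<in> {0<..<1} then \<epsilon> t else 1) \<in> borel_measurable borel"
    if "sign_function \<epsilon>" for \<epsilon> :: "real \<Rightarrow> real"
    using that unfolding sign_function_def by (subst (asm) measurable_restrict_space_iff[where c=1]) auto
  have odd_part: "\<exists>\<epsilon>. sign_function \<epsilon> \<and> (AE u in distr H unit_sphere (column i). T u = \<epsilon> \<bar>a \<bullet> u\<bar> *\<^sub>R reciprocal_field a u)"
    if cauchy: "cauchy_on_planes H i j T" and odd: "agree_off_equator a (\<lambda>u. T (- u)) (\<lambda>u. - T u)"
  proof -
    define \<epsilon> :: "real \<Rightarrow> real" where "\<epsilon> t = (if t * \<phi> t \<ge> 0 then 1 else -1)" for t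
    have "\<epsilon> \<in> borel_measurable borel" unfolding \<epsilon>_def by measurable
    then have sign: "sign_function \<epsilon>" unfolding sign_function_def by (auto intro: measurable_restrict_space1 simp: \<epsilon>_def)
    let ?N = "- {t. t \<in> ?D \<and> \<bar>\<phi> t\<bar> = 1 / \<bar>t\<bar>}"
    have N: "?N \<in> sets borel" by measurable
    have "AE t in lborel. t \<in> {-1<..<1} \<longrightarrow> t \<notin> ?N"
      using reciprocal_if_cauchy_on_planes[OF na p ij phi T T_phi cauchy] AE_lborel_singleton[of 0]
      by eventually_elim auto
    then have "AE u in distr H unit_sphere (column i). a \<bullet> u \<notin> ?N"
      using AE_sphere_iff[OF na p N] by simp
    then have "AE u in distr H unit_sphere (column i). T u = \<epsilon> \<bar>a \<bullet> u\<bar> *\<^sub>R reciprocal_field a u"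
      using AE_space[of "distr H unit_sphere (column i)"]
    proof eventually_elim
      case (elim u)
      let ?t = "a \<bullet> u"
      have t: "?t \<in> ?D" "?t \<noteq> 0" "\<bar>\<phi> ?t\<bar> = 1 / \<bar>?t\<bar>" using elim by auto
      have "\<phi> ?t = \<epsilon> \<bar>?t\<bar> / ?t"
      proof (cases "?t > 0")
        case True
        then show ?thesis using t by (auto simp: \<epsilon>_def abs_if field_simps zero_le_mult_iff split: if_splits)
      next
        case False
        then have "\<phi> (- ?t) = - \<phi> ?t" using odd_profile[OF na p2 T_phi odd t(1)] by simp
        then show ?thesis using t False by (auto simp: \<epsilon>_def abs_if field_simps zero_le_mult_iff mult_le_0_iff split: if_splits)
      qed
      moreover have "T u = \<phi> ?t *\<^sub>R (a - ?t *\<^sub>R u)"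
        using T_phi elim(2) t(2) by (simp add: agree_off_equator_def unit_sphere_def space_restrict_space)
      ultimately show ?case using t(2) by (simp add: reciprocal_field_eq)
    qed
    with sign show ?thesis by blast
  qed
  have converse: "cauchy_on_planes H i j S"
    if sign: "sign_function \<epsilon>" and S: "tangent_field S"
      and agree: "agree_off_equator a S (\<lambda>u. \<epsilon> \<bar>a \<bullet> u\<bar> *\<^sub>R reciprocal_field a u)" for \<epsilon> S
  proof -
    define \<epsilon>' where "\<epsilon>' t = (if t \<in> {0<..<1} then \<epsilon> t else 1)" for t
    have [measurable]: "\<epsilon>' \<in> borel_measurable borel" unfolding \<epsilon>'_def by (rule extend[OF sign])
    have eps1: "\<bar>\<epsilon>' t\<bar> = 1" for t
    proof (cases "t \<in> {0<..<1}")
      case True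
      then have "\<epsilon> t \<in> {-1, 1}" using sign by (simp add: sign_function_def)
      then show ?thesis using True by (auto simp: \<epsilon>'_def)
    qed (auto simp: \<epsilon>'_def)
    have "agree_off_equator a S (\<lambda>u. (\<epsilon> \<bar>a \<bullet> u\<bar> / (a \<bullet> u)) *\<^sub>R (a - (a \<bullet> u) *\<^sub>R u))"
      using agree by (simp add: agree_off_equator_def reciprocal_field_eq)
    then have "agree_off_equator a S (\<lambda>u. (\<epsilon>' \<bar>a \<bullet> u\<bar> / (a \<bullet> u)) *\<^sub>R (a - (a \<bullet> u) *\<^sub>R u))"
    proof (rule agree_off_equator_profile_cong[OF na, THEN iffD1, rotated])
      show "\<epsilon> \<bar>t\<bar> / t = \<epsilon>' \<bar>t\<bar> / t" if "t \<in> ?D" for t using that by (auto simp: \<epsilon>'_def)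
    qed
    then show ?thesis
      by (intro cauchy_on_planes_if_reciprocal[OF na p ij _ S, of "\<lambda>t. \<epsilon>' \<bar>t\<bar> / t"]) (auto simp: eps1)
  qed
  have continuous_part: "(\<forall>\<epsilon>. sign_function \<epsilon> \<and>
           (AE u in distr H unit_sphere (column i). T u = \<epsilon> \<bar>a \<bullet> u\<bar> *\<^sub>R reciprocal_field a u) \<longrightarrow>
           (\<exists>c \<in> {-1, 1}. AE t in lborel. t \<in> {0<..<1} \<longrightarrow> \<epsilon> t = c)) \<and>
        (agree_off_equator a T (reciprocal_field a) \<or>
         agree_off_equator a T (\<lambda>u. - reciprocal_field a u))"
    if cauchy: "cauchy_on_planes H i j T" and odd: "agree_off_equator a (\<lambda>u. T (- u)) (\<lambda>u. - T u)"
      and cont: "continuous_on {0<..<1} \<psi>"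
  proof -
    have "AE t in lborel. t \<in> {-1<..<1} \<longrightarrow> \<bar>\<psi> t\<bar> = 1 / \<bar>t\<bar>" using cauchy equiv by simp
    then have "AE t in lborel. t \<in> {0<..<1} \<longrightarrow> \<bar>\<psi> t\<bar> = 1 / \<bar>t\<bar>" by eventually_elim auto
    then obtain c where c: "c \<in> {-1, 1}" and psi_c: "\<And>t. t \<in> {0<..<1} \<Longrightarrow> \<psi> t = c / t"
      using continuous_unimodular_AE_constant[OF cont] by blast
    have "\<psi> t = c / t" if t: "t \<in> ?D" for t
    proof (cases "t > 0")
      case False
      then show ?thesis using psi_c[of "- t"] odd_profile[OF na p2 T_psi odd t] t by auto
    qed (use t psi_c in auto)
    then have "agree_off_equator a T (\<lambda>u. (c / (a \<bullet> u)) *\<^sub>R (a - (a \<bullet> u) *\<^sub>R u))"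
      using T_psi agree_off_equator_profile_cong[OF na, of \<psi> "\<lambda>t. c / t" T] by blast
    then have T_c: "agree_off_equator a T (\<lambda>u. c *\<^sub>R reciprocal_field a u)"
      by (simp add: agree_off_equator_def reciprocal_field_eq)
    have "\<exists>c \<in> {-1, 1}. AE t in lborel. t \<in> {0<..<1} \<longrightarrow> \<epsilon> t = c"
      if sign: "sign_function \<epsilon>"
        and eq: "AE u in distr H unit_sphere (column i). T u = \<epsilon> \<bar>a \<bullet> u\<bar> *\<^sub>R reciprocal_field a u" for \<epsilon>
    proof (intro bexI[OF _ c])
      define \<epsilon>' where "\<epsilon>' t = (if t \<in> {0<..<1} then \<epsilon> t else 1)" for t
      have [measurable]: "\<epsilon>' \<in> borel_measurable borel" unfolding \<epsilon>'_def by (rule extend[OF sign])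
      let ?N = "{t. t \<in> ?D \<and> \<epsilon>' \<bar>t\<bar> \<noteq> c}"
      have N: "?N \<in> sets borel" by measurable
      have "AE u in distr H unit_sphere (column i). a \<bullet> u \<notin> ?N"
        using eq AE_space[of "distr H unit_sphere (column i)"]
      proof eventually_elim
        case (elim u)
        show ?case
        proof
          assume "a \<bullet> u \<in> ?N"
          then have t: "a \<bullet> u \<in> ?D" "a \<bullet> u \<noteq> 0" "(a \<bullet> u)\<^sup>2 < 1" "\<epsilon> \<bar>a \<bullet> u\<bar> \<noteq> c"
            by (auto simp: abs_square_less_1 \<epsilon>'_def split: if_splits)
          have u: "norm u = 1" using elim(2) by (simp add: unit_sphere_def space_restrict_space)
          have "T u = c *\<^sub>R reciprocal_field a u" using T_c u t(2) by (simp add: agree_off_equator_def)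
          then have "(\<epsilon> \<bar>a \<bullet> u\<bar> - c) *\<^sub>R reciprocal_field a u = 0" using elim(1) by (simp add: scaleR_diff_left)
          then have "a - (a \<bullet> u) *\<^sub>R u = 0" using t by (simp add: reciprocal_field_eq)
          then show False using norm_tangential_part[OF na u] t(3) by simp
        qed
      qed
      then have "AE t in lborel. t \<in> {-1<..<1} \<longrightarrow> t \<notin> ?N" using AE_sphere_iff[OF na p N] by simp
      then show "AE t in lborel. t \<in> {0<..<1} \<longrightarrow> \<epsilon> t = c"
        by eventually_elim (auto simp: \<epsilon>'_def)
    qed
    moreover have "agree_off_equator a T (reciprocal_field a) \<or> agree_off_equator a T (\<lambda>u. - reciprocal_field a u)"
      using T_c c by auto
    ultimately show ?thesis by blast
  qed
  show ?thesis using equiv odd_part converse continuous_part by blast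
qed

end
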